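(* Fix $\alpha,\beta\in(0,1)$ and $\gamma\ge 1$. Let $p_n\ge n$ with $p_n/n\to\gamma$, $r_n=n^{1-\beta}$, $\delta_n=n^{-\alpha}$, and write $p=p_n$, $r=r_n$, $\delta=\delta_n$. Given the data $X_1,\dots,X_n\in\mathbb{R}^p$, consider testing $H_0^{(n)}$ against $H_1^{(n)}$, where under $H_0^{(n)}$: $X_i\stackrel{iid}{\sim}N(0,I_p)$, and under $H_1^{(n)}$: $(X_i\mid Q)\stackrel{iid}{\sim}N\big(0,\ I_p+\tfrac{\delta}{1-\delta}QQ'\big)$ with $Q$ uniformly distributed on the Stiefel manifold $\mathbb{S}(p,r)$. Let $\lambda_1$ be the largest eigenvalue of $\hat\Sigma=\frac1n\sum_{i=1}^nX_iX_i'$, and consider the Tracy-Widom test, which rejects $H_0^{(n)}$ if and only if $$TW_n:=\frac{\lambda_1-E_0[\lambda_1]}{SD_0(\lambda_1)}\ \ge\ [3\log(n)]^{2/3}.$$ If $\alpha+\beta<1$, then as $n\to\infty$ the level of this test tends to $0$. If additionally $\alpha>2/3$, then the power of this test also tends to $0$.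
   Context: $\mathbb{S}(p,r)=\{Q\in\mathbb{R}^{p\times r}:Q'Q=I_r\}$ is the Stiefel manifold; "uniform" means the law invariant under left multiplication by orthogonal $p\times p$ matrices. $r_n=n^{1-\beta}$ is understood as rounded to an integer. $E_0$ and $SD_0$ denote expectation and standard deviation under $H_0^{(n)}$. Under $H_1^{(n)}$ the law of the data is the mixture over $Q$ (one $Q$ is drawn, common to all $i$). The level of a test is its rejection probability under $H_0^{(n)}$; its power is its rejection probability under $H_1^{(n)}$. *)

theory Defs
  imports
    "HOL-Probability.Probability"
    "Jordan_Normal_Form.Gauss_Jordan_Elimination"
    "Jordan_Normal_Form.Spectral_Radius"
begin

text \<open>
  The dimensions depend on the sample size, so they cannot be types. A point of $R^p$ is a function
  in the space of \<open>\<Pi>\<^sub>M j\<in>{..<p}. lborel\<close>, and a data set is a function \<open>X\<close> where \<open>X i j\<close>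
  is the \<open>j\<close>-th coordinate of the \<open>i\<close>-th observation (both 0-based). The linear algebra is done
  with the matrices of \<open>Jordan_Normal_Form\<close>.
\<close>

text \<open>The density is meaningful only for positive definite \<open>S\<close> of size \<open>p \<times> p\<close>.\<close>

definition gaussian :: "nat \<Rightarrow> real mat \<Rightarrow> (nat \<Rightarrow> real) measure" where
  "gaussian p S = density (\<Pi>\<^sub>M j\<in>{..<p}. lborel)
     (\<lambda>x. ennreal (exp (- (Matrix.vec p x \<bullet> (the (mat_inverse S) *\<^sub>v Matrix.vec p x)) / 2)
                    / sqrt ((2 * pi) ^ p * Determinant.det S)))"

definition stiefel :: "nat \<Rightarrow> nat \<Rightarrow> real mat set" where
  "stiefel p r = {Q \<in> carrier_mat p r. transpose_mat Q * Q = 1\<^sub>m r}"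

text \<open>Borel sets of the Stiefel manifold, as a subspace of $R^{p \times r}$.\<close>

definition stiefel_borel :: "nat \<Rightarrow> nat \<Rightarrow> real mat measure" where
  "stiefel_borel p r = vimage_algebra (stiefel p r)
     (\<lambda>Q. \<lambda>ij\<in>{..<p} \<times> {..<r}. Q $$ ij) (\<Pi>\<^sub>M ij\<in>{..<p} \<times> {..<r}. borel)"

definition uniform_on_stiefel :: "nat \<Rightarrow> nat \<Rightarrow> real mat measure \<Rightarrow> bool" where
  "uniform_on_stiefel p r U \<longleftrightarrow>
     prob_space U \<and> sets U = sets (stiefel_borel p r) \<and>
     (\<forall>H \<in> carrier_mat p p. transpose_mat H * H = 1\<^sub>m p \<longrightarrow> distr U U (\<lambda>Q. H * Q) = U)"

definition law_H0 :: "nat \<Rightarrow> nat \<Rightarrow> (nat \<Rightarrow> nat \<Rightarrow> real) measure" where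
  "law_H0 n p = (\<Pi>\<^sub>M i\<in>{..<n}. gaussian p (1\<^sub>m p))"

text \<open>One \<open>Q\<close> is drawn from \<open>U\<close>; given \<open>Q\<close>, the observations are i.i.d.\<close>

definition law_H1 :: "nat \<Rightarrow> nat \<Rightarrow> real \<Rightarrow> real mat measure \<Rightarrow> (nat \<Rightarrow> nat \<Rightarrow> real) measure" where
  "law_H1 n p d U =
     U \<bind> (\<lambda>Q. \<Pi>\<^sub>M i\<in>{..<n}. gaussian p (1\<^sub>m p + (d / (1 - d)) \<cdot>\<^sub>m (Q * transpose_mat Q)))"

text \<open>The entries of $\frac1n \sum_i X_i X_i'$.\<close>

definition sample_cov :: "nat \<Rightarrow> nat \<Rightarrow> (nat \<Rightarrow> nat \<Rightarrow> real) \<Rightarrow> real mat" where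
  "sample_cov n p X = Matrix.mat p p (\<lambda>(j, k). (\<Sum>i<n. X i j * X i k) / real n)"

definition lambda1 :: "nat \<Rightarrow> nat \<Rightarrow> (nat \<Rightarrow> nat \<Rightarrow> real) \<Rightarrow> real" where
  "lambda1 n p X = Max (spectrum (sample_cov n p X))"

definition E0 :: "nat \<Rightarrow> nat \<Rightarrow> ((nat \<Rightarrow> nat \<Rightarrow> real) \<Rightarrow> real) \<Rightarrow> real" where
  "E0 n p f = (\<integral>X. f X \<partial>law_H0 n p)"

definition SD0 :: "nat \<Rightarrow> nat \<Rightarrow> ((nat \<Rightarrow> nat \<Rightarrow> real) \<Rightarrow> real) \<Rightarrow> real" where
  "SD0 n p f = sqrt (E0 n p (\<lambda>X. (f X - E0 n p f)\<^sup>2))"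

definition TW :: "nat \<Rightarrow> nat \<Rightarrow> (nat \<Rightarrow> nat \<Rightarrow> real) \<Rightarrow> real" where
  "TW n p X = (lambda1 n p X - E0 n p (lambda1 n p)) / SD0 n p (lambda1 n p)"

definition TW_rejection_prob :: "nat \<Rightarrow> nat \<Rightarrow> (nat \<Rightarrow> nat \<Rightarrow> real) measure \<Rightarrow> real" where
  "TW_rejection_prob n p M = measure M {X \<in> space M. TW n p X \<ge> (3 * ln (real n)) powr (2/3)}"

definition TW_level :: "nat \<Rightarrow> nat \<Rightarrow> real" where
  "TW_level n p = TW_rejection_prob n p (law_H0 n p)"

definition TW_power :: "nat \<Rightarrow> nat \<Rightarrow> real \<Rightarrow> real mat measure \<Rightarrow> real" where
  "TW_power n p d U = TW_rejection_prob n p (law_H1 n p d U)"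

end

theory Submission
  imports Defs "HOL-Real_Asymp.Real_Asymp"
begin

text \<open>
  By Chebyshev's inequality the level is at most $1/t_n^2$ with $t_n = [3\log n]^{2/3}$. Under
  $H_1$ the data are $ZD$ up to rotations, with $Z$ standard normal and a diagonal $D$ with entries at most
  $(1-\delta)^{-1/2}$, so that $\lambda_1$ is at most $\lambda_1(Z)/(1-\delta)$; Chebyshev's inequality
  again bounds the power as soon as $\delta = n^{-\alpha}$ is of smaller order than $SD_0(\lambda_1)$. Hence
  it suffices to show that $SD_0(\lambda_1)$ is at least $n^{-\eta}$ for every $\eta > 2/3$ and large $n$.

  Rotations of rows and columns do not change the law of the operator norm but turn $Z$ into a bidiagonal matrix
  with independent chi-distributed entries. With high probability all sums of its centred entries over windows of
  length at most $n^{1/3}$ are small. Summation by parts then shows that the norm is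
  $\sqrt p + \sqrt n$ up to $n^{-1/6+o(1)}$ (the lower bound uses a tent-shaped test vector), and that the top
  singular vectors live on the first $m = n^{1/3+o(1)}$ coordinates. Multiplying the first $m$ diagonal
  entries by $1 + c/\sqrt{mp}$ therefore raises $\lambda_1$ by a multiple of $1/\sqrt{mp} = n^{-2/3-o(1)}$,
  while it changes the law of the Gaussian array only by a small amount in total variation. So the law of
  $\lambda_1$ cannot concentrate at a smaller scale.
\<close>

section \<open>Bidiagonal forms\<close>

text \<open>For the power the decisive comparison is between \<delta> times the null mean of the top
  eigenvalue and its null standard deviation; the mean is bounded, so the exponent 2/3 in the
  theorem is the exponent of that deviation. The window length n^(1/3) balances errors. A vector
  spread over K coordinates loses about K / sqrt n because the chi means decrease along the
  diagonal, and about sqrt n / K^2 because it cannot be constant. Both are n^(-1/6) at K = n^(1/3),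
  and window sums of size sqrt K cost sqrt K / K, again n^(-1/6). This error R fixes the
  localisation: mass at coordinate i costs about i / sqrt p, so the mass sits where i is at most of
  order R * sqrt p, which is the order of m. The scaling is the largest invisible one. Changing m *
  p variances by a relative amount s costs m * p * s^2 in chi-square distance, hence s is of order 1
  / sqrt (m * p), while the eigenvalue moves by order s. The bidiagonal entries are norms of
  disjoint parts of one Gaussian array, so scaling the right part of the array scales exactly the
  leading diagonal entries.\<close>

lemma sum_by_parts:
  fixes x w :: "nat \<Rightarrow> real"
  shows "(\<Sum>k<Suc l. x k * w k) =
    (\<Sum>k<Suc l. x k) * w l - (\<Sum>k<l. (\<Sum>j<Suc k. x j) * (w (Suc k) - w k))"
proof (induction l)
  case (Suc l)
  have "(\<Sum>k<Suc (Suc l). x k * w k) = (\<Sum>k<Suc l. x k * w k) + x (Suc l) * w (Suc l)"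
    by simp
  then show ?case
    unfolding Suc by (simp add: algebra_simps)
qed simp

lemma increment_bound:
  fixes w :: "nat \<Rightarrow> real"
  assumes "k \<le> m"
  shows "\<bar>w m\<bar> \<le> \<bar>w k\<bar> + (\<Sum>i<m. \<bar>w (Suc i) - w i\<bar>)"
proof -
  have "\<bar>w m\<bar> \<le> \<bar>w k\<bar> + (\<Sum>i=k..<m. \<bar>w (Suc i) - w i\<bar>)"
    using assms by (induction m rule: dec_induct) auto
  also have "(\<Sum>i=k..<m. \<bar>w (Suc i) - w i\<bar>) \<le> (\<Sum>i<m. \<bar>w (Suc i) - w i\<bar>)"
    by (rule sum_mono2) auto
  finally show ?thesis by simp
qed

text \<open>Summation by parts inside one block: all partial sums from its start are at most \<tau>,
  so the noise sees only the boundary value of \<open>w\<close> and its variation. The boundary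
  value is in turn at most the mean of |w| plus the variation, whence the factor 2.\<close>

lemma block_noise_bound:
  fixes x w :: "nat \<Rightarrow> real"
  assumes l: "l > 0" and x: "\<And>k. k \<le> l \<Longrightarrow> \<bar>\<Sum>j<k. x j\<bar> \<le> \<tau>"
  shows "\<bar>\<Sum>k<l. x k * w k\<bar> \<le> \<tau> * ((\<Sum>k<l. \<bar>w k\<bar>) / real l + 2 * (\<Sum>k<l. \<bar>w (Suc k) - w k\<bar>))"
proof -
  obtain m where m: "l = Suc m" using l by (cases l) auto
  have \<tau>: "0 \<le> \<tau>" using x[of 0] by simp
  let ?D = "\<Sum>k<l. \<bar>w (Suc k) - w k\<bar>"
  have D: "(\<Sum>k<m. \<bar>w (Suc k) - w k\<bar>) \<le> ?D" by (rule sum_mono2) (auto simp: m)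
  \<comment> \<open>Averages \<open>increment_bound\<close> over the \<open>l\<close> positions of
    the block.\<close>
  have "real l * \<bar>w m\<bar> = (\<Sum>k<l. \<bar>w m\<bar>)" by simp
  also have "\<dots> \<le> (\<Sum>k<l. \<bar>w k\<bar> + ?D)"
  proof (rule sum_mono)
    fix k assume "k \<in> {..<l}"
    then show "\<bar>w m\<bar> \<le> \<bar>w k\<bar> + ?D" using increment_bound[of k m w] D m by simp
  qed
  finally have wm: "\<bar>w m\<bar> \<le> (\<Sum>k<l. \<bar>w k\<bar>) / real l + ?D"
    using l by (simp add: sum.distrib field_simps)
  have "\<bar>\<Sum>k<l. x k * w k\<bar> \<le> \<bar>(\<Sum>k<l. x k) * w m\<bar> + \<bar>\<Sum>k<m. (\<Sum>j<Suc k. x j) * (w (Suc k) - w k)\<bar>"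
    unfolding m sum_by_parts by linarith
  also have "\<dots> \<le> \<tau> * \<bar>w m\<bar> + (\<Sum>k<m. \<tau> * \<bar>w (Suc k) - w k\<bar>)"
  proof (rule add_mono)
    show "\<bar>(\<Sum>k<l. x k) * w m\<bar> \<le> \<tau> * \<bar>w m\<bar>"
      using x[of l] by (auto simp: abs_mult intro: mult_right_mono)
    have "\<bar>\<Sum>k<m. (\<Sum>j<Suc k. x j) * (w (Suc k) - w k)\<bar> \<le> (\<Sum>k<m. \<bar>(\<Sum>j<Suc k. x j) * (w (Suc k) - w k)\<bar>)"
      by (rule sum_abs)
    also have "\<dots> \<le> (\<Sum>k<m. \<tau> * \<bar>w (Suc k) - w k\<bar>)"
      unfolding abs_mult by (intro sum_mono mult_right_mono x) (auto simp: m)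
    finally show "\<bar>\<Sum>k<m. (\<Sum>j<Suc k. x j) * (w (Suc k) - w k)\<bar> \<le> (\<Sum>k<m. \<tau> * \<bar>w (Suc k) - w k\<bar>)" .
  qed
  also have "\<dots> \<le> \<tau> * ((\<Sum>k<l. \<bar>w k\<bar>) / real l + ?D) + \<tau> * ?D"
    unfolding sum_distrib_left[symmetric] by (intro add_mono mult_left_mono wm D \<tau>)
  finally show ?thesis by (simp add: algebra_simps)
qed

text \<open>Cutting the range into blocks of length \<open>l\<close> and adding up
  \<open>block_noise_bound\<close> costs \<tau> / l per unit of mass and 2 * \<tau> per unit of
  variation. Long windows make the mass term small, and slowly varying weights make the other one
  small.\<close>

lemma noise_bound:
  fixes x w :: "nat \<Rightarrow> real"
  assumes l: "l > 0" and \<tau>: "0 \<le> \<tau>"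
    and x: "\<And>s k. k \<le> l \<Longrightarrow> s + k \<le> N \<Longrightarrow> \<bar>\<Sum>j<k. x (s + j)\<bar> \<le> \<tau>"
    and w: "\<And>i. i \<ge> N \<Longrightarrow> w i = 0"
  shows "\<bar>\<Sum>i<N. x i * w i\<bar> \<le> \<tau> * ((\<Sum>i<N. \<bar>w i\<bar>) / real l + 2 * (\<Sum>i<N. \<bar>w (Suc i) - w i\<bar>))"
proof -
  \<comment> \<open>Extension by zero allows padding the range to \<open>N * l\<close>, a whole
    number of blocks; a window that crosses \<open>N\<close> is merely shortened.\<close>
  define y where "y i = (if i < N then x i else 0)" for i
  have y: "\<bar>\<Sum>j<k. y (s + j)\<bar> \<le> \<tau>" if "k \<le> l" for s k
  proof -
    have "(\<Sum>j<k. y (s + j)) = (\<Sum>j<min k (N - s). x (s + j))"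
      by (rule sum.mono_neutral_cong_right) (auto simp: y_def)
    also have "\<bar>\<dots>\<bar> \<le> \<tau>"
    proof (cases "s \<le> N")
      case True
      then show ?thesis using that by (intro x) auto
    qed (use \<tau> in auto)
    finally show ?thesis .
  qed
  have ext: "(\<Sum>i<N * l. f i) = (\<Sum>i<N. f i)" if "\<And>i. i \<ge> N \<Longrightarrow> f i = 0" for f :: "nat \<Rightarrow> real"
    using l that by (intro sum.mono_neutral_right) auto
  have grp: "(\<Sum>i<N * l. f i) = (\<Sum>q<N. \<Sum>k<l. f (q * l + k))" for f :: "nat \<Rightarrow> real"
  proof -
    have "sum f {q * l..<q * l + l} = (\<Sum>k<l. f (q * l + k))" for q
      using sum.shift_bounds_nat_ivl[of f 0 "q * l" l] by (simp add: atLeast0LessThan ac_simps)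
    then show ?thesis by (simp add: sum.nat_group[symmetric])
  qed
  have "\<bar>\<Sum>i<N. x i * w i\<bar> = \<bar>\<Sum>i<N. y i * w i\<bar>" by (simp add: y_def)
  also have "\<dots> = \<bar>\<Sum>i<N * l. y i * w i\<bar>" by (subst ext) (auto simp: w)
  also have "\<dots> = \<bar>\<Sum>q<N. \<Sum>k<l. y (q * l + k) * w (q * l + k)\<bar>" by (simp add: grp)
  also have "\<dots> \<le> (\<Sum>q<N. \<bar>\<Sum>k<l. y (q * l + k) * w (q * l + k)\<bar>)" by (rule sum_abs)
  also have "\<dots> \<le> (\<Sum>q<N. \<tau> * ((\<Sum>k<l. \<bar>w (q * l + k)\<bar>) / real l + 2 * (\<Sum>k<l. \<bar>w (Suc (q * l + k)) - w (q * l + k)\<bar>)))"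
    using block_noise_bound[of l "\<lambda>k. y (_ * l + k)" \<tau> "\<lambda>k. w (_ * l + k)"] l y
    by (intro sum_mono) simp
  also have "\<dots> = \<tau> * ((\<Sum>i<N * l. \<bar>w i\<bar>) / real l + 2 * (\<Sum>i<N * l. \<bar>w (Suc i) - w i\<bar>))"
    unfolding grp by (simp add: sum_distrib_left sum.distrib sum_divide_distrib distrib_left)
  also have "\<dots> = \<tau> * ((\<Sum>i<N. \<bar>w i\<bar>) / real l + 2 * (\<Sum>i<N. \<bar>w (Suc i) - w i\<bar>))"
    by (subst (1 2) ext) (auto simp: w)
  finally show ?thesis .
qed

lemma cauchy_schwarz_unit:
  fixes x y :: "nat \<Rightarrow> real"
  assumes "(\<Sum>i\<in>A. (x i)\<^sup>2) \<le> 1"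
  shows "(\<Sum>i\<in>A. \<bar>x i\<bar> * \<bar>y i\<bar>) \<le> sqrt (\<Sum>i\<in>A. (y i)\<^sup>2)"
proof -
  have "(\<Sum>i\<in>A. \<bar>x i\<bar> * \<bar>y i\<bar>) \<le> L2_set x A * L2_set y A" by (rule L2_set_mult_ineq)
  also have "\<dots> \<le> 1 * L2_set y A"
    using assms by (intro mult_right_mono) (auto simp: L2_set_def sum_nonneg)
  finally show ?thesis by (simp add: L2_set_def)
qed

text \<open>The two gaps measure how far the zigzag u 0, v 0, u 1, v 1, ... is from constant in
  square mean. By \<open>unit_vector_overlap\<close> they are also what a bidiagonal form loses
  through misalignment.\<close>

definition diag_gap :: "nat \<Rightarrow> (nat \<Rightarrow> real) \<Rightarrow> (nat \<Rightarrow> real) \<Rightarrow> real" where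
  "diag_gap n u v = (\<Sum>i<n. (u i - v i)\<^sup>2)"

definition sub_gap :: "nat \<Rightarrow> (nat \<Rightarrow> real) \<Rightarrow> (nat \<Rightarrow> real) \<Rightarrow> real" where
  "sub_gap n u v = (\<Sum>i<n. (u (Suc i) - v i)\<^sup>2)"

lemma gap_nonneg: "0 \<le> diag_gap n u v" "0 \<le> sub_gap n u v"
  by (simp_all add: diag_gap_def sub_gap_def sum_nonneg)

lemma sum_lessThan_Suc_shift_le:
  fixes f :: "nat \<Rightarrow> real"
  assumes "\<And>i. 0 \<le> f i" "\<And>i. i \<ge> n \<Longrightarrow> f i = 0"
  shows "(\<Sum>i<n. f (Suc i)) \<le> (\<Sum>i<n. f i)"
proof -
  have "f 0 + (\<Sum>i<n. f (Suc i)) = (\<Sum>i<Suc n. f i)" by (rule sum.lessThan_Suc_shift[symmetric])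
  also have "\<dots> = (\<Sum>i<n. f i)" using assms by simp
  finally show ?thesis using assms(1)[of 0] by linarith
qed

text \<open>Two products of neighbours in the zigzag are linked by exchanging one factor at a time,
  for instance u' v', u'^2, u' v, v^2, u v with primes for the next index. Each exchange costs a
  factor times a difference of neighbours, and Cauchy-Schwarz turns the sum into the root of a
  gap.\<close>

lemma unit_vector_variation:
  fixes u v :: "nat \<Rightarrow> real"
  assumes u0: "\<And>i. i \<ge> n \<Longrightarrow> u i = 0" and v0: "\<And>i. i \<ge> n \<Longrightarrow> v i = 0"
    and u: "(\<Sum>i<n. (u i)\<^sup>2) \<le> 1" and v: "(\<Sum>i<n. (v i)\<^sup>2) \<le> 1"
  shows "(\<Sum>i<n. \<bar>u (Suc i) * v (Suc i) - u i * v i\<bar>) \<le> 2 * sqrt (diag_gap n u v) + 2 * sqrt (sub_gap n u v)"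
    and "(\<Sum>i<n. \<bar>u (Suc (Suc i)) * v (Suc i) - u (Suc i) * v i\<bar>) \<le> 2 * sqrt (diag_gap n u v) + 2 * sqrt (sub_gap n u v)"
proof -
  have u': "(\<Sum>i<n. (u (Suc i))\<^sup>2) \<le> 1"
    using sum_lessThan_Suc_shift_le[of "\<lambda>i. (u i)\<^sup>2" n] u u0 by simp
  have v': "(\<Sum>i<n. (v (Suc i))\<^sup>2) \<le> 1"
    using sum_lessThan_Suc_shift_le[of "\<lambda>i. (v i)\<^sup>2" n] v v0 by simp
  have dg: "sqrt (\<Sum>i<n. (u (Suc i) - v (Suc i))\<^sup>2) \<le> sqrt (diag_gap n u v)"
    unfolding diag_gap_def using sum_lessThan_Suc_shift_le[of "\<lambda>i. (u i - v i)\<^sup>2" n] u0 v0 by simp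
  have sg: "sqrt (\<Sum>i<n. (u (Suc (Suc i)) - v (Suc i))\<^sup>2) \<le> sqrt (sub_gap n u v)"
    unfolding sub_gap_def using sum_lessThan_Suc_shift_le[of "\<lambda>i. (u (Suc i) - v i)\<^sup>2" n] u0 v0 by simp
  note cs = cauchy_schwarz_unit[of _ "{..<n}"]
  have "(\<Sum>i<n. \<bar>u (Suc i) * v (Suc i) - u i * v i\<bar>) \<le>
     (\<Sum>i<n. \<bar>u (Suc i)\<bar> * \<bar>u (Suc i) - v (Suc i)\<bar>) + (\<Sum>i<n. \<bar>u (Suc i)\<bar> * \<bar>u (Suc i) - v i\<bar>)
     + (\<Sum>i<n. \<bar>v i\<bar> * \<bar>u (Suc i) - v i\<bar>) + (\<Sum>i<n. \<bar>v i\<bar> * \<bar>u i - v i\<bar>)"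
    unfolding sum.distrib[symmetric] abs_mult[symmetric]
  proof (rule sum_mono)
    fix i
    have "u (Suc i) * v (Suc i) - u i * v i = - (u (Suc i) * (u (Suc i) - v (Suc i)))
      + u (Suc i) * (u (Suc i) - v i) + v i * (u (Suc i) - v i) - v i * (u i - v i)"
      by (simp add: algebra_simps)
    then show "\<bar>u (Suc i) * v (Suc i) - u i * v i\<bar> \<le> \<bar>u (Suc i) * (u (Suc i) - v (Suc i))\<bar> +
      \<bar>u (Suc i) * (u (Suc i) - v i)\<bar> + \<bar>v i * (u (Suc i) - v i)\<bar> + \<bar>v i * (u i - v i)\<bar>"
      by linarith
  qed
  also have "\<dots> \<le> 2 * sqrt (diag_gap n u v) + 2 * sqrt (sub_gap n u v)"
    using cs[OF u', of "\<lambda>i. u (Suc i) - v (Suc i)"] cs[OF u', of "\<lambda>i. u (Suc i) - v i"]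
      cs[OF v, of "\<lambda>i. u (Suc i) - v i"] cs[OF v, of "\<lambda>i. u i - v i"] dg
    unfolding diag_gap_def sub_gap_def by linarith
  finally show "(\<Sum>i<n. \<bar>u (Suc i) * v (Suc i) - u i * v i\<bar>) \<le> 2 * sqrt (diag_gap n u v) + 2 * sqrt (sub_gap n u v)" .
  have "(\<Sum>i<n. \<bar>u (Suc (Suc i)) * v (Suc i) - u (Suc i) * v i\<bar>) \<le>
     (\<Sum>i<n. \<bar>v (Suc i)\<bar> * \<bar>u (Suc (Suc i)) - v (Suc i)\<bar>) + (\<Sum>i<n. \<bar>v (Suc i)\<bar> * \<bar>u (Suc i) - v (Suc i)\<bar>)
     + (\<Sum>i<n. \<bar>u (Suc i)\<bar> * \<bar>u (Suc i) - v (Suc i)\<bar>) + (\<Sum>i<n. \<bar>u (Suc i)\<bar> * \<bar>u (Suc i) - v i\<bar>)"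
    unfolding sum.distrib[symmetric] abs_mult[symmetric]
  proof (rule sum_mono)
    fix i
    have "u (Suc (Suc i)) * v (Suc i) - u (Suc i) * v i = v (Suc i) * (u (Suc (Suc i)) - v (Suc i))
      - v (Suc i) * (u (Suc i) - v (Suc i)) - u (Suc i) * (u (Suc i) - v (Suc i)) + u (Suc i) * (u (Suc i) - v i)"
      by (simp add: algebra_simps)
    then show "\<bar>u (Suc (Suc i)) * v (Suc i) - u (Suc i) * v i\<bar> \<le> \<bar>v (Suc i) * (u (Suc (Suc i)) - v (Suc i))\<bar> +
      \<bar>v (Suc i) * (u (Suc i) - v (Suc i))\<bar> + \<bar>u (Suc i) * (u (Suc i) - v (Suc i))\<bar> + \<bar>u (Suc i) * (u (Suc i) - v i)\<bar>"
      by linarith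
  qed
  also have "\<dots> \<le> 2 * sqrt (diag_gap n u v) + 2 * sqrt (sub_gap n u v)"
    using cs[OF v', of "\<lambda>i. u (Suc (Suc i)) - v (Suc i)"] cs[OF v', of "\<lambda>i. u (Suc i) - v (Suc i)"]
      cs[OF u', of "\<lambda>i. u (Suc i) - v (Suc i)"] cs[OF u', of "\<lambda>i. u (Suc i) - v i"] dg sg
    unfolding diag_gap_def sub_gap_def by linarith
  finally show "(\<Sum>i<n. \<bar>u (Suc (Suc i)) * v (Suc i) - u (Suc i) * v i\<bar>) \<le> 2 * sqrt (diag_gap n u v) + 2 * sqrt (sub_gap n u v)" .
qed

text \<open>Expanding the squares. The shifted sum never meets \<open>u 0\<close>, so the second
  overlap also loses half of its square.\<close>

lemma unit_vector_overlap:
  fixes u v :: "nat \<Rightarrow> real"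
  assumes u0: "\<And>i. i \<ge> n \<Longrightarrow> u i = 0"
    and u: "(\<Sum>i<n. (u i)\<^sup>2) = 1" and v: "(\<Sum>i<n. (v i)\<^sup>2) = 1"
  shows "(\<Sum>i<n. u i * v i) = 1 - diag_gap n u v / 2"
    and "(\<Sum>i<n. u (Suc i) * v i) = 1 - (u 0)\<^sup>2 / 2 - sub_gap n u v / 2"
proof -
  have "diag_gap n u v = (\<Sum>i<n. (u i)\<^sup>2) + (\<Sum>i<n. (v i)\<^sup>2) - 2 * (\<Sum>i<n. u i * v i)"
    unfolding diag_gap_def power2_diff by (simp add: sum.distrib sum_subtractf sum_distrib_left ac_simps)
  then show "(\<Sum>i<n. u i * v i) = 1 - diag_gap n u v / 2" using u v by linarith
  have "(u 0)\<^sup>2 + (\<Sum>i<n. (u (Suc i))\<^sup>2) = (\<Sum>i<Suc n. (u i)\<^sup>2)"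
    by (rule sum.lessThan_Suc_shift[symmetric])
  also have "\<dots> = 1" using u u0 by simp
  finally have "(\<Sum>i<n. (u (Suc i))\<^sup>2) = 1 - (u 0)\<^sup>2" by simp
  moreover have "sub_gap n u v = (\<Sum>i<n. (u (Suc i))\<^sup>2) + (\<Sum>i<n. (v i)\<^sup>2) - 2 * (\<Sum>i<n. u (Suc i) * v i)"
    unfolding sub_gap_def power2_diff by (simp add: sum.distrib sum_subtractf sum_distrib_left ac_simps)
  ultimately show "(\<Sum>i<n. u (Suc i) * v i) = 1 - (u 0)\<^sup>2 / 2 - sub_gap n u v / 2" using v by linarith
qed


section \<open>Deterministic bounds for bidiagonal forms with controlled noise\<close>

definition windows_bounded :: "nat \<Rightarrow> nat \<Rightarrow> real \<Rightarrow> (nat \<Rightarrow> real) \<Rightarrow> bool" where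
  "windows_bounded l N \<tau> x \<longleftrightarrow> (\<forall>s k. k \<le> l \<longrightarrow> s + k \<le> N \<longrightarrow> \<bar>\<Sum>j<k. x (s + j)\<bar> \<le> \<tau>)"

lemma windows_boundedD:
  assumes "windows_bounded l N \<tau> x"
  shows "k \<le> l \<Longrightarrow> s + k \<le> N \<Longrightarrow> \<bar>\<Sum>j<k. x (s + j)\<bar> \<le> \<tau>"
    and "l > 0 \<Longrightarrow> i < N \<Longrightarrow> \<bar>x i\<bar> \<le> \<tau>"
    and "0 \<le> \<tau>"
proof -
  show *: "k \<le> l \<Longrightarrow> s + k \<le> N \<Longrightarrow> \<bar>\<Sum>j<k. x (s + j)\<bar> \<le> \<tau>" for s k
    using assms by (auto simp: windows_bounded_def)
  show "l > 0 \<Longrightarrow> i < N \<Longrightarrow> \<bar>x i\<bar> \<le> \<tau>" using *[of 1 i] by simp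
  show "0 \<le> \<tau>" using *[of 0 0] by simp
qed

text \<open>First-order Taylor term of a = sqrt (a^2) around a^2 = d. If a^2 is a sum of d squared
  standard normals, it is a weighted sum of independent centred squares with variance 1/2 for every
  d; this linearity permits exponential bounds for window sums.\<close>

definition linearized_dev :: "real \<Rightarrow> real \<Rightarrow> real" where
  "linearized_dev d a = (a\<^sup>2 - d) / (2 * sqrt d)"

text \<open>With q = sqrt d the Taylor error is exactly (a - q)^2 / (2 q). It is nonnegative, and
  since a + q is at least q, |a - q| is at most twice the linearised deviation, which bounds the
  error by a quadratic term.\<close>

lemma linearized_dev_bounds:
  assumes "0 \<le> a" "0 < d"
  shows "a \<le> sqrt d + linearized_dev d a"
    and "sqrt d + linearized_dev d a - 2 * (linearized_dev d a)\<^sup>2 / sqrt d \<le> a"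
proof -
  define q where "q = sqrt d"
  have q: "0 < q" "d = q\<^sup>2" using assms by (auto simp: q_def)
  have *: "sqrt d + linearized_dev d a - a = (a - q)\<^sup>2 / (2 * q)"
    using q by (simp add: linearized_dev_def field_simps power2_eq_square)
  also have "\<dots> \<ge> 0" using q by simp
  finally show "a \<le> sqrt d + linearized_dev d a" by simp
  have "q\<^sup>2 \<le> (a + q)\<^sup>2" using assms q by (intro power_mono) auto
  then have "(a - q)\<^sup>2 * q\<^sup>2 \<le> (a - q)\<^sup>2 * (a + q)\<^sup>2" by (intro mult_left_mono) auto
  moreover have "2 * (linearized_dev d a)\<^sup>2 / sqrt d = (a - q)\<^sup>2 * (a + q)\<^sup>2 / (2 * q ^ 3)"
    using q by (simp add: linearized_dev_def field_simps power2_eq_square power3_eq_cube)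
  moreover have "(a - q)\<^sup>2 / (2 * q) = (a - q)\<^sup>2 * q\<^sup>2 / (2 * q ^ 3)"
    using q by (simp add: field_simps power2_eq_square power3_eq_cube)
  ultimately have "(a - q)\<^sup>2 / (2 * q) \<le> 2 * (linearized_dev d a)\<^sup>2 / sqrt d"
    using q by (simp add: divide_right_mono)
  then show "sqrt d + linearized_dev d a - 2 * (linearized_dev d a)\<^sup>2 / sqrt d \<le> a"
    using * by linarith
qed

lemma sqrt_diff_le:
  fixes p x :: real
  assumes "0 < p" "0 \<le> x" "x \<le> p"
  shows "sqrt (p - x) \<le> sqrt p - x / (2 * sqrt p)"
proof (rule real_le_lsqrt)
  define q where "q = sqrt p"
  have q: "0 < q" "p = q\<^sup>2" using assms by (auto simp: q_def)
  show "0 \<le> sqrt p - x / (2 * sqrt p)"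
    using assms unfolding q_def[symmetric] q(2) using q(1) by (simp add: field_simps power2_eq_square)
  have "(q - x / (2 * q))\<^sup>2 = q\<^sup>2 - x + (x / (2 * q))\<^sup>2"
    using q by (simp add: power2_diff field_simps power2_eq_square)
  then show "p - x \<le> (sqrt p - x / (2 * sqrt p))\<^sup>2"
    unfolding q_def[symmetric] using q(2) by simp
qed

lemma sqrt_diff_ge:
  fixes p x :: real
  assumes "0 < p" "0 \<le> x" "x \<le> p"
  shows "sqrt p - x / sqrt p \<le> sqrt (p - x)"
proof (rule real_le_rsqrt)
  define q where "q = sqrt p"
  have q: "0 < q" "p = q\<^sup>2" using assms by (auto simp: q_def)
  have "(q - x / q)\<^sup>2 = q\<^sup>2 - x - x * (q\<^sup>2 - x) / q\<^sup>2"
    using q(1) by (simp add: power2_diff field_simps power2_eq_square)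
  moreover have "0 \<le> x * (q\<^sup>2 - x) / q\<^sup>2" using assms q by simp
  ultimately show "(sqrt p - x / sqrt p)\<^sup>2 \<le> p - x"
    unfolding q_def[symmetric] using q(2) by simp
qed

definition bidiag_form :: "nat \<Rightarrow> (nat \<Rightarrow> real) \<Rightarrow> (nat \<Rightarrow> real) \<Rightarrow> (nat \<Rightarrow> real) \<Rightarrow> (nat \<Rightarrow> real) \<Rightarrow> real" where
  "bidiag_form n a b u v = (\<Sum>i<n. a i * (u i * v i)) + (\<Sum>i<n - 1. b i * (u (Suc i) * v i))"

text \<open>Nonnegativity lets entrywise bounds on the matrix pass to the form, and costs nothing
  for matrices with nonnegative entries (\<open>opn_attained_nonneg\<close>). Vanishing from
  \<open>n\<close> on makes \<open>u (Suc i)\<close> meaningful at the boundary.\<close>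

definition unit_vector :: "nat \<Rightarrow> (nat \<Rightarrow> real) \<Rightarrow> bool" where
  "unit_vector n u \<longleftrightarrow> (\<forall>i. 0 \<le> u i) \<and> (\<forall>i\<ge>n. u i = 0) \<and> (\<Sum>i<n. (u i)\<^sup>2) = 1"

lemma unit_vectorD:
  assumes "unit_vector n u"
  shows "0 \<le> u i" "i \<ge> n \<Longrightarrow> u i = 0" "(\<Sum>i<n. (u i)\<^sup>2) = 1"
  using assms by (auto simp: unit_vector_def)

lemma chain_noise_bound:
  assumes u: "unit_vector n u" and v: "unit_vector n v" and l: "l > 0"
  shows "windows_bounded l n \<tau> x \<Longrightarrow> \<bar>\<Sum>i<n. x i * (u i * v i)\<bar> \<le>
      \<tau> / real l + 4 * \<tau> * (sqrt (diag_gap n u v) + sqrt (sub_gap n u v))"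
    and "windows_bounded l (n - 1) \<tau> y \<Longrightarrow> \<bar>\<Sum>i<n - 1. y i * (u (Suc i) * v i)\<bar> \<le>
      \<tau> / real l + 4 * \<tau> * (sqrt (diag_gap n u v) + sqrt (sub_gap n u v))"
proof -
  note u' = unit_vectorD[OF u] and v' = unit_vectorD[OF v]
  note var = unit_vector_variation[of n u v, OF u'(2) v'(2) eq_refl[OF u'(3)] eq_refl[OF v'(3)]]
  show "\<bar>\<Sum>i<n. x i * (u i * v i)\<bar> \<le>
      \<tau> / real l + 4 * \<tau> * (sqrt (diag_gap n u v) + sqrt (sub_gap n u v))"
    if w: "windows_bounded l n \<tau> x"
  proof -
    note \<tau> = windows_boundedD(3)[OF w]
    have "\<bar>\<Sum>i<n. x i * (u i * v i)\<bar> \<le> \<tau> * ((\<Sum>i<n. \<bar>u i * v i\<bar>) / real l + 2 * (\<Sum>i<n. \<bar>u (Suc i) * v (Suc i) - u i * v i\<bar>))"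
      using u' by (intro noise_bound l \<tau> windows_boundedD(1)[OF w]) auto
    also have "\<dots> \<le> \<tau> * (1 / real l + 2 * (2 * sqrt (diag_gap n u v) + 2 * sqrt (sub_gap n u v)))"
      using cauchy_schwarz_unit[of u "{..<n}" v] u' v' var(1)
      by (intro mult_left_mono add_mono divide_right_mono \<tau>) (auto simp: abs_mult)
    finally show ?thesis by (simp add: algebra_simps)
  qed
  show "\<bar>\<Sum>i<n - 1. y i * (u (Suc i) * v i)\<bar> \<le>
      \<tau> / real l + 4 * \<tau> * (sqrt (diag_gap n u v) + sqrt (sub_gap n u v))"
    if w: "windows_bounded l (n - 1) \<tau> y"
  proof -
    note \<tau> = windows_boundedD(3)[OF w]
    have "(\<Sum>i<n. (u (Suc i))\<^sup>2) \<le> 1"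
      using sum_lessThan_Suc_shift_le[of "\<lambda>i. (u i)\<^sup>2" n] u' by simp
    then have 1: "(\<Sum>i<n. \<bar>u (Suc i) * v i\<bar>) \<le> 1"
      using cauchy_schwarz_unit[of "\<lambda>i. u (Suc i)" "{..<n}" v] v' by (simp add: abs_mult)
    have 2: "(\<Sum>i<n - 1. \<bar>u (Suc i) * v i\<bar>) \<le> (\<Sum>i<n. \<bar>u (Suc i) * v i\<bar>)"
      and 3: "(\<Sum>i<n - 1. \<bar>u (Suc (Suc i)) * v (Suc i) - u (Suc i) * v i\<bar>) \<le> (\<Sum>i<n. \<bar>u (Suc (Suc i)) * v (Suc i) - u (Suc i) * v i\<bar>)"
      by (rule sum_mono2; auto)+
    have "\<bar>\<Sum>i<n - 1. y i * (u (Suc i) * v i)\<bar> \<le> \<tau> * ((\<Sum>i<n - 1. \<bar>u (Suc i) * v i\<bar>) / real l + 2 * (\<Sum>i<n - 1. \<bar>u (Suc (Suc i)) * v (Suc i) - u (Suc i) * v i\<bar>))"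
      using u' by (intro noise_bound l \<tau> windows_boundedD(1)[OF w]) auto
    also have "\<dots> \<le> \<tau> * (1 / real l + 2 * (2 * sqrt (diag_gap n u v) + 2 * sqrt (sub_gap n u v)))"
      using 1 2 3 var(2) by (intro mult_left_mono add_mono divide_right_mono \<tau>) auto
    finally show ?thesis by (simp add: algebra_simps)
  qed
qed

text \<open>Noise is linear in the root \<open>x\<close> of a gap whereas misalignment costs a
  multiple of x^2. Completing the square trades the former for a part of the latter plus a
  constant.\<close>

lemma absorb_gap:
  fixes s x :: real
  assumes "0 < s"
  shows "8 * \<tau> * x \<le> s * x\<^sup>2 / 4 + 64 * \<tau>\<^sup>2 / s"
proof -
  have "s * x\<^sup>2 / 4 + 64 * \<tau>\<^sup>2 / s - 8 * \<tau> * x = (s * x - 16 * \<tau>)\<^sup>2 / (4 * s)"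
    using assms by (simp add: power2_diff power_mult_distrib field_simps power2_eq_square)
  moreover have "\<dots> \<ge> 0" using assms by simp
  ultimately show ?thesis by linarith
qed

text \<open>The only properties of the random entries that the analysis uses. The centrings count
  squares: row \<open>i\<close> from the diagonal on has p - i entries, column \<open>i\<close>
  below the diagonal has n - 1 - i.\<close>

definition good_bidiag :: "nat \<Rightarrow> nat \<Rightarrow> nat \<Rightarrow> real \<Rightarrow> (nat \<Rightarrow> real) \<Rightarrow> (nat \<Rightarrow> real) \<Rightarrow> bool" where
  "good_bidiag n p l \<tau> a b \<longleftrightarrow> (\<forall>i. 0 \<le> a i) \<and> (\<forall>i. 0 \<le> b i) \<and>
     windows_bounded l n \<tau> (\<lambda>i. linearized_dev (real p - real i) (a i)) \<and>
     windows_bounded l (n - 1) \<tau> (\<lambda>i. linearized_dev (real n - 1 - real i) (b i))"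

text \<open>The noise is at most linear in the roots of the two gaps and is absorbed by the gap
  penalties of the overlaps. Two terms are deliberately kept for
  \<open>top_vector_localized\<close>: half of the diagonal overlap and the drift -i / (2 sqrt p) of
  the diagonal means.\<close>

lemma bidiag_form_upper:
  assumes good: "good_bidiag n p l \<tau> a b" and n: "1 \<le> n" "n \<le> p" and l: "l > 0"
    and u: "unit_vector n u" and v: "unit_vector n v"
  shows "bidiag_form n a b u v \<le> sqrt p / 2 * (\<Sum>i<n. u i * v i) + sqrt p / 2 + sqrt n
     - (\<Sum>i<n. real i * (u i * v i)) / (2 * sqrt p) + (2 * \<tau> / real l + 128 * \<tau>\<^sup>2 / sqrt n)"
proof -
  note u' = unit_vectorD[OF u] and v' = unit_vectorD[OF v]
  let ?\<xi> = "\<lambda>i. linearized_dev (real p - real i) (a i)"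
  let ?\<zeta> = "\<lambda>i. linearized_dev (real n - 1 - real i) (b i)"
  let ?E1 = "diag_gap n u v" and ?E2 = "sub_gap n u v"
  let ?P1 = "\<Sum>i<n. u i * v i" and ?P2 = "\<Sum>i<n. u (Suc i) * v i"
  from good have a: "0 \<le> a i" and b: "0 \<le> b i" and w1: "windows_bounded l n \<tau> ?\<xi>"
    and w2: "windows_bounded l (n - 1) \<tau> ?\<zeta>" for i
    by (auto simp: good_bidiag_def)
  have uv: "0 \<le> u i * v j" for i j using u' v' by simp
  have "(\<Sum>i<n. a i * (u i * v i)) \<le> (\<Sum>i<n. (sqrt p - real i / (2 * sqrt p) + ?\<xi> i) * (u i * v i))"
  proof (intro sum_mono mult_right_mono uv)
    fix i assume "i \<in> {..<n}"
    then show "a i \<le> sqrt p - real i / (2 * sqrt p) + ?\<xi> i"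
      using linearized_dev_bounds(1)[OF a, of "real p - real i" i] sqrt_diff_le[of p i] n by simp
  qed
  also have "\<dots> = sqrt p * ?P1 - (\<Sum>i<n. real i * (u i * v i)) / (2 * sqrt p) + (\<Sum>i<n. ?\<xi> i * (u i * v i))"
    by (simp add: algebra_simps sum.distrib sum_subtractf sum_distrib_left sum_divide_distrib)
  finally have A: "(\<Sum>i<n. a i * (u i * v i)) \<le> \<dots>" .
  have "(\<Sum>i<n - 1. b i * (u (Suc i) * v i)) \<le> (\<Sum>i<n - 1. (sqrt n + ?\<zeta> i) * (u (Suc i) * v i))"
  proof (intro sum_mono mult_right_mono uv)
    fix i assume "i \<in> {..<n - 1}"
    then have i: "0 < real n - 1 - real i" by auto
    have "sqrt (real n - 1 - real i) \<le> sqrt n" by (intro real_sqrt_le_mono) auto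
    then show "b i \<le> sqrt n + ?\<zeta> i"
      using linearized_dev_bounds(1)[OF b, of "real n - 1 - real i" i] i by linarith
  qed
  also have "\<dots> = sqrt n * (\<Sum>i<n - 1. u (Suc i) * v i) + (\<Sum>i<n - 1. ?\<zeta> i * (u (Suc i) * v i))"
    by (simp add: algebra_simps sum.distrib sum_distrib_left)
  also have "(\<Sum>i<n - 1. u (Suc i) * v i) = ?P2"
    using u' n by (intro sum.mono_neutral_left) auto
  finally have B: "(\<Sum>i<n - 1. b i * (u (Suc i) * v i)) \<le> sqrt n * ?P2 + (\<Sum>i<n - 1. ?\<zeta> i * (u (Suc i) * v i))" .
  have ov: "?P1 = 1 - ?E1 / 2" "?P2 = 1 - (u 0)\<^sup>2 / 2 - ?E2 / 2"
    by (rule unit_vector_overlap; use u' v' in simp)+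
  have sp: "sqrt n \<le> sqrt p" "0 < sqrt n" using n by auto
  have e1: "8 * \<tau> * sqrt ?E1 \<le> sqrt n * ?E1 / 4 + 64 * \<tau>\<^sup>2 / sqrt n"
    and e2: "8 * \<tau> * sqrt ?E2 \<le> sqrt n * ?E2 / 4 + 64 * \<tau>\<^sup>2 / sqrt n"
    using absorb_gap[OF sp(2), of \<tau> "sqrt ?E1"] absorb_gap[OF sp(2), of \<tau> "sqrt ?E2"] gap_nonneg[of n u v]
    by simp_all
  have "?P2 \<le> 1 - ?E2 / 2" using ov(2) zero_le_power2[of "u 0"] by linarith
  then have "sqrt n * ?P2 \<le> sqrt n * (1 - ?E2 / 2)" using sp by (intro mult_left_mono) auto
  then have f2: "sqrt n * ?P2 \<le> sqrt n - sqrt n * ?E2 / 2" by (simp add: algebra_simps)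
  have "sqrt p * ?P1 = sqrt p - sqrt p * ?E1 / 2"
    by (subst ov(1)) (simp only: right_diff_distrib mult_1_right times_divide_eq_right)
  \<comment> \<open>Half of the penalty for the diagonal gap stays hidden in \<open>?P1\<close>; the
    other half pays for the noise.\<close>
  then have f1: "sqrt p * ?P1 = sqrt p / 2 * ?P1 + sqrt p / 2 - sqrt p * ?E1 / 4" by linarith
  have f3: "sqrt n * ?E1 \<le> sqrt p * ?E1" and f4: "0 \<le> sqrt n * ?E2"
    using gap_nonneg[of n u v] sp by (auto intro: mult_right_mono)
  have N1: "(\<Sum>i<n. ?\<xi> i * (u i * v i)) \<le> \<tau> / real l + 4 * \<tau> * sqrt ?E1 + 4 * \<tau> * sqrt ?E2"
    and N2: "(\<Sum>i<n - 1. ?\<zeta> i * (u (Suc i) * v i)) \<le> \<tau> / real l + 4 * \<tau> * sqrt ?E1 + 4 * \<tau> * sqrt ?E2"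
    using chain_noise_bound(1)[OF u v l w1] chain_noise_bound(2)[OF u v l w2]
    by (simp_all add: distrib_left)
  show ?thesis
    unfolding bidiag_form_def using A B N1 N2 e1 e2 f1 f2 f3 f4 by linarith
qed


text \<open>Truncated subtraction makes the tent vanish from \<open>2 * K\<close> on. It also
  vanishes at 0, which removes the boundary loss of \<open>u 0\<close> in the subdiagonal
  overlap.\<close>

definition tent :: "nat \<Rightarrow> nat \<Rightarrow> real" where
  "tent K i = real (min i (2 * K - i))"

lemma tent_simps: "tent K 0 = 0" "i \<ge> 2 * K \<Longrightarrow> tent K i = 0" "0 \<le> tent K i"
  by (auto simp: tent_def)

lemma sum_tent_squares:
  assumes "2 * K \<le> n"
  shows "real K ^ 3 / 3 \<le> (\<Sum>i<n. (tent K i)\<^sup>2)"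
proof (cases "K = 0")
  case False
  have *: "real m ^ 3 / 3 \<le> (\<Sum>i<Suc m. (real i)\<^sup>2)" for m
    by (induction m) (auto simp: field_simps power2_eq_square power3_eq_cube)
  have "(\<Sum>i<Suc K. (real i)\<^sup>2) = (\<Sum>i<Suc K. (tent K i)\<^sup>2)"
    by (intro sum.cong) (auto simp: tent_def min_def)
  also have "\<dots> \<le> (\<Sum>i<n. (tent K i)\<^sup>2)"
    using assms False by (intro sum_mono2) auto
  finally show ?thesis using *[of K] by linarith
qed (simp add: sum_nonneg)

lemma tent_increment: "(tent K (Suc i) - tent K i)\<^sup>2 \<le> (if i < 2 * K then 1 else 0)"
proof -
  have "\<bar>tent K (Suc i) - tent K i\<bar> \<le> 1 \<and> (i \<ge> 2 * K \<longrightarrow> tent K (Suc i) - tent K i = 0)"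
    by (auto simp: tent_def min_def)
  then show ?thesis by (auto simp: power2_le_iff_abs_le abs_square_le_1)
qed

text \<open>The normalised tent, taken as both vectors, has no diagonal gap and a subdiagonal gap of
  at most 2 K / (K^3 / 3) = 6 / K^2, which produces the term 3 sqrt n / K^2 and, through the
  variation, the terms \<tau> / K. The term K / sqrt n is the drift of the means over the support,
  and \<tau>^2 / sqrt n is the Taylor error.\<close>

lemma bidiag_form_lower:
  assumes good: "good_bidiag n p l \<tau> a b" and n: "4 * K + 4 \<le> n" "n \<le> p" and l: "l > 0" and K: "K > 0"
  shows "\<exists>u. unit_vector n u \<and> sqrt p + sqrt n -
     (4 * real K / sqrt n + 8 * \<tau>\<^sup>2 / sqrt n + 2 * \<tau> / real l + 24 * \<tau> / real K + 3 * sqrt n / (real K)\<^sup>2)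
     \<le> bidiag_form n a b u u"
proof -
  define S where "S = (\<Sum>i<n. (tent K i)\<^sup>2)"
  have S: "real K ^ 3 / 3 \<le> S" unfolding S_def using n by (intro sum_tent_squares) auto
  have "0 < real K ^ 3 / 3" using K by simp
  then have S0: "0 < S" using S by linarith
  define u where "u i = tent K i / sqrt S" for i
  have u: "unit_vector n u"
    unfolding unit_vector_def using S0 n
    by (auto simp: u_def tent_simps power_divide sum_divide_distrib[symmetric] S_def[symmetric])
  note u' = unit_vectorD[OF u]
  have u0: "u 0 = 0" "i \<ge> 2 * K \<Longrightarrow> u i = 0" for i by (auto simp: u_def tent_simps)
  have "sub_gap n u u = (\<Sum>i<n. (tent K (Suc i) - tent K i)\<^sup>2 / S)"
    unfolding sub_gap_def u_def diff_divide_distrib[symmetric] power_divide using S0 by simp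
  also have "\<dots> \<le> (\<Sum>i<n. (if i < 2 * K then 1 else 0) / S)"
    using S0 by (intro sum_mono divide_right_mono tent_increment) auto
  also have "\<dots> = (\<Sum>i<2 * K. 1 / S)"
    using n by (intro sum.mono_neutral_cong_right) auto
  also have "\<dots> = 2 * real K / S" by simp
  also have "\<dots> \<le> 2 * real K / (real K ^ 3 / 3)"
    using S S0 K by (intro divide_left_mono) auto
  also have "\<dots> = 6 / (real K)\<^sup>2" using K by (simp add: field_simps power2_eq_square power3_eq_cube)
  finally have E2: "sub_gap n u u \<le> 6 / (real K)\<^sup>2" .
  have "sqrt (sub_gap n u u) \<le> sqrt (9 / (real K)\<^sup>2)"
    using E2 by (intro real_sqrt_le_mono order_trans[OF E2] divide_right_mono) auto
  also have "\<dots> = 3 / real K" using K by (simp add: real_sqrt_divide)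
  finally have E2': "sqrt (sub_gap n u u) \<le> 3 / real K" .
  have E1: "diag_gap n u u = 0" by (simp add: diag_gap_def)
  let ?\<xi> = "\<lambda>i. linearized_dev (real p - real i) (a i)"
  let ?\<zeta> = "\<lambda>i. linearized_dev (real n - 1 - real i) (b i)"
  let ?P2 = "\<Sum>i<n. u (Suc i) * u i"
  from good have a: "0 \<le> a i" and b: "0 \<le> b i" and w1: "windows_bounded l n \<tau> ?\<xi>"
    and w2: "windows_bounded l (n - 1) \<tau> ?\<zeta>" for i
    by (auto simp: good_bidiag_def)
  note \<tau> = windows_boundedD(3)[OF w1]
  define D where "D = 2 * real K / sqrt n + 4 * \<tau>\<^sup>2 / sqrt n"
  have D: "0 \<le> D" by (simp add: D_def)
  have sp: "sqrt n \<le> sqrt p" "0 < sqrt n" using n by auto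
  \<comment> \<open>One estimate for both diagonals: used with q = p, x = i for \<open>a\<close> and
    with q = n, x = 1 + i for \<open>b\<close>. \<open>D\<close> collects the drift and the Taylor
    error on the support of the tent.\<close>
  have key: "sqrt q - D + linearized_dev (q - x) c \<le> c"
    if q: "real n \<le> q" and x: "0 \<le> x" "x \<le> 2 * real K" and c: "0 \<le> c" and dev: "\<bar>linearized_dev (q - x) c\<bar> \<le> \<tau>"
    for q x c
  proof -
    have "real n / 4 \<le> q - x" using q x n by auto
    then have "sqrt (real n / 4) \<le> sqrt (q - x)" by (rule real_sqrt_le_mono)
    then have h: "sqrt n / 2 \<le> sqrt (q - x)" by (simp add: real_sqrt_divide)
    have qx: "0 < q - x" "0 < q" using q x n by auto
    have "(linearized_dev (q - x) c)\<^sup>2 \<le> \<tau>\<^sup>2" using dev by (simp add: abs_le_square_iff[symmetric])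
    then have "2 * (linearized_dev (q - x) c)\<^sup>2 / sqrt (q - x) \<le> 2 * \<tau>\<^sup>2 / (sqrt n / 2)"
      using h sp by (intro frac_le) auto
    then have 1: "2 * (linearized_dev (q - x) c)\<^sup>2 / sqrt (q - x) \<le> 4 * \<tau>\<^sup>2 / sqrt n" by simp
    have "x / sqrt q \<le> 2 * real K / sqrt n"
      using x q sp by (intro frac_le) auto
    then have 2: "sqrt q - 2 * real K / sqrt n \<le> sqrt (q - x)"
      using sqrt_diff_ge[of q x] qx x by linarith
    show ?thesis using 1 2 linearized_dev_bounds(2)[OF c qx(1)] unfolding D_def by linarith
  qed
  have uu: "0 \<le> u i * u j" for i j using u' by simp
  have "(\<Sum>i<n. a i * (u i * u i)) \<ge> (\<Sum>i<n. (sqrt p - D + ?\<xi> i) * (u i * u i))"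
  proof (intro sum_mono)
    fix i assume i: "i \<in> {..<n}"
    show "(sqrt p - D + ?\<xi> i) * (u i * u i) \<le> a i * (u i * u i)"
    proof (cases "i < 2 * K")
      case True
      then show ?thesis
        using i n windows_boundedD(2)[OF w1 l, of i] a by (intro mult_right_mono uu key) auto
    qed (simp add: u0)
  qed
  also have "(\<Sum>i<n. (sqrt p - D + ?\<xi> i) * (u i * u i)) = (sqrt p - D) * (\<Sum>i<n. (u i)\<^sup>2) + (\<Sum>i<n. ?\<xi> i * (u i * u i))"
    by (simp add: algebra_simps sum.distrib sum_subtractf sum_distrib_left power2_eq_square)
  finally have A: "sqrt p - D + (\<Sum>i<n. ?\<xi> i * (u i * u i)) \<le> (\<Sum>i<n. a i * (u i * u i))"
    using u' by simp
  have "(\<Sum>i<n - 1. b i * (u (Suc i) * u i)) \<ge> (\<Sum>i<n - 1. (sqrt n - D + ?\<zeta> i) * (u (Suc i) * u i))"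
  proof (intro sum_mono)
    fix i assume i: "i \<in> {..<n - 1}"
    show "(sqrt n - D + ?\<zeta> i) * (u (Suc i) * u i) \<le> b i * (u (Suc i) * u i)"
    \<comment> \<open>Already at i = 2 K - 1 the product vanishes, because \<open>u (2 * K)\<close>
      is zero.\<close>
    proof (cases "i < 2 * K - 1")
      case True
      then show ?thesis
        using i n windows_boundedD(2)[OF w2 l, of i] b key[of n "1 + real i" "b i"]
        by (intro mult_right_mono uu) (auto simp: algebra_simps)
    qed (simp add: u0)
  qed
  also have "(\<Sum>i<n - 1. (sqrt n - D + ?\<zeta> i) * (u (Suc i) * u i)) = (sqrt n - D) * (\<Sum>i<n - 1. u (Suc i) * u i) + (\<Sum>i<n - 1. ?\<zeta> i * (u (Suc i) * u i))"
    by (simp add: algebra_simps sum.distrib sum_subtractf sum_distrib_left)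
  also have "(\<Sum>i<n - 1. u (Suc i) * u i) = ?P2"
    using u' n by (intro sum.mono_neutral_left) auto
  finally have B: "(sqrt n - D) * ?P2 + (\<Sum>i<n - 1. ?\<zeta> i * (u (Suc i) * u i)) \<le> (\<Sum>i<n - 1. b i * (u (Suc i) * u i))" .
  have P2: "?P2 = 1 - sub_gap n u u / 2"
    using unit_vector_overlap(2)[of n u u, OF u'(2) u'(3) u'(3)] u0 by simp
  have "sqrt n * ?P2 \<ge> sqrt n * (1 - 3 / (real K)\<^sup>2)"
    unfolding P2 using E2 sp by (intro mult_left_mono) auto
  moreover have "D * ?P2 \<le> D * 1"
    unfolding P2 using D gap_nonneg[of n u u] by (intro mult_left_mono) auto
  ultimately have C: "sqrt n - 3 * sqrt n / (real K)\<^sup>2 - D \<le> (sqrt n - D) * ?P2"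
    by (simp add: algebra_simps)
  have "4 * \<tau> * (sqrt (diag_gap n u u) + sqrt (sub_gap n u u)) \<le> 4 * \<tau> * (0 + 3 / real K)"
    using E2' E1 \<tau> by (intro mult_left_mono add_mono) auto
  then have N: "\<bar>\<Sum>i<n. ?\<xi> i * (u i * u i)\<bar> \<le> \<tau> / real l + 12 * \<tau> / real K"
    "\<bar>\<Sum>i<n - 1. ?\<zeta> i * (u (Suc i) * u i)\<bar> \<le> \<tau> / real l + 12 * \<tau> / real K"
    using chain_noise_bound(1)[OF u u l w1] chain_noise_bound(2)[OF u u l w2] by simp_all
  show ?thesis
    using A B C N unfolding D_def bidiag_form_def by (intro exI[of _ u] conjI u) linarith
qed

text \<open>A form value within R of the edge leaves at most 2 R for the losses retained in
  \<open>bidiag_form_upper\<close>. Hence the overlap is at least 3/4 and its first moment at most 4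
  R sqrt p, and Markov's inequality leaves at most 1/4 of the overlap beyond
  \<open>m\<close>.\<close>

lemma top_vector_localized:
  fixes R :: real
  assumes good: "good_bidiag n p l \<tau> a b" and n: "1 \<le> n" "n \<le> p" and l: "l > 0" and m: "m > 0"
    and u: "unit_vector n u" and v: "unit_vector n v"
    and top: "sqrt p + sqrt n - R \<le> bidiag_form n a b u v"
    and small: "2 * \<tau> / real l + 128 * \<tau>\<^sup>2 / sqrt n \<le> R"
    and R: "16 * R \<le> sqrt p" "16 * R * sqrt p \<le> real m"
  shows "1 / 2 \<le> (\<Sum>i | i < n \<and> i < m. u i * v i)"
proof -
  let ?w = "\<lambda>i. u i * v i"
  let ?P = "\<Sum>i<n. ?w i" and ?M = "\<Sum>i<n. real i * ?w i"
  have w: "0 \<le> ?w i" for i using unit_vectorD[OF u] unit_vectorD[OF v] by simp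
  have sp: "0 < sqrt p" using n by simp
  have "?P \<le> 1"
    using unit_vector_overlap(1)[of n u v] unit_vectorD[OF u] unit_vectorD[OF v] gap_nonneg(1)[of n u v] by simp
  have M0: "0 \<le> ?M" using w by (intro sum_nonneg) auto
  have *: "sqrt p / 2 - sqrt p / 2 * ?P + ?M / (2 * sqrt p) \<le> 2 * R"
    using bidiag_form_upper[OF good n l u v] top small by linarith
  have "sqrt p / 2 * ?P \<le> sqrt p / 2 * 1" using \<open>?P \<le> 1\<close> sp by (intro mult_left_mono) auto
  then have "?M / (2 * sqrt p) \<le> 2 * R" using * by linarith
  then have M: "?M \<le> 4 * R * sqrt p" using sp by (simp add: field_simps)
  have "0 \<le> ?M / (2 * sqrt p)" using M0 sp by simp
  then have "sqrt p * (1 - ?P) \<le> sqrt p * (1 / 4)" using * R(1) by (simp add: algebra_simps)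
  then have P: "3 / 4 \<le> ?P" using sp by simp
  have split: "?P = (\<Sum>i | i < n \<and> i < m. ?w i) + (\<Sum>i | i < n \<and> \<not> i < m. ?w i)"
    by (subst sum.union_disjoint[symmetric]) (auto intro!: sum.cong)
  have "real m * (\<Sum>i | i < n \<and> \<not> i < m. ?w i) = (\<Sum>i | i < n \<and> \<not> i < m. real m * ?w i)"
    by (rule sum_distrib_left)
  also have "\<dots> \<le> (\<Sum>i | i < n \<and> \<not> i < m. real i * ?w i)"
    using w by (intro sum_mono mult_right_mono) auto
  also have "\<dots> \<le> ?M" using w by (intro sum_mono2) auto
  also have "\<dots> \<le> real m * (1 / 4)" using M R(2) by simp
  finally have "(\<Sum>i | i < n \<and> \<not> i < m. ?w i) \<le> 1 / 4" using m by simp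
  then show ?thesis using split P by linarith
qed

section \<open>Operator norms\<close>

text \<open>Vectors of varying dimension are functions on all naturals, zero from \<open>n\<close>
  on, so that every dimension lives in the same topological space.\<close>

definition sphere_vec :: "nat \<Rightarrow> (nat \<Rightarrow> real) set" where
  "sphere_vec n = {u. (\<forall>i\<ge>n. u i = 0) \<and> (\<Sum>i<n. (u i)\<^sup>2) = 1}"

definition bil :: "nat \<Rightarrow> nat \<Rightarrow> (nat \<Rightarrow> nat \<Rightarrow> real) \<Rightarrow> (nat \<Rightarrow> real) \<Rightarrow> (nat \<Rightarrow> real) \<Rightarrow> real" where
  "bil n p M u v = (\<Sum>i<n. \<Sum>j<p. M i j * (u i * v j))"

definition opn :: "nat \<Rightarrow> nat \<Rightarrow> (nat \<Rightarrow> nat \<Rightarrow> real) \<Rightarrow> real" where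
  "opn n p M = Sup ((\<lambda>(u, v). bil n p M u v) ` (sphere_vec n \<times> sphere_vec p))"

lemma sphere_vecD:
  assumes "u \<in> sphere_vec n"
  shows "i \<ge> n \<Longrightarrow> u i = 0" "(\<Sum>i<n. (u i)\<^sup>2) = 1" "\<bar>u i\<bar> \<le> 1"
proof -
  show *: "i \<ge> n \<Longrightarrow> u i = 0" for i
    using assms by (auto simp: sphere_vec_def)
  show s: "(\<Sum>i<n. (u i)\<^sup>2) = 1"
    using assms by (auto simp: sphere_vec_def)
  show "\<bar>u i\<bar> \<le> 1"
  proof (cases "i < n")
    case True
    then have "(u i)\<^sup>2 \<le> (\<Sum>i<n. (u i)\<^sup>2)"
      using member_le_sum[of i "{..<n}" "\<lambda>i. (u i)\<^sup>2"] by simp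
    then have "(u i)\<^sup>2 \<le> 1" using s by simp
    then show ?thesis by (simp only: abs_square_le_1)
  qed (use * in auto)
qed

text \<open>A closed subset of a product of compact intervals, hence compact by Tychonoff;
  coordinates from \<open>n\<close> on range over {0}.\<close>

lemma compact_sphere_vec: "compact (sphere_vec n)"
proof -
  define S :: "nat \<Rightarrow> real set" where "S i = (if i < n then {-1..1} else {0})" for i
  have "compactin (product_topology (\<lambda>_. euclidean) UNIV) (PiE UNIV S)"
    by (subst compactin_PiE) (auto simp: S_def)
  then have 1: "compact (PiE UNIV S)"
    by (simp add: euclidean_product_topology)
  have "continuous_on UNIV (\<lambda>u::nat \<Rightarrow> real. \<Sum>i<n. (u i)\<^sup>2)"
    by (intro continuous_intros continuous_on_product_coordinates)
  then have "closed ((\<lambda>u::nat \<Rightarrow> real. \<Sum>i<n. (u i)\<^sup>2) -` {1})"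
    by (intro closed_vimage) auto
  then have "compact (PiE UNIV S \<inter> (\<lambda>u::nat \<Rightarrow> real. \<Sum>i<n. (u i)\<^sup>2) -` {1})"
    by (rule compact_Int_closed[OF 1])
  also have "PiE UNIV S \<inter> (\<lambda>u::nat \<Rightarrow> real. \<Sum>i<n. (u i)\<^sup>2) -` {1} = sphere_vec n"
  proof (rule sym, intro equalityI subsetI)
    fix u assume u: "u \<in> sphere_vec n"
    have "u i \<in> S i" for i
      using sphere_vecD(1)[OF u, of i] sphere_vecD(3)[OF u, of i] by (auto simp: S_def abs_le_iff)
    then show "u \<in> PiE UNIV S \<inter> (\<lambda>u::nat \<Rightarrow> real. \<Sum>i<n. (u i)\<^sup>2) -` {1}"
      using sphere_vecD(2)[OF u] by auto
  next
    fix u assume u: "u \<in> PiE UNIV S \<inter> (\<lambda>u::nat \<Rightarrow> real. \<Sum>i<n. (u i)\<^sup>2) -` {1}"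
    have "u i = 0" if "i \<ge> n" for i
    proof -
      have "u i \<in> S i" using u by auto
      then show ?thesis using that by (simp add: S_def)
    qed
    then show "u \<in> sphere_vec n" using u by (auto simp: sphere_vec_def)
  qed
  finally show ?thesis .
qed

lemma sphere_vec_nonempty: "n \<ge> 1 \<Longrightarrow> (\<lambda>i. if i = 0 then 1 else 0) \<in> sphere_vec n"
  by (auto simp: sphere_vec_def if_distrib[of "\<lambda>x. x\<^sup>2"] sum.delta cong: if_cong)

lemma opn_attained_aux:
  assumes "n \<ge> 1" "p \<ge> 1"
  shows "\<exists>z \<in> sphere_vec n \<times> sphere_vec p. bil n p M (fst z) (snd z) = opn n p M \<and>
    (\<forall>y \<in> sphere_vec n \<times> sphere_vec p. bil n p M (fst y) (snd y) \<le> opn n p M)"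
proof -
  let ?C = "sphere_vec n \<times> sphere_vec p" and ?f = "\<lambda>z. bil n p M (fst z) (snd z)"
  have "compact ?C" by (intro compact_Times compact_sphere_vec)
  moreover have "?C \<noteq> {}"
    using sphere_vec_nonempty[OF assms(1)] sphere_vec_nonempty[OF assms(2)] by auto
  moreover have "continuous_on ?C ?f"
  proof -
    have "continuous_on ?C (\<lambda>z. fst z i)" for i
      by (rule continuous_on_compose2[OF continuous_on_product_coordinates[of i] continuous_on_fst[OF continuous_on_id]]) simp
    moreover have "continuous_on ?C (\<lambda>z. snd z j)" for j
      by (rule continuous_on_compose2[OF continuous_on_product_coordinates[of j] continuous_on_snd[OF continuous_on_id]]) simp
    ultimately show ?thesis
      unfolding bil_def by (intro continuous_on_sum continuous_on_mult_left continuous_on_mult)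
  qed
  ultimately obtain z where z: "z \<in> ?C" "\<forall>y \<in> ?C. ?f y \<le> ?f z"
    using continuous_attains_sup[of ?C ?f] by blast
  have "opn n p M = ?f z"
    unfolding opn_def by (rule cSup_eq_maximum) (use z in \<open>auto simp: case_prod_beta\<close>)
  then have "bil n p M (fst z) (snd z) = opn n p M \<and> (\<forall>y \<in> ?C. bil n p M (fst y) (snd y) \<le> opn n p M)"
    using z(2) by simp
  then show ?thesis using z(1) by (rule bexI)
qed

lemma opn_attained:
  assumes "n \<ge> 1" "p \<ge> 1"
  shows "\<exists>u \<in> sphere_vec n. \<exists>v \<in> sphere_vec p. bil n p M u v = opn n p M"
  using opn_attained_aux[OF assms, of M] by auto

lemma bil_le_opn:
  assumes "n \<ge> 1" "p \<ge> 1" "u \<in> sphere_vec n" "v \<in> sphere_vec p"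
  shows "bil n p M u v \<le> opn n p M"
proof -
  from opn_attained_aux[OF assms(1,2), of M]
  have "\<forall>y \<in> sphere_vec n \<times> sphere_vec p. bil n p M (fst y) (snd y) \<le> opn n p M" by auto
  from bspec[OF this, of "(u, v)"] show ?thesis using assms by simp
qed

lemma bil_scale: "bil n p M (\<lambda>i. c * u i) (\<lambda>j. d * v j) = c * d * bil n p M u v"
  by (simp add: bil_def sum_distrib_left algebra_simps)

lemma bil_cong:
  assumes "\<And>i j. i < n \<Longrightarrow> j < p \<Longrightarrow> M i j = M' i j" "\<And>i. i < n \<Longrightarrow> u i = u' i" "\<And>j. j < p \<Longrightarrow> v j = v' j"
  shows "bil n p M u v = bil n p M' u' v'"
  unfolding bil_def using assms by (intro sum.cong) auto

lemma opn_cong: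
  assumes "\<And>i j. i < n \<Longrightarrow> j < p \<Longrightarrow> M i j = M' i j"
  shows "opn n p M = opn n p M'"
  using bil_cong[OF assms refl refl] by (simp add: opn_def)

lemma bil_transpose: "bil p n (\<lambda>i j. M j i) v u = bil n p M u v"
  unfolding bil_def by (subst sum.swap) (simp add: mult.commute)

lemma opn_transpose: "opn p n (\<lambda>i j. M j i) = opn n p M"
proof -
  have "(\<lambda>(v, u). bil p n (\<lambda>i j. M j i) v u) ` (sphere_vec p \<times> sphere_vec n) =
    (\<lambda>(u, v). bil n p M u v) ` (sphere_vec n \<times> sphere_vec p)"
    by (auto simp: bil_transpose[of p n M] image_def)
  then show ?thesis by (simp add: opn_def)
qed

lemma opn_le:
  assumes "n \<ge> 1" "p \<ge> 1" "\<And>u v. u \<in> sphere_vec n \<Longrightarrow> v \<in> sphere_vec p \<Longrightarrow> bil n p M u v \<le> c"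
  shows "opn n p M \<le> c"
proof -
  obtain u v where "u \<in> sphere_vec n" "v \<in> sphere_vec p" "bil n p M u v = opn n p M"
    using opn_attained[OF assms(1,2), of M] by blast
  then show ?thesis using assms(3)[of u v] by simp
qed

lemma opn_nonneg:
  assumes "n \<ge> 1" "p \<ge> 1"
  shows "0 \<le> opn n p M"
proof -
  obtain u v where uv: "u \<in> sphere_vec n" "v \<in> sphere_vec p" "bil n p M u v = opn n p M"
    using opn_attained[OF assms, of M] by blast
  have "(\<lambda>i. - 1 * u i) \<in> sphere_vec n" using uv by (auto simp: sphere_vec_def)
  from bil_le_opn[OF assms this uv(2), of M] show ?thesis
    using bil_scale[of n p M "-1" u 1 v] uv by simp
qed

lemma bil_le:
  assumes "n \<ge> 1" "p \<ge> 1"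
  shows "bil n p M u v \<le> opn n p M * (sqrt (\<Sum>i<n. (u i)\<^sup>2) * sqrt (\<Sum>j<p. (v j)\<^sup>2))"
proof -
  let ?U = "sqrt (\<Sum>i<n. (u i)\<^sup>2)" and ?V = "sqrt (\<Sum>j<p. (v j)\<^sup>2)"
  show ?thesis
  proof (cases "?U = 0 \<or> ?V = 0")
    case True
    then have "(\<forall>i<n. u i = 0) \<or> (\<forall>j<p. v j = 0)"
      by (auto simp: sum_nonneg_eq_0_iff)
    then have "bil n p M u v = 0" by (auto simp: bil_def)
    then show ?thesis using True by auto
  next
    case False
    then have pos: "0 < ?U" "0 < ?V" by (auto simp: less_le sum_nonneg)
    let ?u = "\<lambda>i. if i < n then u i / ?U else 0" and ?v = "\<lambda>i. if i < p then v i / ?V else 0"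
    have "?u \<in> sphere_vec n" "?v \<in> sphere_vec p"
      using pos by (auto simp: sphere_vec_def power_divide sum_divide_distrib[symmetric] sum_nonneg)
    from bil_le_opn[OF assms this, of M] have "bil n p M ?u ?v \<le> opn n p M" .
    also have "bil n p M ?u ?v = bil n p M (\<lambda>i. (1 / ?U) * u i) (\<lambda>j. (1 / ?V) * v j)"
      by (rule bil_cong) auto
    also have "\<dots> = 1 / ?U * (1 / ?V) * bil n p M u v" by (rule bil_scale)
    finally show ?thesis using pos by (simp add: field_simps)
  qed
qed

lemma bil_row: "bil n p M u v = (\<Sum>i<n. u i * (\<Sum>j<p. M i j * v j))"
  by (simp add: bil_def sum_distrib_left algebra_simps)

lemma bil_col: "bil n p M u v = (\<Sum>j<p. v j * (\<Sum>i<n. M i j * u i))"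
  unfolding bil_def by (subst sum.swap) (simp add: sum_distrib_left algebra_simps)

text \<open>The form is tested with the image \<open>M v\<close> itself as left vector, and one
  factor |M v| is cancelled.\<close>

lemma norm_image_le:
  assumes "n \<ge> 1" "p \<ge> 1"
  shows "(\<Sum>i<n. (\<Sum>j<p. M i j * v j)\<^sup>2) \<le> (opn n p M)\<^sup>2 * (\<Sum>j<p. (v j)\<^sup>2)"
proof -
  let ?g = "\<lambda>i. \<Sum>j<p. M i j * v j"
  let ?G = "sqrt (\<Sum>i<n. (?g i)\<^sup>2)" and ?V = "sqrt (\<Sum>j<p. (v j)\<^sup>2)"
  have "?G * ?G = bil n p M ?g v"
    by (simp add: bil_row power2_eq_square sum_nonneg)
  also have "\<dots> \<le> opn n p M * (?G * ?V)" by (rule bil_le[OF assms])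
  also have "\<dots> = ?G * (opn n p M * ?V)" by (rule mult.left_commute)
  finally have *: "?G * ?G \<le> ?G * (opn n p M * ?V)" .
  have "0 \<le> ?G" "0 \<le> opn n p M * ?V" using opn_nonneg[OF assms, of M] by (auto simp: sum_nonneg)
  then have "?G \<le> opn n p M * ?V"
    using * mult_left_le_imp_le[of ?G ?G "opn n p M * ?V"] by linarith
  then have "?G\<^sup>2 \<le> (opn n p M * ?V)\<^sup>2" using \<open>0 \<le> ?G\<close> by (intro power_mono) auto
  then show ?thesis by (simp add: power_mult_distrib sum_nonneg)
qed

lemma sum_square_diff_scaled:
  fixes g u :: "nat \<Rightarrow> real"
  shows "(\<Sum>i<n. (g i - s * u i)\<^sup>2) = (\<Sum>i<n. (g i)\<^sup>2) + s\<^sup>2 * (\<Sum>i<n. (u i)\<^sup>2) - 2 * s * (\<Sum>i<n. u i * g i)"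
  by (simp add: power2_diff sum.distrib sum_subtractf sum_distrib_left power_mult_distrib algebra_simps)

text \<open>Equality case of the norm bound: with s the norm, |M v - s u|^2 is at most s^2 + s^2 - 2
  s^2 = 0.\<close>

lemma singular_vector:
  assumes "n \<ge> 1" "p \<ge> 1" and u: "u \<in> sphere_vec n" and v: "v \<in> sphere_vec p"
    and uv: "bil n p M u v = opn n p M" and i: "i < n"
  shows "(\<Sum>j<p. M i j * v j) = opn n p M * u i"
proof -
  let ?s = "opn n p M" and ?g = "\<lambda>i. \<Sum>j<p. M i j * v j"
  have "(\<Sum>i<n. (?g i - ?s * u i)\<^sup>2) = (\<Sum>i<n. (?g i)\<^sup>2) + ?s\<^sup>2 * (\<Sum>i<n. (u i)\<^sup>2) - 2 * ?s * (\<Sum>i<n. u i * ?g i)"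
    by (rule sum_square_diff_scaled)
  also have "\<dots> \<le> ?s\<^sup>2 * 1 + ?s\<^sup>2 * 1 - 2 * ?s * ?s"
    using norm_image_le[OF assms(1,2), of M v] sphere_vecD(2)[OF u] sphere_vecD(2)[OF v] uv
    by (simp add: bil_row)
  finally have "(\<Sum>i<n. (?g i - ?s * u i)\<^sup>2) \<le> 0" by (simp add: power2_eq_square)
  then have "(\<Sum>i<n. (?g i - ?s * u i)\<^sup>2) = 0" by (intro antisym) (auto simp: sum_nonneg)
  then have "(?g i - ?s * u i)\<^sup>2 = 0" using i by (subst (asm) sum_nonneg_eq_0_iff) auto
  then show ?thesis by simp
qed

text \<open>Replacing both maximising vectors by their absolute values does not decrease the form
  when all entries are nonnegative.\<close>

lemma opn_attained_nonneg:
  assumes "n \<ge> 1" "p \<ge> 1" and M: "\<And>i j. i < n \<Longrightarrow> j < p \<Longrightarrow> 0 \<le> M i j"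
  obtains u v where "u \<in> sphere_vec n" "v \<in> sphere_vec p" "\<And>i. 0 \<le> u i" "\<And>i. 0 \<le> v i"
    "bil n p M u v = opn n p M"
proof -
  obtain u v where uv: "u \<in> sphere_vec n" "v \<in> sphere_vec p" "bil n p M u v = opn n p M"
    using opn_attained[OF assms(1,2), of M] by blast
  have a: "(\<lambda>i. \<bar>u i\<bar>) \<in> sphere_vec n" "(\<lambda>i. \<bar>v i\<bar>) \<in> sphere_vec p"
    using uv by (auto simp: sphere_vec_def)
  have "bil n p M u v \<le> bil n p M (\<lambda>i. \<bar>u i\<bar>) (\<lambda>i. \<bar>v i\<bar>)"
    unfolding bil_def using M
    by (intro sum_mono mult_left_mono) (auto simp: abs_mult[symmetric])
  then have "bil n p M (\<lambda>i. \<bar>u i\<bar>) (\<lambda>i. \<bar>v i\<bar>) = opn n p M"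
    using uv bil_le_opn[OF assms(1,2) a, of M] by simp
  then show ?thesis using that[OF a] by simp
qed

text \<open>Only needed to see that the top eigenvalue has a finite second moment.\<close>

lemma opn_frobenius:
  assumes "n \<ge> 1" "p \<ge> 1"
  shows "(opn n p M)\<^sup>2 \<le> (\<Sum>i<n. \<Sum>j<p. (M i j)\<^sup>2)"
proof -
  have "opn n p M \<le> sqrt (\<Sum>i<n. \<Sum>j<p. (M i j)\<^sup>2)"
  proof (rule opn_le[OF assms])
    fix u v assume uv: "u \<in> sphere_vec n" "v \<in> sphere_vec p"
    let ?I = "{..<n} \<times> {..<p}"
    have "bil n p M u v = (\<Sum>(i, j)\<in>?I. M i j * (u i * v j))"
      by (simp add: bil_def sum.cartesian_product)
    also have "\<dots> \<le> (\<Sum>x\<in>?I. \<bar>M (fst x) (snd x)\<bar> * \<bar>u (fst x) * v (snd x)\<bar>)"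
      by (intro sum_mono) (auto simp: abs_mult[symmetric])
    also have "\<dots> \<le> L2_set (\<lambda>x. M (fst x) (snd x)) ?I * L2_set (\<lambda>x. u (fst x) * v (snd x)) ?I"
      by (rule L2_set_mult_ineq)
    also have "L2_set (\<lambda>x. u (fst x) * v (snd x)) ?I = 1"
      using sphere_vecD(2)[OF uv(1)] sphere_vecD(2)[OF uv(2)]
      by (simp add: L2_set_def sum.cartesian_product' power_mult_distrib sum_distrib_left[symmetric])
    finally show "bil n p M u v \<le> sqrt (\<Sum>i<n. \<Sum>j<p. (M i j)\<^sup>2)"
      by (simp add: L2_set_def sum.cartesian_product')
  qed
  then have "(opn n p M)\<^sup>2 \<le> (sqrt (\<Sum>i<n. \<Sum>j<p. (M i j)\<^sup>2))\<^sup>2"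
    using opn_nonneg[OF assms] by (intro power_mono) auto
  then show ?thesis by (simp add: sum_nonneg)
qed

text \<open>An eigenvector w with eigenvalue k satisfies k |w|^2 = |X w|^2 / n, which gives the
  upper bound; a maximising right singular vector is an eigenvector attaining it. The maximum over a
  spectrum thus becomes a supremum, for which measurability, rotation invariance and comparison are
  accessible.\<close>

lemma lambda1_eq_opn:
  assumes "n \<ge> 1" "p \<ge> 1"
  shows "lambda1 n p X = (opn n p X)\<^sup>2 / real n"
proof -
  let ?C = "sample_cov n p X" and ?s = "opn n p X"
  have C: "?C \<in> carrier_mat p p" by (simp add: sample_cov_def)
  have Cv: "vec_index (?C *\<^sub>v w) j = (\<Sum>i<n. X i j * (\<Sum>k<p. X i k * vec_index w k)) / real n"
    if "w \<in> carrier_vec p" "j < p" for w j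
  proof -
    have "vec_index (?C *\<^sub>v w) j = (\<Sum>k<p. (\<Sum>i<n. X i j * X i k) / real n * vec_index w k)"
      using that by (simp add: sample_cov_def scalar_prod_def atLeast0LessThan)
    also have "\<dots> = (\<Sum>k<p. \<Sum>i<n. X i j * (X i k * vec_index w k)) / real n"
      by (simp add: sum_distrib_right sum_distrib_left sum_divide_distrib algebra_simps)
    also have "\<dots> = (\<Sum>i<n. X i j * (\<Sum>k<p. X i k * vec_index w k)) / real n"
      by (subst sum.swap) (simp add: sum_distrib_left)
    finally show ?thesis .
  qed
  have upper: "k \<le> ?s\<^sup>2 / real n" if k: "k \<in> spectrum ?C" for k
  proof -
    from k obtain w where w: "w \<in> carrier_vec p" "w \<noteq> 0\<^sub>v p" "?C *\<^sub>v w = k \<cdot>\<^sub>v w"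
      by (auto simp: spectrum_def eigenvalue_def eigenvector_def sample_cov_def)
    let ?W = "\<Sum>j<p. (vec_index w j)\<^sup>2"
    obtain j where "j < p" "vec_index w j \<noteq> 0" using w by (metis eq_vecI carrier_vecD index_zero_vec)
    then have W: "0 < ?W" by (intro sum_pos2[of _ j]) auto
    have "k * ?W = (\<Sum>j<p. vec_index w j * vec_index (k \<cdot>\<^sub>v w) j)"
      using w by (simp add: sum_distrib_left power2_eq_square algebra_simps)
    also have "\<dots> = (\<Sum>j<p. vec_index w j * (\<Sum>i<n. X i j * (\<Sum>k<p. X i k * vec_index w k))) / real n"
      unfolding w(3)[symmetric] sum_divide_distrib
      by (intro sum.cong refl) (simp add: Cv w(1))
    also have "(\<Sum>j<p. vec_index w j * (\<Sum>i<n. X i j * (\<Sum>k<p. X i k * vec_index w k))) = bil n p X (\<lambda>i. \<Sum>k<p. X i k * vec_index w k) (\<lambda>j. vec_index w j)"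
      by (simp add: bil_col)
    also have "\<dots> = (\<Sum>i<n. (\<Sum>k<p. X i k * vec_index w k)\<^sup>2)"
      by (simp add: bil_row power2_eq_square)
    also have "\<dots> \<le> ?s\<^sup>2 * ?W" by (rule norm_image_le[OF assms])
    finally have "k * ?W \<le> ?s\<^sup>2 / real n * ?W" by (simp add: divide_right_mono)
    then show ?thesis using W by (rule mult_right_le_imp_le)
  qed
  obtain u v where u: "u \<in> sphere_vec n" and v: "v \<in> sphere_vec p" and uv: "bil n p X u v = ?s"
    using opn_attained[OF assms, of X] by blast
  have vu: "bil p n (\<lambda>i j. X j i) v u = opn p n (\<lambda>i j. X j i)"
    using uv bil_transpose[of p n X v u] opn_transpose[of p n X] by simp
  note s1 = singular_vector[OF assms u v uv]
  have s2: "(\<Sum>i<n. X i j * u i) = ?s * v j" if "j < p" for j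
    using singular_vector[OF assms(2,1) v u vu that] opn_transpose[of p n X] by simp
  let ?w = "Matrix.vec p v"
  have "?C *\<^sub>v ?w = (?s\<^sup>2 / real n) \<cdot>\<^sub>v ?w"
  proof (rule eq_vecI)
    fix j assume "j < dim_vec ((?s\<^sup>2 / real n) \<cdot>\<^sub>v ?w)"
    then have j: "j < p" by simp
    have "vec_index (?C *\<^sub>v ?w) j = (\<Sum>i<n. X i j * (?s * u i)) / real n"
      using j s1 by (simp add: Cv)
    also have "(\<Sum>i<n. X i j * (?s * u i)) = ?s * (\<Sum>i<n. X i j * u i)"
      by (simp add: sum_distrib_left algebra_simps)
    also have "\<dots> = ?s * (?s * v j)" using s2[OF j] by simp
    finally show "vec_index (?C *\<^sub>v ?w) j = vec_index ((?s\<^sup>2 / real n) \<cdot>\<^sub>v ?w) j"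
      using j by (simp add: power2_eq_square)
  qed (use C in simp)
  moreover have "?w \<noteq> 0\<^sub>v p"
  proof
    assume "?w = 0\<^sub>v p"
    then have "v j = 0" if "j < p" for j using that by (metis index_vec index_zero_vec(1))
    then show False using sphere_vecD(2)[OF v] by simp
  qed
  ultimately have "?s\<^sup>2 / real n \<in> spectrum ?C"
    using C by (auto simp: spectrum_def eigenvalue_def eigenvector_def intro!: exI[of _ ?w])
  then show ?thesis
    unfolding lambda1_def using card_finite_spectrum(1)[OF C] upper by (intro Max_eqI) auto
qed


section \<open>Measurability of the operator norm\<close>

lemma rational_sequence: "\<exists>q. (\<forall>k. q k \<in> \<rat>) \<and> q \<longlonglongrightarrow> (x::real)"
proof -
  have "\<exists>r \<in> \<rat>. x < r \<and> r < x + inverse (real (Suc k))" for k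
    by (rule Rats_dense_in_real) simp
  then obtain q where q: "\<And>k. q k \<in> \<rat>" "\<And>k. x < q k" "\<And>k. q k < x + inverse (real (Suc k))"
    by metis
  have "q \<longlonglongrightarrow> x"
    by (rule tendsto_sandwich[OF _ _ tendsto_const LIMSEQ_inverse_real_of_nat_add])
      (intro always_eventually allI less_imp_le q)+
  then show ?thesis using q(1) by blast
qed

definition rational_vec :: "nat \<Rightarrow> (nat \<Rightarrow> real) set" where
  "rational_vec n = (\<lambda>f i. if i < n then f i else 0) ` (PiE {..<n} (\<lambda>_. \<rat>))"

lemma countable_rational_vec: "countable (rational_vec n)"
  unfolding rational_vec_def by (intro countable_image countable_PiE) (auto simp: countable_rat)

lemma rational_vec_sequence:
  "\<exists>q. (\<forall>k. q k \<in> rational_vec n) \<and> (\<forall>i<n. (\<lambda>k. q k i) \<longlonglongrightarrow> u i)"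
proof -
  have "\<forall>i. \<exists>q. (\<forall>k. q k \<in> \<rat>) \<and> q \<longlonglongrightarrow> u i" using rational_sequence by blast
  from choice[OF this] obtain q where q: "\<And>i k. q i k \<in> \<rat>" "\<And>i. q i \<longlonglongrightarrow> u i"
    by blast
  have "(\<lambda>i. if i < n then q i k else 0) \<in> rational_vec n" for k
  proof -
    have "(\<lambda>i. if i < n then q i k else 0) = (\<lambda>i. if i < n then (\<lambda>i\<in>{..<n}. q i k) i else 0)"
      by auto
    moreover have "(\<lambda>i\<in>{..<n}. q i k) \<in> PiE {..<n} (\<lambda>_. \<rat>)" using q(1) by auto
    ultimately show ?thesis unfolding rational_vec_def by (rule image_eqI)
  qed
  then show ?thesis
    using q(2) by (intro exI[of _ "\<lambda>k i. if i < n then q i k else 0"]) auto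
qed

text \<open>Maximising vectors are approximated coordinatewise by rational ones. These need not have
  norm one, so the condition carries both norms as factors. It presents each superlevel set of the
  norm as a countable union.\<close>

lemma less_opn_iff:
  assumes np: "n \<ge> 1" "p \<ge> 1" and c: "0 \<le> c"
  shows "c < opn n p M \<longleftrightarrow> (\<exists>u \<in> rational_vec n. \<exists>v \<in> rational_vec p.
    c * (sqrt (\<Sum>i<n. (u i)\<^sup>2) * sqrt (\<Sum>j<p. (v j)\<^sup>2)) < bil n p M u v)"
proof
  assume l: "c < opn n p M"
  obtain u v where u: "u \<in> sphere_vec n" and v: "v \<in> sphere_vec p" and uv: "bil n p M u v = opn n p M"
    using opn_attained[OF np, of M] by blast
  obtain a where a: "\<And>k. a k \<in> rational_vec n" "\<And>i. i < n \<Longrightarrow> (\<lambda>k. a k i) \<longlonglongrightarrow> u i"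
    using rational_vec_sequence[of n u] by blast
  obtain b where b: "\<And>k. b k \<in> rational_vec p" "\<And>i. i < p \<Longrightarrow> (\<lambda>k. b k i) \<longlonglongrightarrow> v i"
    using rational_vec_sequence[of p v] by blast
  have "(\<lambda>k. bil n p M (a k) (b k) - c * (sqrt (\<Sum>i<n. (a k i)\<^sup>2) * sqrt (\<Sum>j<p. (b k j)\<^sup>2)))
     \<longlonglongrightarrow> bil n p M u v - c * (sqrt (\<Sum>i<n. (u i)\<^sup>2) * sqrt (\<Sum>j<p. (v j)\<^sup>2))"
    unfolding bil_def
    by (intro tendsto_diff tendsto_mult tendsto_sum tendsto_const tendsto_real_sqrt tendsto_power) (auto intro: a b)
  also have "bil n p M u v - c * (sqrt (\<Sum>i<n. (u i)\<^sup>2) * sqrt (\<Sum>j<p. (v j)\<^sup>2)) = opn n p M - c"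
    using uv sphere_vecD(2)[OF u] sphere_vecD(2)[OF v] by simp
  finally have lim: "(\<lambda>k. bil n p M (a k) (b k) - c * (sqrt (\<Sum>i<n. (a k i)\<^sup>2) * sqrt (\<Sum>j<p. (b k j)\<^sup>2)))
     \<longlonglongrightarrow> opn n p M - c" .
  have "\<forall>\<^sub>F k in sequentially. 0 < bil n p M (a k) (b k) - c * (sqrt (\<Sum>i<n. (a k i)\<^sup>2) * sqrt (\<Sum>j<p. (b k j)\<^sup>2))"
    by (rule order_tendstoD(1)[OF lim]) (use l in simp)
  then obtain k where "0 < bil n p M (a k) (b k) - c * (sqrt (\<Sum>i<n. (a k i)\<^sup>2) * sqrt (\<Sum>j<p. (b k j)\<^sup>2))"
    by (auto simp: eventually_sequentially)
  then show "\<exists>u \<in> rational_vec n. \<exists>v \<in> rational_vec p.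
    c * (sqrt (\<Sum>i<n. (u i)\<^sup>2) * sqrt (\<Sum>j<p. (v j)\<^sup>2)) < bil n p M u v"
    using a(1) b(1) by (intro bexI[of _ "a k"] bexI[of _ "b k"]) auto
next
  assume "\<exists>u \<in> rational_vec n. \<exists>v \<in> rational_vec p.
    c * (sqrt (\<Sum>i<n. (u i)\<^sup>2) * sqrt (\<Sum>j<p. (v j)\<^sup>2)) < bil n p M u v"
  then obtain u v where "c * (sqrt (\<Sum>i<n. (u i)\<^sup>2) * sqrt (\<Sum>j<p. (v j)\<^sup>2)) < bil n p M u v"
    by blast
  also have "\<dots> \<le> opn n p M * (sqrt (\<Sum>i<n. (u i)\<^sup>2) * sqrt (\<Sum>j<p. (v j)\<^sup>2))"
    by (rule bil_le[OF np])
  finally have "c * (sqrt (\<Sum>i<n. (u i)\<^sup>2) * sqrt (\<Sum>j<p. (v j)\<^sup>2)) < opn n p M * (sqrt (\<Sum>i<n. (u i)\<^sup>2) * sqrt (\<Sum>j<p. (v j)\<^sup>2))" .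
  then show "c < opn n p M"
    by (rule mult_right_less_imp_less) (simp add: sum_nonneg)
qed

lemma borel_measurable_opn:
  assumes np: "n \<ge> 1" "p \<ge> 1" and M: "\<And>i j. i < n \<Longrightarrow> j < p \<Longrightarrow> (\<lambda>z. M z i j) \<in> borel_measurable N"
  shows "(\<lambda>z. opn n p (M z)) \<in> borel_measurable N"
  unfolding borel_measurable_iff_greater
proof
  fix c :: real
  show "{z \<in> space N. c < opn n p (M z)} \<in> sets N"
  proof (cases "0 \<le> c")
    case True
    have bil: "(\<lambda>z. bil n p (M z) u v) \<in> borel_measurable N" for u v
      unfolding bil_def by (intro borel_measurable_sum borel_measurable_times M borel_measurable_const) auto
    have "{z \<in> space N. c < opn n p (M z)} = (\<Union>u\<in>rational_vec n. \<Union>v\<in>rational_vec p.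
      {z \<in> space N. c * (sqrt (\<Sum>i<n. (u i)\<^sup>2) * sqrt (\<Sum>j<p. (v j)\<^sup>2)) < bil n p (M z) u v})"
      using less_opn_iff[OF np True] by auto
    also have "\<dots> \<in> sets N"
    proof -
      have "{z \<in> space N. c * (sqrt (\<Sum>i<n. (u i)\<^sup>2) * sqrt (\<Sum>j<p. (v j)\<^sup>2)) < bil n p (M z) u v} \<in> sets N" for u v
        using bil[of u v] unfolding borel_measurable_iff_greater by blast
      then show ?thesis by (auto intro!: sets.countable_UN'' countable_rational_vec)
    qed
    finally show ?thesis .
  next
    case False
    then have "{z \<in> space N. c < opn n p (M z)} = space N"
      using less_le_trans[OF _ opn_nonneg[OF np], of c] by auto
    then show ?thesis by simp
  qed
qed

section \<open>Plane rotations and Gaussian measures\<close>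

text \<open>With one coordinate fixed a shear translates the other one, and Lebesgue measure on the
  line is translation invariant; for the second shear Fubini changes the order of
  integration.\<close>

lemma lborel_shear:
  fixes g :: "real \<Rightarrow> real \<Rightarrow> ennreal"
  assumes [measurable]: "case_prod g \<in> borel_measurable (borel \<Otimes>\<^sub>M borel)"
  shows "(\<integral>\<^sup>+x. \<integral>\<^sup>+y. g x (y + t * x) \<partial>lborel \<partial>lborel) = (\<integral>\<^sup>+x. \<integral>\<^sup>+y. g x y \<partial>lborel \<partial>lborel)"
    and "(\<integral>\<^sup>+x. \<integral>\<^sup>+y. g (x + t * y) y \<partial>lborel \<partial>lborel) = (\<integral>\<^sup>+x. \<integral>\<^sup>+y. g x y \<partial>lborel \<partial>lborel)"
proof -
  have tr: "(\<integral>\<^sup>+y. h (y + u) \<partial>lborel) = (\<integral>\<^sup>+y. h y \<partial>lborel)"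
    if "h \<in> borel_measurable borel" for h :: "real \<Rightarrow> ennreal" and u
    using nn_integral_real_affine[OF that, of 1 u] by (simp add: add.commute)
  show "(\<integral>\<^sup>+x. \<integral>\<^sup>+y. g x (y + t * x) \<partial>lborel \<partial>lborel) = (\<integral>\<^sup>+x. \<integral>\<^sup>+y. g x y \<partial>lborel \<partial>lborel)"
    by (intro nn_integral_cong tr) measurable
  have "(\<integral>\<^sup>+x. \<integral>\<^sup>+y. g (x + t * y) y \<partial>lborel \<partial>lborel) = (\<integral>\<^sup>+y. \<integral>\<^sup>+x. g (x + t * y) y \<partial>lborel \<partial>lborel)"
    by (rule lborel_pair.Fubini') measurable
  also have "\<dots> = (\<integral>\<^sup>+y. \<integral>\<^sup>+x. g x y \<partial>lborel \<partial>lborel)"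
    by (intro nn_integral_cong tr[of "\<lambda>x. g x _"]) measurable
  also have "\<dots> = (\<integral>\<^sup>+x. \<integral>\<^sup>+y. g x y \<partial>lborel \<partial>lborel)"
    by (rule lborel_pair.Fubini'[symmetric]) measurable
  finally show "(\<integral>\<^sup>+x. \<integral>\<^sup>+y. g (x + t * y) y \<partial>lborel \<partial>lborel) = (\<integral>\<^sup>+x. \<integral>\<^sup>+y. g x y \<partial>lborel \<partial>lborel)" .
qed

text \<open>A plane rotation is a product of three shears.\<close>

lemma lborel_rotation:
  fixes g :: "real \<Rightarrow> real \<Rightarrow> ennreal"
  assumes g[measurable]: "case_prod g \<in> borel_measurable (borel \<Otimes>\<^sub>M borel)"
    and cs: "c\<^sup>2 + s\<^sup>2 = 1" "0 < 1 + c"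
  shows "(\<integral>\<^sup>+x. \<integral>\<^sup>+y. g (c * x + s * y) (c * y - s * x) \<partial>lborel \<partial>lborel) = (\<integral>\<^sup>+x. \<integral>\<^sup>+y. g x y \<partial>lborel \<partial>lborel)"
proof -
  \<comment> \<open>The tangent of half the angle, finite because 1 + c is positive.\<close>
  define t where "t = s / (1 + c)"
  have "s * s = (1 - c) * (1 + c)" using cs(1) by (simp add: power2_eq_square algebra_simps)
  then have st: "s * t = 1 - c" using cs(2) by (simp add: t_def field_simps)
  have "t * (1 + c) = s" using cs(2) by (simp add: t_def)
  then have tc: "t + t * c = s" by (simp add: algebra_simps)
  have "(\<integral>\<^sup>+x. \<integral>\<^sup>+y. g (c * x + s * y) (c * y - s * x) \<partial>lborel \<partial>lborel) =
    (\<integral>\<^sup>+x. \<integral>\<^sup>+y. (\<lambda>x y. (\<lambda>x y. g (x + t * y) y) x (y + (- s) * x)) (x + t * y) y \<partial>lborel \<partial>lborel)"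
  proof (intro nn_integral_cong)
    fix x y :: real
    have 1: "y + (- s) * (x + t * y) = c * y - s * x"
    proof -
      have "y + (- s) * (x + t * y) = y - s * x - (s * t) * y" by (simp add: algebra_simps)
      then show ?thesis unfolding st by (simp add: algebra_simps)
    qed
    have 2: "x + t * y + t * (c * y - s * x) = c * x + s * y"
    proof -
      have "x + t * y + t * (c * y - s * x) = x - (s * t) * x + (t + t * c) * y" by (simp add: algebra_simps)
      then show ?thesis unfolding st tc by (simp add: algebra_simps)
    qed
    show "g (c * x + s * y) (c * y - s * x) = (\<lambda>x y. (\<lambda>x y. g (x + t * y) y) x (y + (- s) * x)) (x + t * y) y"
      by (simp only: 1 2)
  qed
  also have "\<dots> = (\<integral>\<^sup>+x. \<integral>\<^sup>+y. (\<lambda>x y. g (x + t * y) y) x (y + (- s) * x) \<partial>lborel \<partial>lborel)"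
    by (rule lborel_shear(2)) measurable
  also have "\<dots> = (\<integral>\<^sup>+x. \<integral>\<^sup>+y. (\<lambda>x y. g (x + t * y) y) x y \<partial>lborel \<partial>lborel)"
    by (rule lborel_shear(1)) measurable
  also have "\<dots> = (\<integral>\<^sup>+x. \<integral>\<^sup>+y. g x y \<partial>lborel \<partial>lborel)"
    by (rule lborel_shear(2)) measurable
  finally show ?thesis .
qed

abbreviation lborel_fun :: "'i set \<Rightarrow> ('i \<Rightarrow> real) measure" where
  "lborel_fun I \<equiv> PiM I (\<lambda>_. lborel)"

interpretation lborel_fun: product_sigma_finite "\<lambda>_. lborel :: real measure"
  by standard

text \<open>Fubini isolates the coordinates \<open>a\<close> and \<open>b\<close>; for fixed values
  of the others the planar statement \<open>lborel_rotation\<close> applies.\<close>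

lemma lborel_fun_rotation:
  assumes I: "finite I" and ab: "a \<in> I" "b \<in> I" "a \<noteq> b" and cs: "c\<^sup>2 + s\<^sup>2 = 1" "0 < 1 + c"
  defines "T \<equiv> \<lambda>z. z(a := c * z a + s * z b, b := c * z b - s * z a)"
  shows "T \<in> measurable (lborel_fun I) (lborel_fun I)" "distr (lborel_fun I) (lborel_fun I) T = lborel_fun I"
proof -
  have [measurable]: "(\<lambda>z. z a) \<in> borel_measurable (lborel_fun I)" "(\<lambda>z. z b) \<in> borel_measurable (lborel_fun I)"
    using ab measurable_component_singleton[of _ I "\<lambda>_. lborel :: real measure"] by (auto simp: measurable_lborel1)
  show T[measurable]: "T \<in> measurable (lborel_fun I) (lborel_fun I)"
    unfolding T_def
    by (intro measurable_fun_upd[where J=I]) (use ab in auto)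
  define J where "J = I - {a, b}"
  have J: "finite J" "a \<notin> insert b J" "b \<notin> J" "I = insert a (insert b J)" "finite (insert b J)"
    using I ab by (auto simp: J_def)
  have fold: "(\<integral>\<^sup>+z. f z \<partial>lborel_fun I) = (\<integral>\<^sup>+x. \<integral>\<^sup>+w. \<integral>\<^sup>+y. f (x(b := w, a := y)) \<partial>lborel \<partial>lborel \<partial>lborel_fun J)"
    if f: "f \<in> borel_measurable (lborel_fun I)" for f :: "('a \<Rightarrow> real) \<Rightarrow> ennreal"
  proof -
    have f': "f \<in> borel_measurable (lborel_fun (insert a (insert b J)))" using f by (simp add: J(4)[symmetric])
    have "(\<lambda>x. \<integral>\<^sup>+y. f (x(a := y)) \<partial>lborel) \<in> borel_measurable (lborel_fun (insert b J))"
      using measurable_compose[OF measurable_add_dim f']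
      by (intro lborel.borel_measurable_nn_integral) (simp add: case_prod_beta')
    then show ?thesis
      unfolding J(4) by (subst lborel_fun.product_nn_integral_insert[OF J(5,2) f'])
        (subst lborel_fun.product_nn_integral_insert[OF J(1,3)], auto)
  qed
  have inv: "(\<integral>\<^sup>+z. f (T z) \<partial>lborel_fun I) = (\<integral>\<^sup>+z. f z \<partial>lborel_fun I)"
    if f[measurable]: "f \<in> borel_measurable (lborel_fun I)" for f :: "('a \<Rightarrow> real) \<Rightarrow> ennreal"
  proof -
    have "(\<integral>\<^sup>+z. f (T z) \<partial>lborel_fun I) = (\<integral>\<^sup>+x. \<integral>\<^sup>+w. \<integral>\<^sup>+y. f (T (x(b := w, a := y))) \<partial>lborel \<partial>lborel \<partial>lborel_fun J)"
      by (rule fold) measurable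
    also have "\<dots> = (\<integral>\<^sup>+x. \<integral>\<^sup>+w. \<integral>\<^sup>+y. f (x(b := w, a := y)) \<partial>lborel \<partial>lborel \<partial>lborel_fun J)"
    proof (rule nn_integral_cong)
      fix x assume x: "x \<in> space (lborel_fun J)"
      define g where "g w y = f (x(b := w, a := y))" for w y
      have "(\<lambda>(w, y). x(b := w, a := y)) \<in> measurable (lborel \<Otimes>\<^sub>M lborel) (lborel_fun (insert a (insert b J)))"
      proof -
        have "(\<lambda>(w, y). (x(b := w), y)) \<in> measurable (lborel \<Otimes>\<^sub>M lborel) (lborel_fun (insert b J) \<Otimes>\<^sub>M lborel)"
          using measurable_component_update[OF x J(3)] by (auto simp: case_prod_beta' intro!: measurable_Pair measurable_compose[OF measurable_fst])
        from measurable_compose[OF this measurable_add_dim] show ?thesis by (simp add: case_prod_beta')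
      qed
      then have "(\<lambda>(w, y). g w y) \<in> borel_measurable (lborel \<Otimes>\<^sub>M lborel)"
        unfolding g_def J(4)[symmetric] case_prod_beta' using measurable_compose[OF _ f] by blast
      then have gm: "case_prod g \<in> borel_measurable (borel \<Otimes>\<^sub>M borel)"
        by (subst measurable_cong_sets[OF sets_pair_measure_cong[of borel lborel borel lborel] refl]) auto
      \<comment> \<open>The folded integral treats \<open>b\<close> before \<open>a\<close>; in this
        order the rotation has sine \<open>- s\<close>.\<close>
      have "T (x(b := w, a := y)) = x(b := c * w + (- s) * y, a := c * y - (- s) * w)" for w y
        unfolding T_def using ab(3) by (auto simp: fun_eq_iff)
      then have "(\<integral>\<^sup>+w. \<integral>\<^sup>+y. f (T (x(b := w, a := y))) \<partial>lborel \<partial>lborel) =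
         (\<integral>\<^sup>+w. \<integral>\<^sup>+y. g (c * w + (- s) * y) (c * y - (- s) * w) \<partial>lborel \<partial>lborel)"
        by (simp only: g_def)
      also have "\<dots> = (\<integral>\<^sup>+w. \<integral>\<^sup>+y. g w y \<partial>lborel \<partial>lborel)"
        by (rule lborel_rotation[OF gm]) (use cs in auto)
      finally show "(\<integral>\<^sup>+w. \<integral>\<^sup>+y. f (T (x(b := w, a := y))) \<partial>lborel \<partial>lborel) = (\<integral>\<^sup>+w. \<integral>\<^sup>+y. f (x(b := w, a := y)) \<partial>lborel \<partial>lborel)"
        by (simp only: g_def)
    qed
    also have "\<dots> = (\<integral>\<^sup>+z. f z \<partial>lborel_fun I)" by (rule fold[symmetric, OF f])
    finally show ?thesis .
  qed
  show "distr (lborel_fun I) (lborel_fun I) T = lborel_fun I"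
  proof (rule measure_eqI)
    fix A assume "A \<in> sets (distr (lborel_fun I) (lborel_fun I) T)"
    then have A[measurable]: "A \<in> sets (lborel_fun I)" by simp
    have "emeasure (distr (lborel_fun I) (lborel_fun I) T) A = (\<integral>\<^sup>+z. indicator A z \<partial>distr (lborel_fun I) (lborel_fun I) T)"
      by simp
    also have "\<dots> = (\<integral>\<^sup>+z. indicator A (T z) \<partial>lborel_fun I)" by (rule nn_integral_distr) measurable
    also have "\<dots> = emeasure (lborel_fun I) A" by (subst inv) auto
    finally show "emeasure (distr (lborel_fun I) (lborel_fun I) T) A = emeasure (lborel_fun I) A" .
  qed simp
qed

lemma lborel_fun_flip:
  assumes I: "finite I" and a: "a \<in> I"
  defines "T \<equiv> \<lambda>z. z(a := - z a)"
  shows "T \<in> measurable (lborel_fun I) (lborel_fun I)" "distr (lborel_fun I) (lborel_fun I) T = lborel_fun I"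
proof -
  have [measurable]: "(\<lambda>z. z a) \<in> borel_measurable (lborel_fun I)"
    using a measurable_component_singleton[of _ I "\<lambda>_. lborel :: real measure"] by (auto simp: measurable_lborel1)
  show T[measurable]: "T \<in> measurable (lborel_fun I) (lborel_fun I)"
    unfolding T_def
    by (intro measurable_fun_upd[where J=I]) (use a in auto)
  define J where "J = I - {a}"
  have J: "finite J" "a \<notin> J" "I = insert a J" using I a by (auto simp: J_def)
  have inv: "(\<integral>\<^sup>+z. f (T z) \<partial>lborel_fun I) = (\<integral>\<^sup>+z. f z \<partial>lborel_fun I)"
    if f[measurable]: "f \<in> borel_measurable (lborel_fun I)" for f :: "('a \<Rightarrow> real) \<Rightarrow> ennreal"
  proof -
    have f': "f \<in> borel_measurable (lborel_fun (insert a J))" "(\<lambda>z. f (T z)) \<in> borel_measurable (lborel_fun (insert a J))"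
      unfolding J(3)[symmetric] by measurable
    have "(\<integral>\<^sup>+y. f (T (x(a := y))) \<partial>lborel) = (\<integral>\<^sup>+y. f (x(a := y)) \<partial>lborel)" if x: "x \<in> space (lborel_fun J)" for x
    proof -
      have "(\<lambda>y. f (x(a := y))) \<in> borel_measurable borel"
        using measurable_compose[OF measurable_component_update[OF x J(2)] f'(1)] by simp
      from nn_integral_real_affine[OF this, of "-1" 0] show ?thesis by (simp add: T_def)
    qed
    then have "(\<integral>\<^sup>+x. \<integral>\<^sup>+y. f (T (x(a := y))) \<partial>lborel \<partial>lborel_fun J) = (\<integral>\<^sup>+x. \<integral>\<^sup>+y. f (x(a := y)) \<partial>lborel \<partial>lborel_fun J)"
      by (rule nn_integral_cong)
    then show ?thesis
      unfolding J(3) using lborel_fun.product_nn_integral_insert[OF J(1,2) f'(1)]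
        lborel_fun.product_nn_integral_insert[OF J(1,2) f'(2)] by simp
  qed
  show "distr (lborel_fun I) (lborel_fun I) T = lborel_fun I"
  proof (rule measure_eqI)
    fix A assume "A \<in> sets (distr (lborel_fun I) (lborel_fun I) T)"
    then have A[measurable]: "A \<in> sets (lborel_fun I)" by simp
    have "emeasure (distr (lborel_fun I) (lborel_fun I) T) A = (\<integral>\<^sup>+z. indicator A z \<partial>distr (lborel_fun I) (lborel_fun I) T)"
      by simp
    also have "\<dots> = (\<integral>\<^sup>+z. indicator A (T z) \<partial>lborel_fun I)" by (rule nn_integral_distr) measurable
    also have "\<dots> = emeasure (lborel_fun I) A" by (subst inv) auto
    finally show "emeasure (distr (lborel_fun I) (lborel_fun I) T) A = emeasure (lborel_fun I) A" .
  qed simp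
qed


section \<open>Finite products of plane rotations and sign changes\<close>

datatype 'j givens = Rot 'j 'j real real | Flip 'j

text \<open>Orthogonal maps are represented by lists of elementary steps, so that every invariance
  is an induction over maps of at most two coordinates. The embedding \<open>e\<close> places the
  rotated coordinates in a larger index set; with suitable embeddings one list acts on any row or
  any column of an array.\<close>

fun givens_map :: "('j \<Rightarrow> 'i) \<Rightarrow> 'j givens \<Rightarrow> ('i \<Rightarrow> real) \<Rightarrow> 'i \<Rightarrow> real" where
  "givens_map e (Rot a b c s) z = z(e a := c * z (e a) + s * z (e b), e b := c * z (e b) - s * z (e a))"
| "givens_map e (Flip a) z = z(e a := - z (e a))"

fun act :: "('j \<Rightarrow> 'i) \<Rightarrow> 'j givens list \<Rightarrow> ('i \<Rightarrow> real) \<Rightarrow> 'i \<Rightarrow> real" where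
  "act e [] z = z"
| "act e (g # gs) z = act e gs (givens_map e g z)"

text \<open>The condition \<open>0 < 1 + c\<close> excludes only the half turn, for which the shear decomposition breaks down.\<close>

fun valid :: "'j set \<Rightarrow> 'j givens \<Rightarrow> bool" where
  "valid C (Rot a b c s) \<longleftrightarrow> a \<in> C \<and> b \<in> C \<and> a \<noteq> b \<and> c\<^sup>2 + s\<^sup>2 = 1 \<and> 0 < 1 + c"
| "valid C (Flip a) \<longleftrightarrow> a \<in> C"

fun inverse_givens :: "'j givens \<Rightarrow> 'j givens" where
  "inverse_givens (Rot a b c s) = Rot a b c (- s)"
| "inverse_givens (Flip a) = Flip a"

definition valid_list :: "'j set \<Rightarrow> 'j givens list \<Rightarrow> bool" where
  "valid_list C gs \<longleftrightarrow> (\<forall>g \<in> set gs. valid C g)"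

lemma valid_list_simps [simp]:
  "valid_list C []" "valid_list C (g # gs) \<longleftrightarrow> valid C g \<and> valid_list C gs"
  "valid_list C (gs @ hs) \<longleftrightarrow> valid_list C gs \<and> valid_list C hs"
  by (auto simp: valid_list_def)

lemma valid_list_mono: "valid_list C gs \<Longrightarrow> C \<subseteq> D \<Longrightarrow> valid_list D gs"
proof (induction gs)
  case (Cons g gs)
  then show ?case by (cases g) auto
qed simp

lemma act_append: "act e (gs @ hs) z = act e hs (act e gs z)"
  by (induction gs arbitrary: z) auto

lemma act_outside:
  assumes "valid_list C gs" "x \<notin> e ` C"
  shows "act e gs z x = z x"
  using assms
proof (induction gs arbitrary: z)
  case (Cons g gs)
  then show ?case by (cases g) auto
qed simp

lemma act_pullback:
  assumes "inj e"
  shows "act e gs z (e j) = act (\<lambda>j. j) gs (\<lambda>j. z (e j)) j"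
proof (induction gs arbitrary: z)
  case (Cons g gs)
  have "(\<lambda>j. givens_map e g z (e j)) = givens_map (\<lambda>j. j) g (\<lambda>j. z (e j))"
    using assms by (cases g) (auto simp: fun_eq_iff inj_eq)
  then show ?case using Cons[of "givens_map e g z"] by simp
qed simp

lemma act_cong:
  assumes "valid_list C gs" "\<And>j. j \<in> C \<Longrightarrow> x j = y j" "j \<in> C"
  shows "act (\<lambda>j. j) gs x j = act (\<lambda>j. j) gs y j"
  using assms(1,2)
proof (induction gs arbitrary: x y)
  case (Cons g gs)
  have "givens_map (\<lambda>j. j) g x i = givens_map (\<lambda>j. j) g y i" if "i \<in> C" for i
    using Cons.prems that by (cases g) auto
  moreover have "valid_list C gs" using Cons.prems by simp
  ultimately have "act (\<lambda>j. j) gs (givens_map (\<lambda>j. j) g x) j = act (\<lambda>j. j) gs (givens_map (\<lambda>j. j) g y) j"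
    by (intro Cons.IH)
  then show ?case by simp
qed (use assms(3) in simp)

lemma act_zero:
  assumes "valid_list C gs" "\<And>j. j \<in> C \<Longrightarrow> x j = 0"
  shows "act (\<lambda>j. j) gs x = x"
  using assms(1)
proof (induction gs)
  case (Cons g gs)
  have "givens_map (\<lambda>j. j) g x = x" using Cons.prems assms(2) by (cases g) (auto simp: fun_eq_iff)
  then show ?case using Cons by simp
qed simp

lemma givens_dot:
  assumes "finite I" "valid C g" "inj e" "e ` C \<subseteq> I"
  shows "(\<Sum>x\<in>I. givens_map e g z x * givens_map e g w x) = (\<Sum>x\<in>I. z x * w x)"
proof (cases g)
  case (Rot a b c s)
  then have ab: "e a \<in> I" "e b \<in> I" "e a \<noteq> e b" "c\<^sup>2 + s\<^sup>2 = 1"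
    using assms by (auto simp: inj_eq)
  define J where "J = I - {e a, e b}"
  have J: "finite J" "e a \<notin> insert (e b) J" "e b \<notin> J" "I = insert (e a) (insert (e b) J)" "e a \<notin> J"
    using assms(1) ab by (auto simp: J_def)
  have *: "(\<Sum>x\<in>J. givens_map e g z x * givens_map e g w x) = (\<Sum>x\<in>J. z x * w x)"
    using J Rot by (intro sum.cong) auto
  have "(c * z (e a) + s * z (e b)) * (c * w (e a) + s * w (e b)) + (c * z (e b) - s * z (e a)) * (c * w (e b) - s * w (e a))
    = (c\<^sup>2 + s\<^sup>2) * (z (e a) * w (e a) + z (e b) * w (e b))"
    by (simp add: power2_eq_square algebra_simps)
  then show ?thesis
    unfolding J(4) using J * ab Rot by simp
next
  case (Flip a)
  then have a: "e a \<in> I" using assms by auto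
  then show ?thesis using Flip by (intro sum.cong) auto
qed

lemma act_dot:
  assumes "finite I" "valid_list C gs" "inj e" "e ` C \<subseteq> I"
  shows "(\<Sum>x\<in>I. act e gs z x * act e gs w x) = (\<Sum>x\<in>I. z x * w x)"
  using assms(2)
proof (induction gs arbitrary: z w)
  case (Cons g gs)
  then show ?case using givens_dot[OF assms(1) _ assms(3,4), of g z w] by simp
qed simp

lemma givens_inverse:
  assumes "valid C g"
  shows "givens_map (\<lambda>j. j) (inverse_givens g) (givens_map (\<lambda>j. j) g z) = z" "givens_map (\<lambda>j. j) g (givens_map (\<lambda>j. j) (inverse_givens g) z) = z"
    "valid C (inverse_givens g)"
proof -
  have *: "c * (c * x + s * y) - s * (c * y - s * x) = x" "c * (c * y - s * x) + s * (c * x + s * y) = y"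
    "c * (c * x - s * y) + s * (c * y + s * x) = x" "c * (c * y + s * x) - s * (c * x - s * y) = y"
    if "c\<^sup>2 + s\<^sup>2 = 1" for c s x y :: real
  proof -
    have "c * (c * x + s * y) - s * (c * y - s * x) = (c\<^sup>2 + s\<^sup>2) * x"
      "c * (c * y - s * x) + s * (c * x + s * y) = (c\<^sup>2 + s\<^sup>2) * y"
      "c * (c * x - s * y) + s * (c * y + s * x) = (c\<^sup>2 + s\<^sup>2) * x"
      "c * (c * y + s * x) - s * (c * x - s * y) = (c\<^sup>2 + s\<^sup>2) * y"
      by (simp_all add: power2_eq_square algebra_simps)
    then show "c * (c * x + s * y) - s * (c * y - s * x) = x" "c * (c * y - s * x) + s * (c * x + s * y) = y"
      "c * (c * x - s * y) + s * (c * y + s * x) = x" "c * (c * y + s * x) - s * (c * x - s * y) = y"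
      using that by simp_all
  qed
  show "givens_map (\<lambda>j. j) (inverse_givens g) (givens_map (\<lambda>j. j) g z) = z" "givens_map (\<lambda>j. j) g (givens_map (\<lambda>j. j) (inverse_givens g) z) = z"
    "valid C (inverse_givens g)"
    using assms by (cases g; auto simp: fun_eq_iff *)+
qed

lemma act_inverse:
  assumes "valid_list C gs"
  shows "act (\<lambda>j. j) (rev (map inverse_givens gs)) (act (\<lambda>j. j) gs z) = z"
    and "act (\<lambda>j. j) gs (act (\<lambda>j. j) (rev (map inverse_givens gs)) z) = z"
    and "valid_list C (rev (map inverse_givens gs))"
proof -
  show "act (\<lambda>j. j) (rev (map inverse_givens gs)) (act (\<lambda>j. j) gs z) = z"
    using assms by (induction gs arbitrary: z) (auto simp: act_append givens_inverse)
  show "act (\<lambda>j. j) gs (act (\<lambda>j. j) (rev (map inverse_givens gs)) z) = z"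
    using assms by (induction gs arbitrary: z) (auto simp: act_append givens_inverse)
  show "valid_list C (rev (map inverse_givens gs))"
    using assms by (induction gs) (auto simp: givens_inverse)
qed

text \<open>Induction on the set of coordinates: each rotation moves one further coordinate onto the
  axis \<open>a\<close>. The base case makes the entry at \<open>a\<close> nonnegative by a sign
  change, so every later cosine q / r is nonnegative and the excluded half turn never
  occurs.\<close>

lemma rotate_to_axis:
  assumes "finite C" "a \<in> C"
  shows "\<exists>gs. valid_list C gs \<and> (\<forall>j\<in>C. act (\<lambda>j. j) gs x j = (if j = a then sqrt (\<Sum>j\<in>C. (x j)\<^sup>2) else 0))"
proof -
  have *: "\<exists>gs. valid_list (insert a D) gs \<and>
      (\<forall>j\<in>insert a D. act (\<lambda>j. j) gs x j = (if j = a then sqrt (\<Sum>j\<in>insert a D. (x j)\<^sup>2) else 0))"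
    if "finite D" "a \<notin> D" for D
    using that
  proof (induction D)
    case empty
    show ?case
    proof (cases "0 \<le> x a")
      case False
      then show ?thesis by (intro exI[of _ "[Flip a]"]) auto
    qed (auto intro!: exI[of _ "[]"])
  next
    case (insert b D)
    define q where "q = sqrt (\<Sum>j\<in>insert a D. (x j)\<^sup>2)"
    define r where "r = sqrt (\<Sum>j\<in>insert a (insert b D). (x j)\<^sup>2)"
    have "a \<notin> D" using insert.prems by auto
    from insert.IH[OF this] obtain gs where gs: "valid_list (insert a D) gs"
      and ax': "\<forall>j\<in>insert a D. act (\<lambda>j. j) gs x j = (if j = a then q else 0)"
      unfolding q_def by blast
    note ax = bspec[OF ax']
    have ab: "a \<noteq> b" "b \<notin> D" "a \<notin> D" using insert by auto
    have xb: "act (\<lambda>j. j) gs x b = x b" using act_outside[OF gs, of b "\<lambda>j. j" x] ab by auto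
    have q0: "0 \<le> q" "0 \<le> r" by (auto simp: q_def r_def sum_nonneg)
    have r2: "r\<^sup>2 = q\<^sup>2 + (x b)\<^sup>2" and q2: "q\<^sup>2 = (\<Sum>j\<in>insert a D. (x j)\<^sup>2)"
      using ab insert.hyps by (simp_all add: q_def r_def sum_nonneg)
    show ?case
    proof (cases "r = 0")
      case True
      then have "q = 0" "x b = 0" using r2 by auto
      then show ?thesis
        unfolding r_def[symmetric] using gs ax xb True valid_list_mono[OF gs, of "insert a (insert b D)"]
        by (intro exI[of _ gs]) auto
    next
      case False
      then have r: "0 < r" using q0 by simp
      have u: "(q / r)\<^sup>2 + (x b / r)\<^sup>2 = 1"
      proof -
        have "(q / r)\<^sup>2 + (x b / r)\<^sup>2 = (q\<^sup>2 + (x b)\<^sup>2) / r\<^sup>2"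
          by (simp add: power_divide add_divide_distrib)
        then show ?thesis using r unfolding r2[symmetric] by simp
      qed
      have "q / r * q + x b / r * x b = r\<^sup>2 / r"
        unfolding r2 by (simp add: add_divide_distrib power2_eq_square)
      then have "q / r * q + x b / r * x b = r" using r by (simp add: power2_eq_square)
      moreover have "q / r * x b - x b / r * q = 0" by simp
      moreover have "0 < 1 + q / r" using q0 r by (intro add_pos_nonneg) auto
      ultimately show ?thesis
        unfolding r_def[symmetric] using gs ax xb u ab valid_list_mono[OF gs, of "insert a (insert b D)"]
        by (intro exI[of _ "gs @ [Rot a b (q / r) (x b / r)]"]) (auto simp: act_append)
    qed
  qed
  have C: "insert a (C - {a}) = C" using assms by auto
  show ?thesis using *[of "C - {a}"] assms(1) unfolding C by simp
qed

lemma act_lborel_fun: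
  assumes I: "finite I" and "valid_list C gs" "inj e" "e ` C \<subseteq> I"
  shows "act e gs \<in> measurable (lborel_fun I) (lborel_fun I) \<and>
    distr (lborel_fun I) (lborel_fun I) (act e gs) = lborel_fun I"
  using assms(2)
proof (induction gs)
  case Nil
  have "act e [] = (\<lambda>z. z)" by auto
  then show ?case by (simp add: distr_id2)
next
  case (Cons g gs)
  have g: "givens_map e g \<in> measurable (lborel_fun I) (lborel_fun I) \<and>
    distr (lborel_fun I) (lborel_fun I) (givens_map e g) = lborel_fun I"
  proof (cases g)
    case (Rot a b c s)
    then have "e a \<in> I" "e b \<in> I" "e a \<noteq> e b" "c\<^sup>2 + s\<^sup>2 = 1" "0 < 1 + c"
      using Cons.prems assms by (auto simp: inj_eq)
    from lborel_fun_rotation[OF I this] show ?thesis unfolding Rot givens_map.simps by blast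
  next
    case (Flip a)
    then have "e a \<in> I" using Cons.prems assms by auto
    from lborel_fun_flip[OF I this] show ?thesis unfolding Flip givens_map.simps by blast
  qed
  have gs: "act e gs \<in> measurable (lborel_fun I) (lborel_fun I)"
    "distr (lborel_fun I) (lborel_fun I) (act e gs) = lborel_fun I" using Cons by auto
  have *: "act e (g # gs) = act e gs \<circ> givens_map e g" by auto
  have "distr (lborel_fun I) (lborel_fun I) (act e (g # gs)) =
    distr (distr (lborel_fun I) (lborel_fun I) (givens_map e g)) (lborel_fun I) (act e gs)"
    unfolding * using gs g by (subst distr_distr) auto
  then have "distr (lborel_fun I) (lborel_fun I) (act e (g # gs)) = lborel_fun I" using gs g by simp
  moreover have "act e (g # gs) \<in> measurable (lborel_fun I) (lborel_fun I)"
    unfolding * using gs g by (intro measurable_comp) auto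
  ultimately show ?case by blast
qed

section \<open>Gaussian product measures and their invariance\<close>

lemma PiM_density:
  fixes M :: "'i \<Rightarrow> 'a measure"
  assumes "product_sigma_finite M" "product_sigma_finite (\<lambda>i. density (M i) (f i))"
    and I: "finite I" and f[measurable]: "\<And>i. f i \<in> borel_measurable (M i)"
  shows "PiM I (\<lambda>i. density (M i) (f i)) = density (PiM I M) (\<lambda>x. \<Prod>i\<in>I. f i (x i))"
proof -
  interpret M: product_sigma_finite M by fact
  interpret D: product_sigma_finite "\<lambda>i. density (M i) (f i)" by fact
  have F: "(\<lambda>x. \<Prod>i\<in>I. f i (x i)) \<in> borel_measurable (PiM I M)" by measurable
  show ?thesis
  proof (rule D.PiM_eqI[symmetric])
    show "sets (density (PiM I M) (\<lambda>x. \<Prod>i\<in>I. f i (x i))) = sets (PiM I (\<lambda>i. density (M i) (f i)))"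
      by (simp cong: sets_PiM_cong)
    fix A assume "\<And>i. i \<in> I \<Longrightarrow> A i \<in> sets (density (M i) (f i))"
    then have A: "\<And>i. i \<in> I \<Longrightarrow> A i \<in> sets (M i)" by simp
    then have "emeasure (density (PiM I M) (\<lambda>x. \<Prod>i\<in>I. f i (x i))) (PiE I A) =
      (\<integral>\<^sup>+x. (\<Prod>i\<in>I. f i (x i)) * indicator (PiE I A) x \<partial>PiM I M)"
      using I by (intro emeasure_density F sets_PiM_I_finite) auto
    also have "\<dots> = (\<integral>\<^sup>+x. (\<Prod>i\<in>I. f i (x i) * indicator (A i) (x i)) \<partial>PiM I M)"
    proof (rule nn_integral_cong)
      fix x assume "x \<in> space (PiM I M)"
      then have "(x \<in> PiE I A) = (\<forall>i\<in>I. x i \<in> A i)" by (auto simp: space_PiM PiE_def Pi_def)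
      then show "(\<Prod>i\<in>I. f i (x i)) * indicator (PiE I A) x = (\<Prod>i\<in>I. f i (x i) * indicator (A i) (x i))"
        using I by (auto simp: prod.distrib indicator_def prod_zero_iff)
    qed
    also have "\<dots> = (\<Prod>i\<in>I. \<integral>\<^sup>+x. f i x * indicator (A i) x \<partial>M i)"
      using I A by (intro M.product_nn_integral_prod) auto
    also have "\<dots> = (\<Prod>i\<in>I. emeasure (density (M i) (f i)) (A i))"
      using A by (intro prod.cong refl emeasure_density[symmetric] f) auto
    finally show "emeasure (density (PiM I M) (\<lambda>x. \<Prod>i\<in>I. f i (x i))) (PiE I A) = (\<Prod>i\<in>I. emeasure (density (M i) (f i)) (A i))" .
  qed fact
qed

definition std_gauss :: "'i set \<Rightarrow> ('i \<Rightarrow> real) measure" where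
  "std_gauss I = PiM I (\<lambda>_. std_normal_distribution)"

lemma prob_space_std_normal: "prob_space std_normal_distribution"
  by (rule prob_space_normal_density) simp

lemma prob_space_std_gauss: "prob_space (std_gauss I)"
  unfolding std_gauss_def by (intro prob_space_PiM prob_space_std_normal)

interpretation std_normal: product_sigma_finite "\<lambda>_. std_normal_distribution"
  using prob_space_imp_sigma_finite[OF prob_space_std_normal] by (simp add: product_sigma_finite_def)

lemma sets_std_gauss: "sets (std_gauss I) = sets (lborel_fun I)"
  unfolding std_gauss_def by (intro sets_PiM_cong) auto

lemma space_std_gauss: "space (std_gauss I) = PiE I (\<lambda>_. UNIV)"
  unfolding std_gauss_def by (simp add: space_PiM)

lemma std_gauss_density:
  assumes "finite I"
  shows "std_gauss I = density (lborel_fun I) (\<lambda>z. ennreal ((1 / sqrt (2 * pi)) ^ card I * exp (- (\<Sum>i\<in>I. (z i)\<^sup>2) / 2)))"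
proof -
  have "std_gauss I = density (lborel_fun I) (\<lambda>z. \<Prod>i\<in>I. ennreal (std_normal_density (z i)))"
    unfolding std_gauss_def
    by (intro PiM_density assms) (auto intro!: lborel_fun.product_sigma_finite_axioms std_normal.product_sigma_finite_axioms)
  also have "(\<lambda>z. \<Prod>i\<in>I. ennreal (std_normal_density (z i))) =
    (\<lambda>z. ennreal ((1 / sqrt (2 * pi)) ^ card I * exp (- (\<Sum>i\<in>I. (z i)\<^sup>2) / 2)))"
    by (simp add: prod_ennreal std_normal_density_def prod_dividef prod.distrib exp_sum[OF assms, symmetric] sum_negf
        sum_divide_distrib power_divide)
  finally show ?thesis .
qed

text \<open>The maps preserve Lebesgue measure, and the Gaussian density depends only on the sum of
  squares, which they preserve as well.\<close>

lemma act_std_gauss: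
  fixes e :: "'j \<Rightarrow> 'i"
  assumes I: "finite I" and gs: "valid_list C gs" "inj e" "e ` C \<subseteq> I"
  shows "act e gs \<in> measurable (std_gauss I) (std_gauss I)"
    and "distr (std_gauss I) (std_gauss I) (act e gs) = std_gauss I"
proof -
  let ?L = "lborel_fun I" and ?T = "act e gs"
  define F where "F z = ennreal ((1 / sqrt (2 * pi)) ^ card I * exp (- (\<Sum>i\<in>I. (z i)\<^sup>2) / 2))" for z
  have T: "?T \<in> measurable ?L ?L" "distr ?L ?L ?T = ?L" using act_lborel_fun[OF I gs] by auto
  show "?T \<in> measurable (std_gauss I) (std_gauss I)"
    using T(1) by (simp cong: measurable_cong_sets add: sets_std_gauss)
  have F: "F \<in> borel_measurable ?L"
    unfolding F_def by measurable
  have FT: "F (?T z) = F z" for z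
    using act_dot[OF I gs, of z z] by (simp add: F_def power2_eq_square)
  have G: "std_gauss I = density ?L F" unfolding F_def by (rule std_gauss_density[OF I])
  have "distr (std_gauss I) (std_gauss I) ?T = distr (density ?L F) ?L ?T"
    unfolding G by (intro distr_cong) auto
  also have "\<dots> = distr (density ?L (\<lambda>z. F (?T z))) ?L ?T" by (simp only: FT)
  also have "\<dots> = density (distr ?L ?L ?T) F" by (rule density_distr[OF F T(1), symmetric])
  finally show "distr (std_gauss I) (std_gauss I) ?T = std_gauss I" unfolding T(2) G .
qed

section \<open>Bidiagonal reduction of a Gaussian matrix\<close>

text \<open>Rotating the test vector \<open>v\<close> along with the rows leaves the form unchanged,
  which gives one inequality for every list; the inverse list gives the other.\<close>

lemma opn_act:
  assumes np: "n \<ge> 1" "p \<ge> 1" and gs: "valid_list {..<p} gs"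
  shows "opn n p (\<lambda>i. act (\<lambda>j. j) gs (M i)) = opn n p M"
proof -
  have le: "opn n p M \<le> opn n p (\<lambda>i. act (\<lambda>j. j) gs (M i))" if gs: "valid_list {..<p} gs" for gs M
  proof (rule opn_le[OF np])
    fix u v assume u: "u \<in> sphere_vec n" and v: "v \<in> sphere_vec p"
    have dot: "(\<Sum>j<p. act (\<lambda>j. j) gs x j * act (\<lambda>j. j) gs y j) = (\<Sum>j<p. x j * y j)" for x y
      by (rule act_dot[OF finite_lessThan gs]) auto
    have "act (\<lambda>j. j) gs v \<in> sphere_vec p"
      using sphere_vecD[OF v] act_outside[OF gs, of _ "\<lambda>j. j" v] dot[of v v]
      by (auto simp: sphere_vec_def power2_eq_square)
    from bil_le_opn[OF np u this, of "\<lambda>i. act (\<lambda>j. j) gs (M i)"]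
    show "bil n p M u v \<le> opn n p (\<lambda>i. act (\<lambda>j. j) gs (M i))"
      by (simp add: bil_row dot)
  qed
  have "opn n p (\<lambda>i. act (\<lambda>j. j) gs (M i)) \<le> opn n p M"
    using le[OF act_inverse(3)[OF gs], of "\<lambda>i. act (\<lambda>j. j) gs (M i)"] by (simp add: act_inverse(1)[OF gs])
  with le[OF gs, of M] show ?thesis by simp
qed

text \<open>Applying the same list to each row of \<open>rs\<close> is a rotation of the columns. It
  is composed row by row because invariance of the Gaussian law is known for one embedded copy at a
  time; the copies do not interact since their index sets are disjoint.\<close>

definition act_rows :: "(nat \<Rightarrow> nat \<Rightarrow> 'i) \<Rightarrow> nat givens list \<Rightarrow> nat list \<Rightarrow> ('i \<Rightarrow> real) \<Rightarrow> 'i \<Rightarrow> real" where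
  "act_rows e gs rs = fold (\<lambda>i. act (e i) gs) rs"

lemma act_rows_apply:
  assumes e: "\<And>i j i' j'. e i j = e i' j' \<Longrightarrow> i = i' \<and> j = j'" and gs: "valid_list C gs"
    and "distinct rs" "i \<in> set rs"
  shows "act_rows e gs rs z (e i j) = act (\<lambda>j. j) gs (\<lambda>j. z (e i j)) j"
  using assms(3,4)
proof (induction rs arbitrary: z)
  case (Cons r rs)
  have inj: "inj (e i)" for i using e by (auto intro: injI)
  have off: "act (e r) gs z (e i' j) = z (e i' j)" if "i' \<noteq> r" for i' j
    using that e by (intro act_outside[OF gs]) auto
  have skip: "act_rows e gs rs z (e r j) = z (e r j)" if "r \<notin> set rs" for z rs
    using that
  proof (induction rs arbitrary: z)
    case (Cons s rs)
    have "act (e s) gs z (e r j) = z (e r j)"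
      using Cons.prems e by (intro act_outside[OF gs]) auto
    then show ?case using Cons by (simp add: act_rows_def)
  qed (simp add: act_rows_def)
  show ?case
  proof (cases "i = r")
    case True
    then show ?thesis
      using skip[of rs "act (e r) gs z"] Cons.prems act_pullback[OF inj, of r gs z j] by (simp add: act_rows_def)
  next
    case False
    then have "act_rows e gs rs (act (e r) gs z) (e i j) = act (\<lambda>j. j) gs (\<lambda>j. act (e r) gs z (e i j)) j"
      using Cons by auto
    then show ?thesis using off[OF False] by (simp add: act_rows_def)
  qed
qed simp

lemma act_rows_std_gauss:
  assumes I: "finite I" and e: "\<And>i j i' j'. e i j = e i' j' \<Longrightarrow> i = i' \<and> j = j'" and gs: "valid_list C gs"
    and "\<And>i j. i \<in> set rs \<Longrightarrow> j \<in> C \<Longrightarrow> e i j \<in> I"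
  shows "act_rows e gs rs \<in> measurable (std_gauss I) (std_gauss I) \<and>
    distr (std_gauss I) (std_gauss I) (act_rows e gs rs) = std_gauss I"
  using assms(4)
proof (induction rs)
  case Nil
  have "act_rows e gs [] = (\<lambda>z. z)" by (auto simp: act_rows_def)
  then show ?case by (simp add: distr_id2)
next
  case (Cons r rs)
  have "inj (e r)" using e by (auto intro: injI)
  moreover have "e r ` C \<subseteq> I" using Cons.prems by auto
  ultimately have r: "act (e r) gs \<in> measurable (std_gauss I) (std_gauss I)"
    "distr (std_gauss I) (std_gauss I) (act (e r) gs) = std_gauss I"
    using act_std_gauss[OF I gs] by auto
  have rs: "act_rows e gs rs \<in> measurable (std_gauss I) (std_gauss I)"
    "distr (std_gauss I) (std_gauss I) (act_rows e gs rs) = std_gauss I" using Cons by auto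
  have *: "act_rows e gs (r # rs) = act_rows e gs rs \<circ> act (e r) gs" by (auto simp: act_rows_def)
  have "distr (std_gauss I) (std_gauss I) (act_rows e gs (r # rs)) =
    distr (distr (std_gauss I) (std_gauss I) (act (e r) gs)) (std_gauss I) (act_rows e gs rs)"
    unfolding * using r rs by (subst distr_distr) auto
  moreover have "act_rows e gs (r # rs) \<in> measurable (std_gauss I) (std_gauss I)"
    unfolding * using r rs by (intro measurable_comp) auto
  ultimately show ?case using r rs by simp
qed

lemma borel_measurable_sqrt_comp:
  "f \<in> borel_measurable M \<Longrightarrow> (\<lambda>x. sqrt (f x)) \<in> borel_measurable M"
  by measurable

text \<open>Conditionally on row \<open>k\<close>, a rotation of the columns in \<open>C\<close> that moves this row to its first axis
  preserves the law of the remaining rows.\<close>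

lemma reduce_row:
  fixes e :: "nat \<Rightarrow> nat \<Rightarrow> 'i" and D :: "('i \<Rightarrow> real) \<Rightarrow> nat \<Rightarrow> nat \<Rightarrow> real"
  assumes np: "n \<ge> 1" "p \<ge> 1" and I: "finite I"
    and e: "\<And>i j i' j'. e i j = e i' j' \<Longrightarrow> i = i' \<and> j = j'"
    and R: "R \<subseteq> {..<n}" and k: "k < n" "k \<notin> R" and C: "C \<subseteq> {..<p}" and c: "c \<in> C"
    and eI: "\<And>i j. i \<in> insert k R \<Longrightarrow> j \<in> C \<Longrightarrow> e i j \<in> I"
    and meas: "\<And>i j. i < n \<Longrightarrow> j < p \<Longrightarrow> (\<lambda>z. D z i j) \<in> borel_measurable (std_gauss I)"
    and D1: "\<And>z i j. i \<in> insert k R \<Longrightarrow> j \<in> C \<Longrightarrow> D z i j = z (e i j)"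
    and D2: "\<And>z i j. i \<in> R \<Longrightarrow> j < p \<Longrightarrow> j \<notin> C \<Longrightarrow> D z i j = 0"
    and D3: "\<And>z i j. i < n \<Longrightarrow> i \<notin> insert k R \<Longrightarrow> j \<in> C \<Longrightarrow> D z i j = 0"
    and D4: "\<And>z z' i j. (\<And>x. (\<And>i j. i \<in> R \<Longrightarrow> j \<in> C \<Longrightarrow> x \<noteq> e i j) \<Longrightarrow> z x = z' x) \<Longrightarrow>
       i < n \<Longrightarrow> j < p \<Longrightarrow> i \<notin> R \<Longrightarrow> D z i j = D z' i j"
    and f: "f \<in> borel_measurable borel"
  shows "(\<integral>\<^sup>+z. f (opn n p (D z)) \<partial>std_gauss I) =
    (\<integral>\<^sup>+z. f (opn n p (\<lambda>i j. if i = k \<and> j \<in> C then if j = c then sqrt (\<Sum>j\<in>C. (z (e k j))\<^sup>2) else 0 else D z i j)) \<partial>std_gauss I)"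
proof -
  define D' where "D' z i j = (if i = k \<and> j \<in> C then if j = c then sqrt (\<Sum>j\<in>C. (z (e k j))\<^sup>2) else 0 else D z i j)" for z i j
  \<comment> \<open>\<open>B\<close> holds the raw entries that get mixed. Row \<open>k\<close> lies
    in the complement \<open>A\<close>, so the rotation, chosen from \<open>x\<close>, is constant
    while \<open>y\<close> is integrated.\<close>
  define B where "B = (\<lambda>(i, j). e i j) ` (R \<times> C)"
  define A where "A = I - B"
  have BI: "B \<subseteq> I" using eI by (auto simp: B_def)
  have AB: "A \<inter> B = {}" "finite A" "finite B" "A \<union> B = I"
    using I BI finite_subset[OF BI I] by (auto simp: A_def)
  have fC: "finite C" and fR: "finite R" using C R finite_subset by blast+
  have kA: "e k j \<in> A" if "j \<in> C" for j
  proof -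
    have "e k j \<noteq> e i' j'" if "i' \<in> R" for i' j' using e[of k j i' j'] that k by auto
    then show ?thesis using that eI[of k j] by (auto simp: A_def B_def)
  qed
  have notB: "x \<notin> B" if "\<And>i j. i \<in> R \<Longrightarrow> j \<in> C \<Longrightarrow> x \<noteq> e i j" for x using that by (auto simp: B_def)
  have meas': "(\<lambda>z. D' z i j) \<in> borel_measurable (std_gauss I)" if "i < n" "j < p" for i j
  proof -
    have [measurable]: "(\<lambda>z. z (e k j)) \<in> borel_measurable (std_gauss I)" if "j \<in> C" for j
      using eI[of k j] that unfolding std_gauss_def by simp
    show ?thesis
      using meas[OF that] unfolding D'_def
      by (cases "i = k \<and> j \<in> C") (auto intro!: borel_measurable_sum borel_measurable_power borel_measurable_sqrt_comp)
  qed
  have fm: "(\<lambda>z. f (opn n p (D z))) \<in> borel_measurable (std_gauss I)"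
    by (rule measurable_compose[OF borel_measurable_opn[OF np meas] f])
  have fm': "(\<lambda>z. f (opn n p (D' z))) \<in> borel_measurable (std_gauss I)"
    by (rule measurable_compose[OF borel_measurable_opn[OF np meas'] f])
  have fold: "(\<integral>\<^sup>+z. g z \<partial>std_gauss I) = (\<integral>\<^sup>+x. \<integral>\<^sup>+y. g (merge A B (x, y)) \<partial>std_gauss B \<partial>std_gauss A)"
    if "g \<in> borel_measurable (std_gauss I)" for g :: "_ \<Rightarrow> ennreal"
    using std_normal.product_nn_integral_fold[OF AB(1-3)] that unfolding std_gauss_def AB(4) by blast
  have "(\<integral>\<^sup>+z. f (opn n p (D z)) \<partial>std_gauss I) =
    (\<integral>\<^sup>+x. \<integral>\<^sup>+y. f (opn n p (D (merge A B (x, y)))) \<partial>std_gauss B \<partial>std_gauss A)"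
    by (rule fold[OF fm])
  also have "\<dots> = (\<integral>\<^sup>+x. \<integral>\<^sup>+y. f (opn n p (D' (merge A B (x, y)))) \<partial>std_gauss B \<partial>std_gauss A)"
  proof (rule nn_integral_cong)
    fix x assume x: "x \<in> space (std_gauss A)"
    obtain gs where gs: "valid_list C gs"
      and "\<forall>j\<in>C. act (\<lambda>j. j) gs (\<lambda>j. x (e k j)) j = (if j = c then sqrt (\<Sum>j\<in>C. (x (e k j))\<^sup>2) else 0)"
      using rotate_to_axis[OF fC c, of "\<lambda>j. x (e k j)"] by blast
    note axis = bspec[OF this(2)]
    define T where "T = act_rows e gs (sorted_list_of_set R)"
    have eB: "e i j \<in> B" if "i \<in> set (sorted_list_of_set R)" "j \<in> C" for i j
      using that fR unfolding B_def by (intro image_eqI[of _ _ "(i, j)"]) auto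
    have "T \<in> measurable (std_gauss B) (std_gauss B) \<and> distr (std_gauss B) (std_gauss B) T = std_gauss B"
      unfolding T_def
      by (rule act_rows_std_gauss[OF AB(3) _ gs]; (rule e; assumption | rule eB; assumption))
    then have T: "T \<in> measurable (std_gauss B) (std_gauss B)" "distr (std_gauss B) (std_gauss B) T = std_gauss B"
      by blast+
    \<comment> \<open>The rotation acts on all columns in \<open>C\<close> at once: rows in
      \<open>R\<close> receive rotated raw entries and vanish outside \<open>C\<close> by
      \<open>D2\<close>, row \<open>k\<close> becomes an axis, and the remaining rows vanish on
      \<open>C\<close> by \<open>D3\<close>. By \<open>D4\<close> entries outside the rows
      \<open>R\<close> do not depend on \<open>B\<close>.\<close>
    have key: "opn n p (D (merge A B (x, y))) = opn n p (D' (merge A B (x, T y)))" for y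
    proof -
      let ?m = "merge A B (x, y)" and ?m' = "merge A B (x, T y)"
      have off: "?m x' = ?m' x'" if "\<And>i j. i \<in> R \<Longrightarrow> j \<in> C \<Longrightarrow> x' \<noteq> e i j" for x'
        using notB[OF that] by (simp add: merge_def)
      have same: "D ?m i j = D ?m' i j" if "i < n" "j < p" "i \<notin> R" for i j
        by (rule D4[OF off that])
      have "opn n p (D ?m) = opn n p (\<lambda>i. act (\<lambda>j. j) gs (D ?m i))"
        by (rule opn_act[OF np valid_list_mono[OF gs C], symmetric])
      also have "\<dots> = opn n p (D' ?m')"
      proof (rule opn_cong)
        fix i j assume ij: "i < n" "j < p"
        show "act (\<lambda>j. j) gs (D ?m i) j = D' ?m' i j"
        proof (cases "j \<in> C")
          case False
          then have "act (\<lambda>j. j) gs (D ?m i) j = D ?m i j" by (intro act_outside[OF gs]) auto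
          also have "\<dots> = D ?m' i j"
            using same[OF ij] D2[OF _ ij(2) False, of i] by (cases "i \<in> R") auto
          finally show ?thesis using False by (simp add: D'_def)
        next
          case jC: True
          consider "i \<in> R" | "i = k" | "i \<notin> insert k R" by blast
          then show ?thesis
          proof cases
            case 1
            have eB: "e i j' \<in> B" if "j' \<in> C" for j' using 1 that by (force simp: B_def)
            have "D ?m i j' = y (e i j')" if "j' \<in> C" for j'
              using 1 that eB[OF that] AB(1) by (simp add: D1 merge_def) blast
            then have "act (\<lambda>j. j) gs (D ?m i) j = act (\<lambda>j. j) gs (\<lambda>j. y (e i j)) j"
              by (intro act_cong[OF gs] jC) auto
            also have "\<dots> = T y (e i j)"
              unfolding T_def
              by (rule sym, rule act_rows_apply[OF _ gs]; (rule e; assumption | use 1 fR in simp))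
            also have "\<dots> = D ?m' i j"
              using 1 jC eB[OF jC] AB(1) by (simp add: D1 merge_def) blast
            finally show ?thesis using 1 k by (auto simp: D'_def)
          next
            case 2
            have mk: "?m (e k j') = x (e k j')" "?m' (e k j') = x (e k j')" if "j' \<in> C" for j'
              using kA[OF that] by (simp_all add: merge_def)
            have "act (\<lambda>j. j) gs (D ?m i) j = act (\<lambda>j. j) gs (\<lambda>j. x (e k j)) j"
              using 2 by (intro act_cong[OF gs] jC) (simp add: D1 mk)
            then show ?thesis using 2 jC axis[OF jC] by (simp add: D'_def mk cong: sum.cong)
          next
            case 3
            then have "act (\<lambda>j. j) gs (D ?m i) = D ?m i" using ij by (intro act_zero[OF gs] D3) auto
            then show ?thesis using 3 same[OF ij] by (auto simp: D'_def)
          qed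
        qed
      qed
      finally show ?thesis .
    qed
    have "(\<lambda>y. merge A B (x, y)) \<in> measurable (std_gauss B) (std_gauss I)"
      using measurable_compose[OF measurable_Pair1'[OF x, of "std_gauss B"] measurable_merge[of A B "\<lambda>_. std_normal_distribution", folded std_gauss_def]]
      by (simp add: AB(4))
    from measurable_compose[OF this fm']
    have m: "(\<lambda>y. f (opn n p (D' (merge A B (x, y))))) \<in> borel_measurable (std_gauss B)" .
    have "(\<integral>\<^sup>+y. f (opn n p (D' (merge A B (x, y)))) \<partial>std_gauss B) =
      (\<integral>\<^sup>+y. f (opn n p (D' (merge A B (x, y)))) \<partial>distr (std_gauss B) (std_gauss B) T)"
      by (simp only: T(2))
    also have "\<dots> = (\<integral>\<^sup>+y. f (opn n p (D' (merge A B (x, T y)))) \<partial>std_gauss B)"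
      by (rule nn_integral_distr[OF T(1)]) (use m in simp)
    finally show "(\<integral>\<^sup>+y. f (opn n p (D (merge A B (x, y)))) \<partial>std_gauss B) = (\<integral>\<^sup>+y. f (opn n p (D' (merge A B (x, y)))) \<partial>std_gauss B)"
      by (simp only: key)
  qed
  also have "\<dots> = (\<integral>\<^sup>+z. f (opn n p (D' z)) \<partial>std_gauss I)" by (rule fold[OF fm', symmetric])
  finally show ?thesis unfolding D'_def .
qed


text \<open>Norms of raw entries: row \<open>i\<close> from the diagonal on, column \<open>j\<close>
  strictly below it. Each reduction preserves the law of the entries still untouched, so that later
  norms may be taken in the original array; since the index sets are disjoint, the resulting
  bidiagonal entries are independent.\<close>

definition row_norm :: "nat \<Rightarrow> (nat \<times> nat \<Rightarrow> real) \<Rightarrow> nat \<Rightarrow> real" where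
  "row_norm p z i = sqrt (\<Sum>j\<in>{i..<p}. (z (i, j))\<^sup>2)"

definition col_norm :: "nat \<Rightarrow> (nat \<times> nat \<Rightarrow> real) \<Rightarrow> nat \<Rightarrow> real" where
  "col_norm n z j = sqrt (\<Sum>i\<in>{Suc j..<n}. (z (i, j))\<^sup>2)"

text \<open>The array \<open>z\<close> after its first \<open>k\<close> rows and its first \<open>l\<close> columns were reduced to bidiagonal shape.\<close>

definition partial_bidiag :: "nat \<Rightarrow> nat \<Rightarrow> nat \<Rightarrow> nat \<Rightarrow> (nat \<times> nat \<Rightarrow> real) \<Rightarrow> nat \<Rightarrow> nat \<Rightarrow> real" where
  "partial_bidiag n p k l z i j =
    (if i \<le> j then (if i < k then (if i = j then row_norm p z i else 0) else z (i, j))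
     else (if j < l then (if i = Suc j then col_norm n z j else 0) else z (i, j)))"

lemma borel_measurable_coordinate: "x \<in> I \<Longrightarrow> (\<lambda>z. z x) \<in> borel_measurable (std_gauss I)"
  unfolding std_gauss_def by simp

lemma borel_measurable_partial_bidiag:
  assumes "i < n" "j < p" "n \<le> p"
  shows "(\<lambda>z. partial_bidiag n p k l z i j) \<in> borel_measurable (std_gauss ({..<n} \<times> {..<p}))"
proof -
  let ?G = "std_gauss ({..<n} \<times> {..<p})"
  have "(\<lambda>z. row_norm p z i) \<in> borel_measurable ?G"
    unfolding row_norm_def using assms
    by (intro borel_measurable_sqrt_comp borel_measurable_sum borel_measurable_power borel_measurable_coordinate) auto
  moreover have "(\<lambda>z. col_norm n z j) \<in> borel_measurable ?G"
    unfolding col_norm_def using assms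
    by (intro borel_measurable_sqrt_comp borel_measurable_sum borel_measurable_power borel_measurable_coordinate) auto
  moreover have "(\<lambda>z. z (i, j)) \<in> borel_measurable ?G"
    using assms by (intro borel_measurable_coordinate) auto
  ultimately show ?thesis unfolding partial_bidiag_def by auto
qed

lemma partial_bidiag_row_step:
  assumes n: "n \<le> p" "k < n" and f: "f \<in> borel_measurable borel"
  shows "(\<integral>\<^sup>+z. f (opn n p (partial_bidiag n p k k z)) \<partial>std_gauss ({..<n} \<times> {..<p})) =
    (\<integral>\<^sup>+z. f (opn n p (partial_bidiag n p (Suc k) k z)) \<partial>std_gauss ({..<n} \<times> {..<p}))"
proof -
  let ?R = "{k<..<n}" and ?C = "{k..<p}"
  have "(\<integral>\<^sup>+z. f (opn n p (partial_bidiag n p k k z)) \<partial>std_gauss ({..<n} \<times> {..<p})) =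
    (\<integral>\<^sup>+z. f (opn n p (\<lambda>i j. if i = k \<and> j \<in> ?C then if j = k then sqrt (\<Sum>j\<in>?C. (z (k, j))\<^sup>2) else 0
       else partial_bidiag n p k k z i j)) \<partial>std_gauss ({..<n} \<times> {..<p}))"
  proof (rule reduce_row[where R = "?R" and e = Pair, OF _ _ _ _ _ _ _ _ _ _ _ _ _ _ _ f])
    show "(\<lambda>z. partial_bidiag n p k k z i j) \<in> borel_measurable (std_gauss ({..<n} \<times> {..<p}))"
      if "i < n" "j < p" for i j
      by (rule borel_measurable_partial_bidiag[OF that n(1)])
    fix z z' :: "nat \<times> nat \<Rightarrow> real" and i j
    assume eq: "\<And>x. (\<And>i j. i \<in> ?R \<Longrightarrow> j \<in> ?C \<Longrightarrow> x \<noteq> (i, j)) \<Longrightarrow> z x = z' x"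
      and ij: "i < n" "j < p" "i \<notin> ?R"
    have eq': "z (a, b) = z' (a, b)" if "a \<le> k \<or> b < k" for a b
      using that by (intro eq) auto
    have "row_norm p z i = row_norm p z' i" if "i < k"
      unfolding row_norm_def using that by (intro arg_cong[of _ _ sqrt] sum.cong refl) (auto simp: eq')
    moreover have "col_norm n z j = col_norm n z' j" if "j < k"
      unfolding col_norm_def using that by (intro arg_cong[of _ _ sqrt] sum.cong refl) (auto simp: eq')
    moreover have "z (i, j) = z' (i, j)" using ij by (intro eq) auto
    ultimately show "partial_bidiag n p k k z i j = partial_bidiag n p k k z' i j"
      by (auto simp: partial_bidiag_def)
  qed (use n in \<open>auto simp: partial_bidiag_def\<close>)
  also have "\<dots> = (\<integral>\<^sup>+z. f (opn n p (partial_bidiag n p (Suc k) k z)) \<partial>std_gauss ({..<n} \<times> {..<p}))"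
    by (intro nn_integral_cong arg_cong[of _ _ f] opn_cong) (auto simp: partial_bidiag_def row_norm_def less_Suc_eq)
  finally show ?thesis .
qed

text \<open>A row reduction of the transposed array, with \<open>Suc k\<close> as axis so that the
  mass lands just below the diagonal. In the last column nothing lies below the diagonal and the two
  arrays agree.\<close>

lemma partial_bidiag_col_step:
  assumes n: "n \<le> p" "k < n" and f: "f \<in> borel_measurable borel"
  shows "(\<integral>\<^sup>+z. f (opn n p (partial_bidiag n p (Suc k) k z)) \<partial>std_gauss ({..<n} \<times> {..<p})) =
    (\<integral>\<^sup>+z. f (opn n p (partial_bidiag n p (Suc k) (Suc k) z)) \<partial>std_gauss ({..<n} \<times> {..<p}))"
proof (cases "Suc k < n")
  case True
  let ?R = "{k<..<p}" and ?C = "{Suc k..<n}"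
  have "(\<integral>\<^sup>+z. f (opn n p (partial_bidiag n p (Suc k) k z)) \<partial>std_gauss ({..<n} \<times> {..<p})) =
    (\<integral>\<^sup>+z. f (opn p n (\<lambda>i j. partial_bidiag n p (Suc k) k z j i)) \<partial>std_gauss ({..<n} \<times> {..<p}))"
    by (simp only: opn_transpose[of p n "partial_bidiag n p (Suc k) k _"])
  also have "\<dots> = (\<integral>\<^sup>+z. f (opn p n (\<lambda>i j. if i = k \<and> j \<in> ?C then if j = Suc k then sqrt (\<Sum>j\<in>?C. (z (j, k))\<^sup>2) else 0
       else partial_bidiag n p (Suc k) k z j i)) \<partial>std_gauss ({..<n} \<times> {..<p}))"
  proof (rule reduce_row[where R = "?R" and e = "\<lambda>i j. (j, i)", OF _ _ _ _ _ _ _ _ _ _ _ _ _ _ _ f])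
    show "(\<lambda>z. partial_bidiag n p (Suc k) k z j i) \<in> borel_measurable (std_gauss ({..<n} \<times> {..<p}))"
      if "i < p" "j < n" for i j
      by (rule borel_measurable_partial_bidiag[OF that(2,1) n(1)])
    fix z z' :: "nat \<times> nat \<Rightarrow> real" and i j
    assume eq: "\<And>x. (\<And>i j. i \<in> ?R \<Longrightarrow> j \<in> ?C \<Longrightarrow> x \<noteq> (j, i)) \<Longrightarrow> z x = z' x"
      and ij: "i < p" "j < n" "i \<notin> ?R"
    have eq': "z (a, b) = z' (a, b)" if "a \<le> k \<or> b \<le> k" for a b
      using that by (intro eq) auto
    have "row_norm p z j = row_norm p z' j" if "j \<le> k"
      unfolding row_norm_def using that by (intro arg_cong[of _ _ sqrt] sum.cong refl) (auto simp: eq')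
    moreover have "col_norm n z i = col_norm n z' i" if "i \<le> k"
      unfolding col_norm_def using that by (intro arg_cong[of _ _ sqrt] sum.cong refl) (auto simp: eq')
    moreover have "z (j, i) = z' (j, i)" using ij by (intro eq) auto
    ultimately show "partial_bidiag n p (Suc k) k z j i = partial_bidiag n p (Suc k) k z' j i"
      by (auto simp: partial_bidiag_def)
  qed (use n True in \<open>auto simp: partial_bidiag_def\<close>)
  also have "\<dots> = (\<integral>\<^sup>+z. f (opn p n (\<lambda>i j. partial_bidiag n p (Suc k) (Suc k) z j i)) \<partial>std_gauss ({..<n} \<times> {..<p}))"
    by (intro nn_integral_cong arg_cong[of _ _ f] opn_cong) (auto simp: partial_bidiag_def col_norm_def less_Suc_eq)
  also have "\<dots> = (\<integral>\<^sup>+z. f (opn n p (partial_bidiag n p (Suc k) (Suc k) z)) \<partial>std_gauss ({..<n} \<times> {..<p}))"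
    by (simp only: opn_transpose[of p n "partial_bidiag n p (Suc k) (Suc k) _"])
  finally show ?thesis .
next
  case False
  then show ?thesis
    using n by (intro nn_integral_cong arg_cong[of _ _ f] opn_cong) (auto simp: partial_bidiag_def)
qed

definition bidiag :: "(nat \<Rightarrow> real) \<Rightarrow> (nat \<Rightarrow> real) \<Rightarrow> nat \<Rightarrow> nat \<Rightarrow> real" where
  "bidiag a b i j = (if i = j then a i else if i = Suc j then b j else 0)"

lemma opn_zero_columns:
  assumes n: "n \<ge> 1" "n \<le> p" and z: "\<And>i j. i < n \<Longrightarrow> n \<le> j \<Longrightarrow> j < p \<Longrightarrow> M i j = 0"
  shows "opn n p M = opn n n M"
proof (rule antisym)
  have p: "p \<ge> 1" using n by simp
  have eq: "bil n p M u v = bil n n M u v" for u v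
    unfolding bil_def using n z by (intro sum.cong sum.mono_neutral_right) auto
  show "opn n p M \<le> opn n n M"
  proof (rule opn_le[OF n(1) p])
    fix u v assume u: "u \<in> sphere_vec n" and v: "v \<in> sphere_vec p"
    have "(\<Sum>j<n. (v j)\<^sup>2) \<le> (\<Sum>j<p. (v j)\<^sup>2)" using n by (intro sum_mono2) auto
    then have "opn n n M * (sqrt (\<Sum>i<n. (u i)\<^sup>2) * sqrt (\<Sum>j<n. (v j)\<^sup>2)) \<le> opn n n M * (1 * 1)"
      using sphere_vecD(2)[OF u] sphere_vecD(2)[OF v] opn_nonneg[OF n(1) n(1)]
      by (intro mult_left_mono mult_mono) (auto simp: sum_nonneg)
    then show "bil n p M u v \<le> opn n n M" unfolding eq using bil_le[OF n(1) n(1), of M u v] by simp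
  qed
  show "opn n n M \<le> opn n p M"
  proof (rule opn_le[OF n(1) n(1)])
    fix u v assume u: "u \<in> sphere_vec n" and v: "v \<in> sphere_vec n"
    have "(\<Sum>j<p. (v j)\<^sup>2) = (\<Sum>j<n. (v j)\<^sup>2)"
      using n v by (intro sum.mono_neutral_right) (auto simp: sphere_vec_def)
    then have "v \<in> sphere_vec p" using v n by (auto simp: sphere_vec_def)
    then show "bil n n M u v \<le> opn n p M" unfolding eq[symmetric] by (rule bil_le_opn[OF n(1) p u])
  qed
qed

text \<open>Row and column steps alternate. Only the law of the norm is compared, through integrals
  of arbitrary nonnegative functions of it, so that the steps chain by transitivity; the columns
  from \<open>n\<close> on are zero at the end and are dropped.\<close>

lemma opn_bidiag_law:
  assumes n: "1 \<le> n" "n \<le> p" and f: "f \<in> borel_measurable borel"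
  shows "(\<integral>\<^sup>+z. f (opn n p (\<lambda>i j. z (i, j))) \<partial>std_gauss ({..<n} \<times> {..<p})) =
    (\<integral>\<^sup>+z. f (opn n n (bidiag (row_norm p z) (col_norm n z))) \<partial>std_gauss ({..<n} \<times> {..<p}))"
proof -
  have *: "(\<integral>\<^sup>+z. f (opn n p (\<lambda>i j. z (i, j))) \<partial>std_gauss ({..<n} \<times> {..<p})) =
    (\<integral>\<^sup>+z. f (opn n p (partial_bidiag n p k k z)) \<partial>std_gauss ({..<n} \<times> {..<p}))" if "k \<le> n" for k
    using that
  proof (induction k)
    case 0
    then show ?case by (intro nn_integral_cong arg_cong[of _ _ f] opn_cong) (auto simp: partial_bidiag_def)
  next
    case (Suc k)
    then show ?case
      using partial_bidiag_row_step[OF n(2) _ f, of k] partial_bidiag_col_step[OF n(2) _ f, of k] by simp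
  qed
  have "opn n p (partial_bidiag n p n n z) = opn n n (bidiag (row_norm p z) (col_norm n z))" for z
  proof -
    have "opn n p (partial_bidiag n p n n z) = opn n n (partial_bidiag n p n n z)"
      by (rule opn_zero_columns[OF n]) (auto simp: partial_bidiag_def)
    also have "\<dots> = opn n n (bidiag (row_norm p z) (col_norm n z))"
      by (rule opn_cong) (auto simp: partial_bidiag_def bidiag_def)
    finally show ?thesis .
  qed
  then show ?thesis using *[of n] by simp
qed

lemma bil_bidiag:
  "bil n n (bidiag a b) u v = bidiag_form n a b u v"
proof -
  have "bil n n (bidiag a b) u v = (\<Sum>j<n. \<Sum>i<n. bidiag a b i j * (u i * v j))"
    unfolding bil_def by (rule sum.swap)
  also have "\<dots> = (\<Sum>j<n. a j * (u j * v j) + (if j < n - 1 then b j * (u (Suc j) * v j) else 0))"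
  proof (rule sum.cong)
    fix j assume j: "j \<in> {..<n}"
    have "(\<Sum>i<n. bidiag a b i j * (u i * v j)) =
      (\<Sum>i<n. (if i = j then a j * (u j * v j) else 0) + (if i = Suc j then b j * (u (Suc j) * v j) else 0))"
      by (intro sum.cong) (auto simp: bidiag_def)
    also have "\<dots> = a j * (u j * v j) + (if j < n - 1 then b j * (u (Suc j) * v j) else 0)"
      using j by (auto simp: sum.distrib)
    finally show "(\<Sum>i<n. bidiag a b i j * (u i * v j)) = \<dots>" .
  qed simp
  also have "\<dots> = bidiag_form n a b u v"
    unfolding bidiag_form_def sum.distrib
    by (intro arg_cong2[of _ _ _ _ "(+)"] refl sum.mono_neutral_cong_right) auto
  finally show ?thesis .
qed

section \<open>Concentration and scaling\<close>

text \<open>Tilting by exp (c t^2) turns the standard normal density into a multiple of the normal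
  density with variance 1 / (1 - 2 c).\<close>

lemma nn_integral_std_normal_exp_square:
  fixes c :: real
  assumes "c < 1 / 2"
  shows "(\<integral>\<^sup>+t. ennreal (exp (c * t\<^sup>2)) \<partial>std_normal_distribution) = ennreal (1 / sqrt (1 - 2 * c))"
proof -
  define \<sigma> where "\<sigma> = 1 / sqrt (1 - 2 * c)"
  have \<sigma>: "0 < \<sigma>" using assms by (simp add: \<sigma>_def)
  have s2: "1 / \<sigma>\<^sup>2 = 1 - 2 * c" using assms by (simp add: \<sigma>_def power_divide)
  have "std_normal_density t * exp (c * t\<^sup>2) = \<sigma> * normal_density 0 \<sigma> t" for t
  proof -
    have "- t\<^sup>2 / (2 * \<sigma>\<^sup>2) = - t\<^sup>2 / 2 * (1 / \<sigma>\<^sup>2)" by simp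
    also have "\<dots> = - t\<^sup>2 / 2 + c * t\<^sup>2" unfolding s2 by (simp add: field_simps)
    finally have "exp (- t\<^sup>2 / (2 * \<sigma>\<^sup>2)) = exp (- t\<^sup>2 / 2) * exp (c * t\<^sup>2)" by (simp only: exp_add)
    then show ?thesis
      using \<sigma> by (simp add: normal_density_def real_sqrt_mult)
  qed
  then have "(\<integral>\<^sup>+t. ennreal (exp (c * t\<^sup>2)) \<partial>std_normal_distribution) = (\<integral>\<^sup>+t. ennreal \<sigma> * ennreal (normal_density 0 \<sigma> t) \<partial>lborel)"
    using \<sigma> by (subst nn_integral_density) (auto simp: ennreal_mult'[symmetric])
  also have "\<dots> = ennreal \<sigma> * (\<integral>\<^sup>+t. ennreal (normal_density 0 \<sigma> t) \<partial>lborel)"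
    by (rule nn_integral_cmult) simp
  also have "(\<integral>\<^sup>+t. ennreal (normal_density 0 \<sigma> t) \<partial>lborel) = 1"
    using prob_space.emeasure_space_1[OF prob_space_normal_density[OF \<sigma>, of 0]]
    by (simp add: emeasure_density)
  finally show ?thesis by (simp add: \<sigma>_def)
qed

lemma chi_square_mgf_bound:
  fixes c :: real
  assumes "\<bar>c\<bar> \<le> 1 / 4"
  shows "exp (- c) / sqrt (1 - 2 * c) \<le> exp (4 * c\<^sup>2)"
proof -
  have "\<bar>ln (1 + (- 2 * c)) - (- 2 * c)\<bar> \<le> 2 * (- 2 * c)\<^sup>2"
    using assms by (intro abs_ln_one_plus_x_minus_x_bound) auto
  then have *: "- c - ln (1 - 2 * c) / 2 \<le> 4 * c\<^sup>2" by (simp add: power2_eq_square abs_le_iff)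
  have pos: "0 < 1 - 2 * c" using assms by auto
  have "exp (- c - ln (1 - 2 * c) / 2) = exp (- c) / sqrt (1 - 2 * c)"
    using pos by (simp add: exp_diff ln_sqrt[symmetric])
  then show ?thesis using * by (metis exp_le_cancel_iff)
qed

lemma chi_square_sum_mgf:
  assumes I: "finite I" and S: "S \<subseteq> I" and c: "\<And>x. x \<in> S \<Longrightarrow> \<bar>c x\<bar> \<le> 1 / 4"
  shows "(\<integral>\<^sup>+z. ennreal (exp (\<Sum>x\<in>S. c x * ((z x)\<^sup>2 - 1))) \<partial>std_gauss I) \<le> ennreal (exp (4 * (\<Sum>x\<in>S. (c x)\<^sup>2)))"
proof -
  have fS: "finite S" using S I by (rule finite_subset)
  define g where "g x t = (if x \<in> S then ennreal (exp (c x * (t\<^sup>2 - 1))) else 1)" for x and t :: real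
  have "(\<Prod>x\<in>I. g x (z x)) = ennreal (exp (\<Sum>x\<in>S. c x * ((z x)\<^sup>2 - 1)))" for z
  proof -
    have "(\<Prod>x\<in>I. g x (z x)) = (\<Prod>x\<in>S. ennreal (exp (c x * ((z x)\<^sup>2 - 1))))"
      using I S by (intro prod.mono_neutral_cong_right) (auto simp: g_def)
    then show ?thesis by (simp add: prod_ennreal exp_sum[OF fS])
  qed
  then have "(\<integral>\<^sup>+z. ennreal (exp (\<Sum>x\<in>S. c x * ((z x)\<^sup>2 - 1))) \<partial>std_gauss I) = (\<integral>\<^sup>+z. (\<Prod>x\<in>I. g x (z x)) \<partial>std_gauss I)"
    by simp
  also have "\<dots> = (\<Prod>x\<in>I. \<integral>\<^sup>+t. g x t \<partial>std_normal_distribution)"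
    unfolding std_gauss_def by (rule std_normal.product_nn_integral_prod[OF I]) (simp add: g_def)
  also have "\<dots> = (\<Prod>x\<in>S. \<integral>\<^sup>+t. g x t \<partial>std_normal_distribution)"
    using I S prob_space.emeasure_space_1[OF prob_space_std_normal]
    by (intro prod.mono_neutral_right) (auto simp: g_def)
  also have "\<dots> \<le> (\<Prod>x\<in>S. ennreal (exp (4 * (c x)\<^sup>2)))"
  proof (intro prod_mono_ennreal)
    fix x assume x: "x \<in> S"
    have cx: "c x < 1 / 2" using c[OF x] by auto
    have "(\<integral>\<^sup>+t. g x t \<partial>std_normal_distribution) = (\<integral>\<^sup>+t. ennreal (exp (- c x)) * ennreal (exp (c x * t\<^sup>2)) \<partial>std_normal_distribution)"
      using x by (simp add: g_def ennreal_mult'[symmetric] exp_add[symmetric] algebra_simps)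
    also have "\<dots> = ennreal (exp (- c x)) * (\<integral>\<^sup>+t. ennreal (exp (c x * t\<^sup>2)) \<partial>std_normal_distribution)"
      by (rule nn_integral_cmult) simp
    also have "\<dots> = ennreal (exp (- c x) / sqrt (1 - 2 * c x))"
      unfolding nn_integral_std_normal_exp_square[OF cx] using cx by (simp add: ennreal_mult'[symmetric])
    also have "\<dots> \<le> ennreal (exp (4 * (c x)\<^sup>2))"
      by (intro ennreal_leI chi_square_mgf_bound c x)
    finally show "(\<integral>\<^sup>+t. g x t \<partial>std_normal_distribution) \<le> ennreal (exp (4 * (c x)\<^sup>2))" .
  qed
  also have "\<dots> = ennreal (exp (4 * (\<Sum>x\<in>S. (c x)\<^sup>2)))"
    by (simp add: prod_ennreal exp_sum[OF fS] sum_distrib_left)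
  finally show ?thesis .
qed

lemma borel_measurable_chi_sum:
  assumes "S \<subseteq> I"
  shows "(\<lambda>z. \<Sum>x\<in>S. c x * ((z x)\<^sup>2 - 1)) \<in> borel_measurable (std_gauss I)"
  using assms
  by (intro borel_measurable_sum borel_measurable_times borel_measurable_const borel_measurable_diff
      borel_measurable_power borel_measurable_coordinate) auto

text \<open>Markov's inequality for the exponential of the sum. Parameter one suffices because the
  weights are already scaled such that the exponent in \<open>chi_square_sum_mgf\<close> is at most
  1.\<close>

lemma chi_square_sum_tail:
  assumes I: "finite I" and S: "S \<subseteq> I" and c: "\<And>x. x \<in> S \<Longrightarrow> \<bar>c x\<bar> \<le> 1 / 4"
    and V: "4 * (\<Sum>x\<in>S. (c x)\<^sup>2) \<le> 1"
  shows "measure (std_gauss I) {z \<in> space (std_gauss I). t \<le> (\<Sum>x\<in>S. c x * ((z x)\<^sup>2 - 1))} \<le> exp (1 - t)"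
proof -
  interpret prob_space "std_gauss I" by (rule prob_space_std_gauss)
  let ?Y = "\<lambda>z. \<Sum>x\<in>S. c x * ((z x)\<^sup>2 - 1)"
  let ?A = "{z \<in> space (std_gauss I). t \<le> ?Y z}"
  have [measurable]: "?Y \<in> borel_measurable (std_gauss I)" by (rule borel_measurable_chi_sum[OF S])
  have "emeasure (std_gauss I) ?A = (\<integral>\<^sup>+z. indicator ?A z \<partial>std_gauss I)" by simp
  also have "\<dots> \<le> (\<integral>\<^sup>+z. ennreal (exp (- t)) * ennreal (exp (?Y z)) \<partial>std_gauss I)"
    by (intro nn_integral_mono) (auto simp: indicator_def ennreal_mult'[symmetric] exp_add[symmetric] simp flip: ennreal_1 intro!: ennreal_leI)
  also have "\<dots> = ennreal (exp (- t)) * (\<integral>\<^sup>+z. ennreal (exp (?Y z)) \<partial>std_gauss I)"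
    by (rule nn_integral_cmult) measurable
  also have "\<dots> \<le> ennreal (exp (- t)) * ennreal (exp 1)"
    using V by (intro mult_left_mono order_trans[OF chi_square_sum_mgf[OF I S c]] ennreal_leI) auto
  also have "\<dots> = ennreal (exp (1 - t))" by (simp add: ennreal_mult'[symmetric] exp_add[symmetric])
  finally show ?thesis by (simp add: emeasure_eq_measure)
qed

text \<open>A window of consecutive row or column norms is a weighted sum of centred squares with
  disjoint index sets \<open>H i\<close>.\<close>

lemma window_tail:
  fixes H :: "nat \<Rightarrow> 'i set"
  assumes I: "finite I" and H: "\<And>i. i < N \<Longrightarrow> H i \<subseteq> I" "\<And>i. i < N \<Longrightarrow> H i \<noteq> {}"
    and disj: "\<And>i j. i < N \<Longrightarrow> j < N \<Longrightarrow> i \<noteq> j \<Longrightarrow> H i \<inter> H j = {}"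
    and l: "4 \<le> l" and k: "k \<le> l" "s + k \<le> N"
  shows "measure (std_gauss I) {z \<in> space (std_gauss I).
      \<not> \<bar>\<Sum>j<k. linearized_dev (real (card (H (s + j)))) (sqrt (\<Sum>x\<in>H (s + j). (z x)\<^sup>2))\<bar> \<le> \<tau>} \<le> 2 * exp (1 - \<tau> / sqrt l)"
    and "{z \<in> space (std_gauss I).
      \<not> \<bar>\<Sum>j<k. linearized_dev (real (card (H (s + j)))) (sqrt (\<Sum>x\<in>H (s + j). (z x)\<^sup>2))\<bar> \<le> \<tau>} \<in> sets (std_gauss I)"
proof -
  interpret prob_space "std_gauss I" by (rule prob_space_std_gauss)
  have fH: "finite (H i)" if "i < N" for i using H(1)[OF that] I by (rule finite_subset)
  have sN: "s + j < N" if "j < k" for j using that k by auto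
  define S where "S = (\<Union>j<k. H (s + j))"
  \<comment> \<open>Disjointness lets a point determine its block, so that the weight of a square is
    a function of the point alone.\<close>
  define ind where "ind x = (THE j. j < k \<and> x \<in> H (s + j))" for x
  have ind: "ind x = j" if "j < k" "x \<in> H (s + j)" for j x
    unfolding ind_def
  proof (rule the_equality)
    fix j' assume j': "j' < k \<and> x \<in> H (s + j')"
    show "j' = j"
    proof (rule ccontr)
      assume "j' \<noteq> j"
      then have "H (s + j') \<inter> H (s + j) = {}" using j' that sN by (intro disj) auto
      then show False using j' that by blast
    qed
  qed (use that in auto)
  define q where "q x = 1 / (2 * sqrt (real (card (H (s + ind x)))))" for x
  have S: "S \<subseteq> I" unfolding S_def using H(1) sN by auto
  have cpos: "1 \<le> card (H (s + j))" if "j < k" for j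
    using fH[OF sN[OF that]] H(2)[OF sN[OF that]] by (simp add: Suc_le_eq card_gt_0_iff)
  have sumS: "(\<Sum>x\<in>S. f x) = (\<Sum>j<k. \<Sum>x\<in>H (s + j). f x)" for f :: "_ \<Rightarrow> real"
  proof -
    have "H (s + i) \<inter> H (s + j) = {}" if "i < k" "j < k" "i \<noteq> j" for i j
      using that sN by (intro disj) auto
    then show ?thesis unfolding S_def using fH sN by (intro sum.UNION_disjoint) auto
  qed
  have W: "(\<Sum>j<k. linearized_dev (real (card (H (s + j)))) (sqrt (\<Sum>x\<in>H (s + j). (z x)\<^sup>2))) = (\<Sum>x\<in>S. q x * ((z x)\<^sup>2 - 1))" for z
  proof -
    have "(\<Sum>x\<in>H (s + j). q x * ((z x)\<^sup>2 - 1)) = linearized_dev (real (card (H (s + j)))) (sqrt (\<Sum>x\<in>H (s + j). (z x)\<^sup>2))"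
      if j: "j < k" for j
    proof -
      have "(\<Sum>x\<in>H (s + j). q x * ((z x)\<^sup>2 - 1)) = (\<Sum>x\<in>H (s + j). ((z x)\<^sup>2 - 1) / (2 * sqrt (real (card (H (s + j))))))"
        using ind[OF j] by (intro sum.cong) (auto simp: q_def)
      also have "\<dots> = linearized_dev (real (card (H (s + j)))) (sqrt (\<Sum>x\<in>H (s + j). (z x)\<^sup>2))"
        by (simp add: linearized_dev_def sum_nonneg sum_subtractf flip: sum_divide_distrib)
      finally show ?thesis .
    qed
    then show ?thesis unfolding sumS by simp
  qed
  have q: "\<bar>q x\<bar> \<le> 1 / 2" if "x \<in> S" for x
  proof -
    from that obtain j where j: "j < k" "x \<in> H (s + j)" by (auto simp: S_def)
    have "1 \<le> sqrt (real (card (H (s + j))))" using cpos[OF j(1)] by simp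
    then show ?thesis by (simp add: q_def ind[OF j] field_simps)
  qed
  \<comment> \<open>The normalisation in \<open>linearized_dev\<close> cancels the block sizes:
    every block contributes 1/4.\<close>
  have q2: "(\<Sum>x\<in>S. (q x)\<^sup>2) = real k / 4"
  proof -
    have "(\<Sum>x\<in>H (s + j). (q x)\<^sup>2) = 1 / 4" if j: "j < k" for j
    proof -
      have "(\<Sum>x\<in>H (s + j). (q x)\<^sup>2) = (\<Sum>x\<in>H (s + j). 1 / (4 * real (card (H (s + j)))))"
        using ind[OF j] by (intro sum.cong) (auto simp: q_def power_divide power_mult_distrib)
      then show ?thesis using cpos[OF j] by simp
    qed
    then have "(\<Sum>j<k. \<Sum>x\<in>H (s + j). (q x)\<^sup>2) = (\<Sum>j<k. 1 / 4)" by (intro sum.cong) auto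
    then show ?thesis unfolding sumS by simp
  qed
  \<comment> \<open>Division by sqrt l, at least 2, brings the weights below 1/4 and the exponent
    below k / l, as \<open>chi_square_sum_tail\<close> requires.\<close>
  have l0: "0 < sqrt (real l)" "2 \<le> sqrt (real l)" using l by (auto intro: real_le_rsqrt)
  let ?W = "\<lambda>z. \<Sum>x\<in>S. q x * ((z x)\<^sup>2 - 1)"
  have tail: "prob {z \<in> space (std_gauss I). \<tau> \<le> \<epsilon> * ?W z} \<le> exp (1 - \<tau> / sqrt l)" if \<epsilon>: "\<bar>\<epsilon>\<bar> = 1" for \<epsilon> :: real
  proof -
    have "prob {z \<in> space (std_gauss I). \<tau> / sqrt l \<le> (\<Sum>x\<in>S. \<epsilon> / sqrt l * q x * ((z x)\<^sup>2 - 1))} \<le> exp (1 - \<tau> / sqrt l)"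
    proof (rule chi_square_sum_tail[OF I S])
      show "\<bar>\<epsilon> / sqrt (real l) * q x\<bar> \<le> 1 / 4" if "x \<in> S" for x
      proof -
        have "\<bar>\<epsilon> / sqrt (real l) * q x\<bar> = 1 / sqrt (real l) * \<bar>q x\<bar>" using \<epsilon> l0 by (simp add: abs_mult)
        also have "\<dots> \<le> 1 / 2 * (1 / 2)"
          using q[OF that] l0 by (intro mult_mono) (auto simp: field_simps)
        finally show ?thesis by simp
      qed
      have "(\<Sum>x\<in>S. (\<epsilon> / sqrt (real l) * q x)\<^sup>2) = (\<epsilon> / sqrt (real l))\<^sup>2 * (real k / 4)"
        unfolding power_mult_distrib q2[symmetric] by (simp add: sum_distrib_left)
      also have "(\<epsilon> / sqrt (real l))\<^sup>2 = 1 / real l"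
        using \<epsilon> by (simp add: power_divide abs_square_eq_1[symmetric])
      finally have "4 * (\<Sum>x\<in>S. (\<epsilon> / sqrt (real l) * q x)\<^sup>2) = real k / real l" by simp
      also have "\<dots> \<le> 1" using k l by simp
      finally show "4 * (\<Sum>x\<in>S. (\<epsilon> / sqrt (real l) * q x)\<^sup>2) \<le> 1" .
    qed
    also have "(\<lambda>z. \<Sum>x\<in>S. \<epsilon> / sqrt l * q x * ((z x)\<^sup>2 - 1)) = (\<lambda>z. \<epsilon> * ?W z / sqrt l)"
      by (simp add: sum_distrib_left sum_divide_distrib algebra_simps)
    then have "{z \<in> space (std_gauss I). \<tau> / sqrt l \<le> (\<Sum>x\<in>S. \<epsilon> / sqrt l * q x * ((z x)\<^sup>2 - 1))} =
      {z \<in> space (std_gauss I). \<tau> \<le> \<epsilon> * ?W z}"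
      using l0 by (simp add: fun_eq_iff divide_le_cancel)
    finally show ?thesis .
  qed
  have [measurable]: "?W \<in> borel_measurable (std_gauss I)" by (rule borel_measurable_chi_sum[OF S])
  show "{z \<in> space (std_gauss I).
      \<not> \<bar>\<Sum>j<k. linearized_dev (real (card (H (s + j)))) (sqrt (\<Sum>x\<in>H (s + j). (z x)\<^sup>2))\<bar> \<le> \<tau>} \<in> sets (std_gauss I)"
    unfolding W by measurable
  have "prob {z \<in> space (std_gauss I). \<not> \<bar>?W z\<bar> \<le> \<tau>} \<le>
    prob ({z \<in> space (std_gauss I). \<tau> \<le> 1 * ?W z} \<union> {z \<in> space (std_gauss I). \<tau> \<le> (- 1) * ?W z})"
    by (intro finite_measure_mono) auto
  also have "\<dots> \<le> prob {z \<in> space (std_gauss I). \<tau> \<le> 1 * ?W z} + prob {z \<in> space (std_gauss I). \<tau> \<le> (- 1) * ?W z}"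
    by (intro measure_Un_le) measurable
  also have "\<dots> \<le> 2 * exp (1 - \<tau> / sqrt l)"
    using tail[of 1] tail[of "-1"] by simp
  finally show "prob {z \<in> space (std_gauss I).
      \<not> \<bar>\<Sum>j<k. linearized_dev (real (card (H (s + j)))) (sqrt (\<Sum>x\<in>H (s + j). (z x)\<^sup>2))\<bar> \<le> \<tau>} \<le> 2 * exp (1 - \<tau> / sqrt l)"
    unfolding W .
qed


section \<open>The effect of scaling on a Gaussian law\<close>

definition scale_on :: "'i set \<Rightarrow> real \<Rightarrow> ('i \<Rightarrow> real) \<Rightarrow> 'i \<Rightarrow> real" where
  "scale_on S \<kappa> z = (\<lambda>x. if x \<in> S then \<kappa> * z x else z x)"

text \<open>Density of the centred normal law with variance 1 / (1 - s) relative to the standard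
  one.\<close>

definition scale_density :: "real \<Rightarrow> real \<Rightarrow> real" where
  "scale_density s t = sqrt (1 - s) * exp (s * t\<^sup>2 / 2)"

lemma borel_measurable_scale_density [measurable]: "scale_density s \<in> borel_measurable borel"
  unfolding scale_density_def[abs_def] by measurable

lemma distr_std_normal_scale:
  fixes s :: real
  assumes "s < 1"
  shows "distr std_normal_distribution std_normal_distribution ((*) (1 / sqrt (1 - s))) =
    density std_normal_distribution (\<lambda>t. ennreal (scale_density s t))"
proof (rule measure_eqI)
  let ?N = std_normal_distribution
  fix A assume "A \<in> sets (distr ?N ?N ((*) (1 / sqrt (1 - s))))"
  then have A[measurable]: "A \<in> sets borel" by simp
  define c where "c = sqrt (1 - s)"
  have c: "0 < c" "c\<^sup>2 = 1 - s" using assms by (auto simp: c_def)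
  let ?f = "\<lambda>t. ennreal (std_normal_density t) * indicator A (1 / c * t)"
  have m: "?f \<in> borel_measurable borel" by measurable
  have "emeasure (distr ?N ?N ((*) (1 / c))) A = (\<integral>\<^sup>+t. indicator A (1 / c * t) \<partial>?N)"
    by (subst nn_integral_indicator[symmetric], simp, subst nn_integral_distr) auto
  also have "\<dots> = (\<integral>\<^sup>+t. ?f t \<partial>lborel)"
    by (subst nn_integral_density) auto
  also have "\<dots> = ennreal \<bar>c\<bar> * (\<integral>\<^sup>+t. ?f (0 + c * t) \<partial>lborel)"
    using c by (intro nn_integral_real_affine m) auto
  also have "\<dots> = (\<integral>\<^sup>+t. ennreal \<bar>c\<bar> * ?f (0 + c * t) \<partial>lborel)"
    by (rule nn_integral_cmult[symmetric]) measurable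
  also have "\<dots> = (\<integral>\<^sup>+t. ennreal (std_normal_density t) * (ennreal (scale_density s t) * indicator A t) \<partial>lborel)"
  proof (rule nn_integral_cong)
    fix t :: real
    have "- (c * t)\<^sup>2 / 2 = - t\<^sup>2 / 2 + s * t\<^sup>2 / 2"
      using c by (simp add: power_mult_distrib left_diff_distrib diff_divide_distrib)
    then have "c * std_normal_density (c * t) = std_normal_density t * scale_density s t"
      by (simp add: std_normal_density_def scale_density_def c_def[symmetric] exp_add[symmetric])
    then have "ennreal c * ennreal (std_normal_density (c * t)) = ennreal (std_normal_density t) * ennreal (scale_density s t)"
      using c assms by (simp add: ennreal_mult'[symmetric] scale_density_def)
    then show "ennreal \<bar>c\<bar> * ?f (0 + c * t) = ennreal (std_normal_density t) * (ennreal (scale_density s t) * indicator A t)"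
      using c by (simp add: mult.assoc[symmetric])
  qed
  also have "\<dots> = (\<integral>\<^sup>+t. ennreal (scale_density s t) * indicator A t \<partial>?N)"
    by (subst nn_integral_density) (auto simp: scale_density_def)
  also have "\<dots> = emeasure (density ?N (\<lambda>t. ennreal (scale_density s t))) A"
    by (subst emeasure_density) (auto simp: scale_density_def)
  finally show "emeasure (distr ?N ?N ((*) (1 / sqrt (1 - s)))) A = emeasure (density ?N (\<lambda>t. ennreal (scale_density s t))) A"
    unfolding c_def .
qed simp

lemma distr_std_gauss_scale:
  assumes I: "finite I" and S: "S \<subseteq> I" and s: "s < 1"
  defines "T \<equiv> scale_on S (1 / sqrt (1 - s))"
  shows "T \<in> measurable (std_gauss I) (std_gauss I)"
    "distr (std_gauss I) (std_gauss I) T = density (std_gauss I) (\<lambda>z. \<Prod>x\<in>S. ennreal (scale_density s (z x)))"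
proof -
  let ?N = std_normal_distribution
  define \<rho> where "\<rho> x t = (if x \<in> S then ennreal (scale_density s t) else 1)" for x :: 'a and t
  have "(\<lambda>t. \<rho> x t) \<in> borel_measurable ?N" for x
    by (cases "x \<in> S") (simp_all add: \<rho>_def)
  then have \<rho>[measurable]: "\<rho> x \<in> borel_measurable ?N" for x by simp
  have S': "x \<in> I" if "x \<in> S" for x using S that by blast
  show T[measurable]: "T \<in> measurable (std_gauss I) (std_gauss I)"
    unfolding std_gauss_def T_def
  proof (rule measurable_PiM_single')
    show "(\<lambda>z. scale_on S (1 / sqrt (1 - s)) z x) \<in> measurable (PiM I (\<lambda>_. ?N)) ?N" if "x \<in> I" for x
      using that unfolding scale_on_def by auto
    show "(\<lambda>z x. scale_on S (1 / sqrt (1 - s)) z x) \<in> space (PiM I (\<lambda>_. ?N)) \<rightarrow> PiE I (\<lambda>_. space ?N)"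
      using S' by (auto simp: space_PiM PiE_def extensional_def scale_on_def)
  qed
  have dN: "density ?N (\<rho> x) = (if x \<in> S then distr ?N ?N ((*) (1 / sqrt (1 - s))) else ?N)" for x
    unfolding \<rho>_def distr_std_normal_scale[OF s] by (simp add: density_1)
  have dp: "prob_space (density ?N (\<rho> x))" for x
    unfolding dN using prob_space_std_normal by (auto intro!: prob_space.prob_space_distr)
  have ps: "product_sigma_finite (\<lambda>x. density ?N (\<rho> x))"
    using prob_space_imp_sigma_finite[OF dp] by (simp add: product_sigma_finite_def)
  interpret D: product_sigma_finite "\<lambda>x. density ?N (\<rho> x)" by (rule ps)
  have "distr (std_gauss I) (std_gauss I) T = PiM I (\<lambda>x. density ?N (\<rho> x))"
  proof (rule D.PiM_eqI[OF I])
    show "sets (distr (std_gauss I) (std_gauss I) T) = sets (PiM I (\<lambda>x. density ?N (\<rho> x)))"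
      unfolding std_gauss_def by (simp cong: sets_PiM_cong)
    fix A assume "\<And>x. x \<in> I \<Longrightarrow> A x \<in> sets (density ?N (\<rho> x))"
    then have A: "\<And>x. x \<in> I \<Longrightarrow> A x \<in> sets borel" by simp
    let ?B = "\<lambda>x. if x \<in> S then ((*) (1 / sqrt (1 - s))) -` A x else A x"
    have mu: "((*) (1 / sqrt (1 - s))) \<in> measurable ?N ?N" by simp
    have B: "?B x \<in> sets borel" if "x \<in> I" for x
      using measurable_sets[OF mu, of "A x"] A[OF that] by auto
    have "emeasure (distr (std_gauss I) (std_gauss I) T) (PiE I A) = emeasure (std_gauss I) (T -` PiE I A \<inter> space (std_gauss I))"
      using A by (intro emeasure_distr T) (auto simp: std_gauss_def intro!: sets_PiM_I_finite I)
    also have "T -` PiE I A \<inter> space (std_gauss I) = PiE I ?B"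
      using S' by (auto simp: T_def scale_on_def space_std_gauss PiE_iff extensional_def split: if_splits)
    also have "emeasure (std_gauss I) (PiE I ?B) = (\<Prod>x\<in>I. emeasure ?N (?B x))"
      unfolding std_gauss_def using B by (intro std_normal.emeasure_PiM I) auto
    also have "\<dots> = (\<Prod>x\<in>I. emeasure (density ?N (\<rho> x)) (A x))"
      using A unfolding dN by (intro prod.cong refl) (auto simp: emeasure_distr)
    finally show "emeasure (distr (std_gauss I) (std_gauss I) T) (PiE I A) = (\<Prod>x\<in>I. emeasure (density ?N (\<rho> x)) (A x))" .
  qed
  also have "\<dots> = density (std_gauss I) (\<lambda>z. \<Prod>x\<in>I. \<rho> x (z x))"
    unfolding std_gauss_def by (rule PiM_density[OF std_normal.product_sigma_finite_axioms ps I]) simp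
  also have "(\<lambda>z. \<Prod>x\<in>I. \<rho> x (z x)) = (\<lambda>z. \<Prod>x\<in>S. ennreal (scale_density s (z x)))"
    using I S by (intro ext prod.mono_neutral_cong_right) (auto simp: \<rho>_def)
  finally show "distr (std_gauss I) (std_gauss I) T = density (std_gauss I) (\<lambda>z. \<Prod>x\<in>S. ennreal (scale_density s (z x)))" .
qed

text \<open>One coordinate contributes (1 - s) / sqrt (1 - 2 s), whose square is 1 + s^2 / (1 - 2
  s). The first-order terms cancel, so the cost of scaling is quadratic in \<open>s\<close> and
  additive over the coordinates.\<close>

lemma nn_integral_scale_density_square:
  assumes I: "finite I" and S: "S \<subseteq> I" and s: "0 \<le> s" "s \<le> 1 / 4"
  shows "(\<integral>\<^sup>+z. ennreal ((\<Prod>x\<in>S. scale_density s (z x))\<^sup>2) \<partial>std_gauss I) \<le> ennreal (exp (real (card S) * s\<^sup>2))"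
proof -
  let ?N = std_normal_distribution
  define g where "g x t = (if x \<in> S then ennreal ((scale_density s t)\<^sup>2) else 1)" for x :: 'a and t
  have one: "(\<integral>\<^sup>+t. ennreal ((scale_density s t)\<^sup>2) \<partial>?N) \<le> ennreal (exp (s\<^sup>2))"
  proof -
    have "(scale_density s t)\<^sup>2 = (1 - s) * exp (s * t\<^sup>2)" for t
      using s by (simp add: scale_density_def power_mult_distrib exp_double[symmetric])
    then have "(\<integral>\<^sup>+t. ennreal ((scale_density s t)\<^sup>2) \<partial>?N) = (\<integral>\<^sup>+t. ennreal (1 - s) * ennreal (exp (s * t\<^sup>2)) \<partial>?N)"
      using s by (simp add: ennreal_mult'[symmetric])
    also have "\<dots> = ennreal (1 - s) * (\<integral>\<^sup>+t. ennreal (exp (s * t\<^sup>2)) \<partial>?N)"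
      by (rule nn_integral_cmult) simp
    also have "\<dots> = ennreal ((1 - s) / sqrt (1 - 2 * s))"
      using s by (simp add: nn_integral_std_normal_exp_square ennreal_mult'[symmetric])
    also have "(1 - s) / sqrt (1 - 2 * s) \<le> exp (s\<^sup>2)"
    proof (rule power2_le_imp_le)
      have "((1 - s) / sqrt (1 - 2 * s))\<^sup>2 = 1 + s\<^sup>2 / (1 - 2 * s)"
        using s by (simp add: power_divide field_simps power2_eq_square)
      also have "s\<^sup>2 / (1 - 2 * s) \<le> s\<^sup>2 / (1 / 2)"
        using s by (intro divide_left_mono) auto
      also have "1 + s\<^sup>2 / (1 / 2) = 1 + 2 * s\<^sup>2" by simp
      also have "\<dots> \<le> exp (2 * s\<^sup>2)" by (rule exp_ge_add_one_self)
      also have "\<dots> = (exp (s\<^sup>2))\<^sup>2" by (simp add: exp_double)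
      finally show "((1 - s) / sqrt (1 - 2 * s))\<^sup>2 \<le> (exp (s\<^sup>2))\<^sup>2" by simp
    qed simp
    finally show ?thesis by (simp add: ennreal_leI)
  qed
  have "(\<Prod>x\<in>I. g x (z x)) = ennreal ((\<Prod>x\<in>S. scale_density s (z x))\<^sup>2)" for z
  proof -
    have "(\<Prod>x\<in>I. g x (z x)) = (\<Prod>x\<in>S. ennreal ((scale_density s (z x))\<^sup>2))"
      using I S by (intro prod.mono_neutral_cong_right) (auto simp: g_def)
    then show ?thesis by (simp add: prod_ennreal prod_power_distrib)
  qed
  then have "(\<integral>\<^sup>+z. ennreal ((\<Prod>x\<in>S. scale_density s (z x))\<^sup>2) \<partial>std_gauss I) = (\<integral>\<^sup>+z. (\<Prod>x\<in>I. g x (z x)) \<partial>std_gauss I)"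
    by simp
  also have "\<dots> = (\<Prod>x\<in>I. \<integral>\<^sup>+t. g x t \<partial>?N)"
    unfolding std_gauss_def by (rule std_normal.product_nn_integral_prod[OF I]) (auto simp: g_def)
  also have "\<dots> = (\<Prod>x\<in>S. \<integral>\<^sup>+t. g x t \<partial>?N)"
    using I S prob_space.emeasure_space_1[OF prob_space_std_normal]
    by (intro prod.mono_neutral_right) (auto simp: g_def)
  also have "\<dots> \<le> (\<Prod>x\<in>S. ennreal (exp (s\<^sup>2)))"
    using one by (intro prod_mono_ennreal) (simp add: g_def)
  also have "\<dots> = ennreal (exp (real (card S) * s\<^sup>2))"
    by (simp add: prod_ennreal exp_of_nat_mult del: prod_constant flip: prod_constant)
  finally show ?thesis .
qed

text \<open>The chi-square distance between the two laws controls their total variation distance.\<close>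

lemma scale_on_close:
  assumes I: "finite I" and S: "S \<subseteq> I" and s: "0 \<le> s" "s \<le> 1 / 4" "real (card S) * s\<^sup>2 \<le> 1 / 64"
    and A: "A \<in> sets (std_gauss I)"
  shows "measure (std_gauss I) A \<le> measure (std_gauss I) (scale_on S (1 / sqrt (1 - s)) -` A \<inter> space (std_gauss I)) + 3 / 16"
proof -
  interpret prob_space "std_gauss I" by (rule prob_space_std_gauss)
  let ?G = "std_gauss I" and ?T = "scale_on S (1 / sqrt (1 - s))"
  define r where "r z = (\<Prod>x\<in>S. scale_density s (z x))" for z
  have s1: "s < 1" using s by simp
  note T = distr_std_gauss_scale[OF I S s1]
  have fS: "finite S" using S I by (rule finite_subset)
  have r0: "0 \<le> r z" for z unfolding r_def scale_density_def using s by (intro prod_nonneg mult_nonneg_nonneg) auto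
  have rm[measurable]: "r \<in> borel_measurable ?G"
    unfolding r_def scale_density_def
    using S by (intro borel_measurable_prod borel_measurable_times borel_measurable_const
        borel_measurable_exp[THEN measurable_compose[rotated]] borel_measurable_divide borel_measurable_power borel_measurable_coordinate)
      (auto intro!: borel_measurable_coordinate)
  have rd: "(\<Prod>x\<in>S. ennreal (scale_density s (z x))) = ennreal (r z)" for z
    using s by (simp add: r_def prod_ennreal scale_density_def)
  have D: "distr ?G ?G ?T = density ?G (\<lambda>z. ennreal (r z))" using T(2) unfolding rd .
  have "prob_space (density ?G (\<lambda>z. ennreal (r z)))" unfolding D[symmetric] by (rule prob_space_distr[OF T(1)])
  then have r1: "(\<integral>\<^sup>+z. ennreal (r z) \<partial>?G) = 1"
    using prob_space.emeasure_space_1 by (fastforce simp: emeasure_density cong: nn_integral_cong)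
  then have ir: "integrable ?G r" and Er: "expectation r = 1"
    using r0 by (auto intro!: integrableI_nonneg simp: integral_eq_nn_integral)
  have r2: "(\<integral>\<^sup>+z. ennreal ((r z)\<^sup>2) \<partial>?G) \<le> ennreal (exp (1 / 64))"
    unfolding r_def using s(3)
    by (intro order_trans[OF nn_integral_scale_density_square[OF I S s(1,2)]] ennreal_leI) simp
  then have ir2: "integrable ?G (\<lambda>z. (r z)\<^sup>2)"
    by (intro integrableI_nonneg) (auto intro: le_less_trans)
  have Er2: "expectation (\<lambda>z. (r z)\<^sup>2) \<le> exp (1 / 64)"
    using r2 by (subst integral_eq_nn_integral) (auto intro!: enn2real_leI)
  have e64: "exp (1 / 64 :: real) \<le> 1 + 1 / 32"
    using exp_bound[of "1 / 64 :: real"] by (simp add: power2_eq_square)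
  have "measure ?G (?T -` A \<inter> space ?G) = measure (density ?G (\<lambda>z. ennreal (r z))) A"
    unfolding D[symmetric] by (rule measure_distr[OF T(1) A, symmetric])
  also have "\<dots> = enn2real (\<integral>\<^sup>+z. ennreal (r z * indicator A z) \<partial>?G)"
    using A r0 by (simp add: measure_def emeasure_density ennreal_mult' ennreal_indicator)
  also have "\<dots> = expectation (\<lambda>z. r z * indicator A z)"
    using A r0 by (subst integral_eq_nn_integral) auto
  finally have eq: "measure ?G (?T -` A \<inter> space ?G) = expectation (\<lambda>z. r z * indicator A z)" .
  have irA: "integrable ?G (\<lambda>z. r z * indicator A z)" using integrable_mult_indicator[OF A ir] by (simp add: mult.commute)
  have iA: "integrable ?G (\<lambda>z. indicator A z :: real)" using A by (simp add: emeasure_eq_measure)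
  have "measure ?G A - expectation (\<lambda>z. r z * indicator A z) = expectation (\<lambda>z. indicator A z - r z * indicator A z)"
    using A irA iA by simp
  \<comment> \<open>The majorant is 2 (1 - r)^2 + 1/8. It dominates the positive part of 1 - r
    because 2 (1 - r - 1/4)^2 is nonnegative, and its expectation is 2 (E r^2 - 1) + 1/8, at most
    1/16 + 1/8 = 3/16.\<close>
  also have "\<dots> \<le> expectation (\<lambda>z. 2 * (r z)\<^sup>2 - 4 * r z + (2 + 1 / 8))"
  proof (rule integral_mono)
    show "integrable ?G (\<lambda>z. indicator A z - r z * indicator A z)" using irA iA by simp
    show "integrable ?G (\<lambda>z. 2 * (r z)\<^sup>2 - 4 * r z + (2 + 1 / 8))" using ir ir2 by simp
    fix z
    have "0 \<le> 2 * (1 - r z - 1 / 4)\<^sup>2" "0 \<le> 2 * (1 - r z)\<^sup>2" by simp_all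
    then have "1 - r z \<le> 2 * (r z)\<^sup>2 - 4 * r z + (2 + 1 / 8)" "0 \<le> 2 * (r z)\<^sup>2 - 4 * r z + (2 + 1 / 8)"
      by (simp_all add: power2_eq_square algebra_simps)
    then show "indicator A z - r z * indicator A z \<le> 2 * (r z)\<^sup>2 - 4 * r z + (2 + 1 / 8)"
      by (simp add: indicator_def)
  qed
  also have "\<dots> = 2 * expectation (\<lambda>z. (r z)\<^sup>2) - 4 + (2 + 1 / 8)"
    using ir ir2 Er prob_space by simp
  also have "\<dots> \<le> 3 / 16" using Er2 e64 by simp
  finally show ?thesis unfolding eq by simp
qed

section \<open>A lower bound for the standard deviation\<close>

lemma integrable_coordinate_power: "x \<in> I \<Longrightarrow> integrable (std_gauss I) (\<lambda>z. (z x) ^ k)"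
proof -
  assume x: "x \<in> I"
  have "distr (std_gauss I) std_normal_distribution (\<lambda>z. z x) = std_normal_distribution"
    unfolding std_gauss_def by (rule distr_PiM_component) (use x prob_space_std_normal in auto)
  moreover have "(\<lambda>z. z x) \<in> measurable (std_gauss I) std_normal_distribution"
    using borel_measurable_coordinate[OF x] by (simp cong: measurable_cong_sets)
  ultimately show ?thesis
    using integrable_distr[of "\<lambda>z. z x" "std_gauss I" std_normal_distribution "\<lambda>t. t ^ k"]
      integrable_std_normal_distribution_moment[of k] by simp
qed

abbreviation grid :: "nat \<Rightarrow> nat \<Rightarrow> (nat \<times> nat) set" where
  "grid n p \<equiv> {..<n} \<times> {..<p}"

text \<open>The largest sample eigenvalue as a function of one array indexed by pairs, on which
  rotations and scalings act; \<open>lambda1_rows_of\<close> relates it to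
  \<open>lambda1\<close>.\<close>

definition top_eig :: "nat \<Rightarrow> nat \<Rightarrow> (nat \<times> nat \<Rightarrow> real) \<Rightarrow> real" where
  "top_eig n p z = (opn n p (\<lambda>i j. z (i, j)))\<^sup>2 / real n"

definition top_eig_mean :: "nat \<Rightarrow> nat \<Rightarrow> real" where
  "top_eig_mean n p = (\<integral>z. top_eig n p z \<partial>std_gauss (grid n p))"

definition top_eig_sd :: "nat \<Rightarrow> nat \<Rightarrow> real" where
  "top_eig_sd n p = sqrt (\<integral>z. (top_eig n p z - top_eig_mean n p)\<^sup>2 \<partial>std_gauss (grid n p))"

lemma borel_measurable_top_eig:
  assumes "n \<ge> 1" "p \<ge> 1"
  shows "top_eig n p \<in> borel_measurable (std_gauss (grid n p))"
  unfolding top_eig_def[abs_def]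
  by (intro borel_measurable_divide borel_measurable_power borel_measurable_const borel_measurable_opn assms
      borel_measurable_coordinate) auto

text \<open>The Frobenius bound and Cauchy-Schwarz reduce the claim to fourth moments of single
  normals. Without integrability the integral in \<open>top_eig_sd\<close> would be a mere default
  value and Chebyshev's inequality would fail to apply.\<close>

lemma integrable_top_eig_square:
  assumes np: "n \<ge> 1" "p \<ge> 1"
  shows "integrable (std_gauss (grid n p)) (\<lambda>z. (top_eig n p z)\<^sup>2)"
proof (rule Bochner_Integration.integrable_bound)
  let ?I = "grid n p"
  show "integrable (std_gauss ?I) (\<lambda>z. (real (card ?I) * (\<Sum>x\<in>?I. (z x) ^ 4)) / (real n)\<^sup>2)"
  proof -
    have "integrable (std_gauss ?I) (\<lambda>z. \<Sum>x\<in>?I. (z x) ^ 4)"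
      by (rule Bochner_Integration.integrable_sum) (rule integrable_coordinate_power)
    then show ?thesis by (intro integrable_divide integrable_mult_right)
  qed
  show "(\<lambda>z. (top_eig n p z)\<^sup>2) \<in> borel_measurable (std_gauss ?I)"
    using borel_measurable_top_eig[OF np] by measurable
  show "AE z in std_gauss ?I. norm ((top_eig n p z)\<^sup>2) \<le> norm ((real (card ?I) * (\<Sum>x\<in>?I. (z x) ^ 4)) / (real n)\<^sup>2)"
  proof (rule AE_I2)
    fix z :: "nat \<times> nat \<Rightarrow> real"
    have "(opn n p (\<lambda>i j. z (i, j)))\<^sup>2 \<le> (\<Sum>i<n. \<Sum>j<p. (z (i, j))\<^sup>2)"
      by (rule opn_frobenius[OF np])
    also have "\<dots> = (\<Sum>x\<in>?I. (z x)\<^sup>2)" by (simp add: sum.cartesian_product')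
    finally have "((opn n p (\<lambda>i j. z (i, j)))\<^sup>2)\<^sup>2 \<le> (\<Sum>x\<in>?I. (z x)\<^sup>2)\<^sup>2"
      by (intro power_mono) auto
    also have "\<dots> \<le> real (card ?I) * (\<Sum>x\<in>?I. ((z x)\<^sup>2)\<^sup>2)"
      using sum_squared_le_sum_of_squares[of "\<lambda>x. (z x)\<^sup>2" ?I] by (simp add: mult.commute)
    finally show "norm ((top_eig n p z)\<^sup>2) \<le> norm ((real (card ?I) * (\<Sum>x\<in>?I. (z x) ^ 4)) / (real n)\<^sup>2)"
      by (simp add: top_eig_def power_divide divide_right_mono sum_nonneg)
  qed
qed

lemma top_eig_chebyshev:
  assumes np: "n \<ge> 1" "p \<ge> 1" and a: "0 < a"
  shows "measure (std_gauss (grid n p)) {z \<in> space (std_gauss (grid n p)). a \<le> \<bar>top_eig n p z - top_eig_mean n p\<bar>}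
    \<le> (top_eig_sd n p)\<^sup>2 / a\<^sup>2"
proof -
  interpret prob_space "std_gauss (grid n p)" by (rule prob_space_std_gauss)
  have "(top_eig_sd n p)\<^sup>2 = variance (top_eig n p)"
    by (simp add: top_eig_sd_def top_eig_mean_def)
  then show ?thesis
    using Chebyshev_inequality[OF borel_measurable_top_eig[OF np] integrable_top_eig_square[OF np] a]
    by (simp add: top_eig_mean_def)
qed

text \<open>A different random variable on the same space with the same law as
  \<open>top_eig\<close>; statements about its distribution transfer by
  \<open>bidiag_eig_law\<close>, pointwise ones do not.\<close>

definition bidiag_eig :: "nat \<Rightarrow> nat \<Rightarrow> (nat \<times> nat \<Rightarrow> real) \<Rightarrow> real" where
  "bidiag_eig n p z = (opn n n (bidiag (row_norm p z) (col_norm n z)))\<^sup>2 / real n"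

lemma borel_measurable_bidiag_eig:
  assumes "1 \<le> n" "n \<le> p"
  shows "bidiag_eig n p \<in> borel_measurable (std_gauss (grid n p))"
proof -
  have "(\<lambda>z. bidiag (row_norm p z) (col_norm n z) i j) \<in> borel_measurable (std_gauss (grid n p))"
    if "i < n" "j < n" for i j
    unfolding bidiag_def row_norm_def col_norm_def using that assms
    by (cases "i = j"; cases "i = Suc j")
      (auto intro!: borel_measurable_sqrt_comp borel_measurable_sum borel_measurable_power borel_measurable_coordinate)
  then show ?thesis
    unfolding bidiag_eig_def[abs_def] using assms
    by (intro borel_measurable_divide borel_measurable_power borel_measurable_const borel_measurable_opn) auto
qed

lemma bidiag_eig_law:
  assumes n: "1 \<le> n" "n \<le> p" and A: "A \<in> sets borel"
  shows "measure (std_gauss (grid n p)) {z \<in> space (std_gauss (grid n p)). bidiag_eig n p z \<in> A} =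
    measure (std_gauss (grid n p)) {z \<in> space (std_gauss (grid n p)). top_eig n p z \<in> A}"
proof -
  let ?G = "std_gauss (grid n p)"
  define f where "f x = (indicator A (x\<^sup>2 / real n) :: ennreal)" for x :: real
  have f: "f \<in> borel_measurable borel" unfolding f_def using A by measurable
  have p: "p \<ge> 1" using n by simp
  have "{z \<in> space ?G. bidiag_eig n p z \<in> A} \<in> sets ?G" "{z \<in> space ?G. top_eig n p z \<in> A} \<in> sets ?G"
    using measurable_sets[OF borel_measurable_bidiag_eig[OF n] A] measurable_sets[OF borel_measurable_top_eig[OF n(1) p] A]
    by (simp_all add: vimage_def Int_def conj_commute)
  then have "emeasure ?G {z \<in> space ?G. bidiag_eig n p z \<in> A} = (\<integral>\<^sup>+z. f (opn n n (bidiag (row_norm p z) (col_norm n z))) \<partial>?G)"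
    "emeasure ?G {z \<in> space ?G. top_eig n p z \<in> A} = (\<integral>\<^sup>+z. f (opn n p (\<lambda>i j. z (i, j))) \<partial>?G)"
    by (auto simp: f_def bidiag_eig_def top_eig_def simp flip: nn_integral_indicator intro!: nn_integral_cong split: split_indicator)
  then show ?thesis using opn_bidiag_law[OF n f] by (simp add: measure_def)
qed

text \<open>Written as a finite union over starting points and lengths, which gives both
  measurability and a union bound.\<close>

definition bad_windows :: "nat \<Rightarrow> nat \<Rightarrow> nat \<Rightarrow> real \<Rightarrow> (nat \<times> nat \<Rightarrow> real) set" where
  "bad_windows n p l \<tau> = (\<Union>(s, k)\<in>{..n} \<times> {..l}.
     (if s + k \<le> n then {z \<in> space (std_gauss (grid n p)).
        \<not> \<bar>\<Sum>j<k. linearized_dev (real (p - (s + j))) (row_norm p z (s + j))\<bar> \<le> \<tau>} else {}) \<union>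
     (if s + k \<le> n - 1 then {z \<in> space (std_gauss (grid n p)).
        \<not> \<bar>\<Sum>j<k. linearized_dev (real (n - Suc (s + j))) (col_norm n z (s + j))\<bar> \<le> \<tau>} else {}))"

text \<open>Union bound over the pairs of start and length; the factor 4 stands for rows and columns
  with two tails each.\<close>

lemma bad_windows_bound:
  assumes n: "1 \<le> n" "n \<le> p" and l: "4 \<le> l"
  shows "bad_windows n p l \<tau> \<in> sets (std_gauss (grid n p))"
    and "measure (std_gauss (grid n p)) (bad_windows n p l \<tau>) \<le> 4 * (real n + 1) * (real l + 1) * exp (1 - \<tau> / sqrt l)"
proof -
  let ?G = "std_gauss (grid n p)"
  interpret prob_space ?G by (rule prob_space_std_gauss)
  let ?R = "\<lambda>s k. {z \<in> space ?G. \<not> \<bar>\<Sum>j<k. linearized_dev (real (p - (s + j))) (row_norm p z (s + j))\<bar> \<le> \<tau>}"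
  let ?C = "\<lambda>s k. {z \<in> space ?G. \<not> \<bar>\<Sum>j<k. linearized_dev (real (n - Suc (s + j))) (col_norm n z (s + j))\<bar> \<le> \<tau>}"
  have fin: "finite (grid n p)" by simp
  define Hr where "Hr i = Pair i ` {i..<p}" for i :: nat
  define Hc where "Hc j = (\<lambda>i. (i, j)) ` {Suc j..<n}" for j :: nat
  have card: "card (Hr i) = p - i" "card (Hc i) = n - Suc i" for i
    unfolding Hr_def Hc_def by (subst card_image; simp add: inj_on_def)+
  have norms: "sqrt (\<Sum>x\<in>Hr i. (z x)\<^sup>2) = row_norm p z i" "sqrt (\<Sum>x\<in>Hc i. (z x)\<^sup>2) = col_norm n z i" for z i
    unfolding Hr_def Hc_def row_norm_def col_norm_def by (subst sum.reindex; simp add: inj_on_def)+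
  have R: "prob (?R s k) \<le> 2 * exp (1 - \<tau> / sqrt l)" "?R s k \<in> sets ?G" if "k \<le> l" "s + k \<le> n" for s k
  proof -
    have H: "Hr i \<subseteq> grid n p" "Hr i \<noteq> {}" if "i < n" for i using that n by (auto simp: Hr_def)
    have D: "Hr i \<inter> Hr j = {}" if "i < n" "j < n" "i \<noteq> j" for i j using that by (auto simp: Hr_def)
    show "prob (?R s k) \<le> 2 * exp (1 - \<tau> / sqrt l)" "?R s k \<in> sets ?G"
      using window_tail[where H = Hr and N = n and \<tau> = \<tau>, OF fin H D l that] unfolding card norms by auto
  qed
  have C: "prob (?C s k) \<le> 2 * exp (1 - \<tau> / sqrt l)" "?C s k \<in> sets ?G" if "k \<le> l" "s + k \<le> n - 1" for s k
  proof -
    have H: "Hc i \<subseteq> grid n p" "Hc i \<noteq> {}" if "i < n - 1" for i using that n by (auto simp: Hc_def)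
    have D: "Hc i \<inter> Hc j = {}" if "i < n - 1" "j < n - 1" "i \<noteq> j" for i j using that by (auto simp: Hc_def)
    show "prob (?C s k) \<le> 2 * exp (1 - \<tau> / sqrt l)" "?C s k \<in> sets ?G"
      using window_tail[where H = Hc and N = "n - 1" and \<tau> = \<tau>, OF fin H D l that] unfolding card norms by auto
  qed
  let ?B = "\<lambda>(s, k). (if s + k \<le> n then ?R s k else {}) \<union> (if s + k \<le> n - 1 then ?C s k else {})"
  have B: "?B x \<in> sets ?G" "prob (?B x) \<le> 4 * exp (1 - \<tau> / sqrt l)" if "x \<in> {..n} \<times> {..l}" for x
  proof -
    obtain s k where x: "x = (s, k)" by (cases x)
    with that have k: "k \<le> l" by simp
    have 1: "(if s + k \<le> n then ?R s k else {}) \<in> sets ?G" "prob (if s + k \<le> n then ?R s k else {}) \<le> 2 * exp (1 - \<tau> / sqrt l)"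
      using R[OF k, of s] by auto
    have 2: "(if s + k \<le> n - 1 then ?C s k else {}) \<in> sets ?G" "prob (if s + k \<le> n - 1 then ?C s k else {}) \<le> 2 * exp (1 - \<tau> / sqrt l)"
      using C[OF k, of s] by auto
    show "?B x \<in> sets ?G" unfolding x using 1(1) 2(1) by simp
    show "prob (?B x) \<le> 4 * exp (1 - \<tau> / sqrt l)"
      unfolding x using measure_Un_le[OF 1(1) 2(1)] 1(2) 2(2) by simp
  qed
  have eq: "bad_windows n p l \<tau> = (\<Union>x\<in>{..n} \<times> {..l}. ?B x)"
    unfolding bad_windows_def by simp
  show "bad_windows n p l \<tau> \<in> sets ?G" unfolding eq using B(1) by (intro sets.finite_UN) auto
  have "prob (bad_windows n p l \<tau>) \<le> (\<Sum>x\<in>{..n} \<times> {..l}. prob (?B x))"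
    unfolding eq using B(1) by (intro finite_measure_subadditive_finite) auto
  also have "\<dots> \<le> (\<Sum>x\<in>{..n} \<times> {..l}. 4 * exp (1 - \<tau> / sqrt l))"
    using B(2) by (intro sum_mono) auto
  also have "\<dots> = 4 * (real n + 1) * (real l + 1) * exp (1 - \<tau> / sqrt l)" by (simp add: algebra_simps)
  finally show "prob (bad_windows n p l \<tau>) \<le> 4 * (real n + 1) * (real l + 1) * exp (1 - \<tau> / sqrt l)" .
qed

lemma row_col_norm_nonneg: "0 \<le> row_norm p z i" "0 \<le> col_norm n z i"
  by (simp_all add: row_norm_def col_norm_def sum_nonneg)

lemma good_bidiagI:
  assumes n: "1 \<le> n" "n \<le> p" and z: "z \<in> space (std_gauss (grid n p))" "z \<notin> bad_windows n p l \<tau>"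
  shows "good_bidiag n p l \<tau> (row_norm p z) (col_norm n z)"
  unfolding good_bidiag_def windows_bounded_def
proof (intro conjI allI impI row_col_norm_nonneg)
  fix s k assume sk: "k \<le> l" "s + k \<le> n"
  have "\<bar>\<Sum>j<k. linearized_dev (real (p - (s + j))) (row_norm p z (s + j))\<bar> \<le> \<tau>"
  proof (rule ccontr)
    assume "\<not> ?thesis"
    then have "z \<in> bad_windows n p l \<tau>"
      unfolding bad_windows_def using sk z(1) by (intro UN_I[of "(s, k)"]) simp_all
    then show False using z(2) by blast
  qed
  also have "(\<Sum>j<k. linearized_dev (real (p - (s + j))) (row_norm p z (s + j))) =
    (\<Sum>j<k. linearized_dev (real p - real (s + j)) (row_norm p z (s + j)))"
    using sk n by (intro sum.cong) (auto simp: of_nat_diff)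
  finally show "\<bar>\<Sum>j<k. linearized_dev (real p - real (s + j)) (row_norm p z (s + j))\<bar> \<le> \<tau>" .
next
  fix s k assume sk: "k \<le> l" "s + k \<le> n - 1"
  have "\<bar>\<Sum>j<k. linearized_dev (real (n - Suc (s + j))) (col_norm n z (s + j))\<bar> \<le> \<tau>"
  proof (rule ccontr)
    assume "\<not> ?thesis"
    then have "z \<in> bad_windows n p l \<tau>"
      unfolding bad_windows_def using sk z(1) by (intro UN_I[of "(s, k)"]) simp_all
    then show False using z(2) by blast
  qed
  also have "(\<Sum>j<k. linearized_dev (real (n - Suc (s + j))) (col_norm n z (s + j))) =
    (\<Sum>j<k. linearized_dev (real n - 1 - real (s + j)) (col_norm n z (s + j)))"
    using sk n by (intro sum.cong) (auto simp: of_nat_diff diff_diff_eq)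
  finally show "\<bar>\<Sum>j<k. linearized_dev (real n - 1 - real (s + j)) (col_norm n z (s + j))\<bar> \<le> \<tau>" .
qed


lemma unit_vector_iff: "unit_vector n u \<longleftrightarrow> u \<in> sphere_vec n \<and> (\<forall>i. 0 \<le> u i)"
  by (auto simp: unit_vector_def sphere_vec_def)

lemma opn_bidiag_attained:
  assumes "n \<ge> 1" "\<And>i. 0 \<le> a i" "\<And>i. 0 \<le> b i"
  obtains u v where "unit_vector n u" "unit_vector n v" "bidiag_form n a b u v = opn n n (bidiag a b)"
proof -
  obtain u v where uv: "u \<in> sphere_vec n" "v \<in> sphere_vec n" "\<And>i. 0 \<le> u i" "\<And>i. 0 \<le> v i"
    "bil n n (bidiag a b) u v = opn n n (bidiag a b)"
    by (rule opn_attained_nonneg[OF assms(1,1), of "bidiag a b"]) (auto simp: bidiag_def assms)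
  show ?thesis by (rule that[of u v]) (use uv in \<open>simp_all add: unit_vector_iff bil_bidiag\<close>)
qed

lemma bidiag_form_le_opn:
  assumes "n \<ge> 1" "unit_vector n u" "unit_vector n v"
  shows "bidiag_form n a b u v \<le> opn n n (bidiag a b)"
  using bil_le_opn[OF assms(1,1), of u v "bidiag a b"] assms by (simp add: unit_vector_iff bil_bidiag)

text \<open>All numerical requirements for one fixed \<open>n\<close>, so that the probabilistic
  argument is free of limits. \<open>R_lower\<close> is the loss in \<open>bidiag_form_lower\<close>
  for a tent with \<open>K = l\<close>, \<open>R_upper\<close> the noise term of
  \<open>bidiag_form_upper\<close>; \<open>R_small\<close> serves
  \<open>top_vector_localized\<close>, and \<open>bad_small\<close> makes the exceptional event have
  probability at most 1/8.\<close>

locale edge_parameters =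
  fixes n p l m :: nat and \<tau> R :: real
  assumes np: "n \<le> p" "4 * l + 4 \<le> n" and l4: "4 \<le> l" and m: "0 < m" "2 * m \<le> n"
    and R_lower: "4 * real l / sqrt n + 8 * \<tau>\<^sup>2 / sqrt n + 2 * \<tau> / real l + 24 * \<tau> / real l + 3 * sqrt n / (real l)\<^sup>2 \<le> R"
    and R_upper: "2 * \<tau> / real l + 128 * \<tau>\<^sup>2 / sqrt n \<le> R"
    and R_small: "16 * R \<le> sqrt n" "16 * R * sqrt p \<le> real m"
    and \<tau>_small: "8 * \<tau> \<le> sqrt n"
    and bad_small: "4 * (real n + 1) * (real l + 1) * exp (1 - \<tau> / sqrt l) \<le> 1 / 8"
begin

lemma n1: "1 \<le> n" using np by simp

lemma sqrt_np: "0 < sqrt n" "sqrt n \<le> sqrt p" "0 < sqrt p" using np by auto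

text \<open>The tent bound puts the norm within \<open>R\<close> of sqrt p + sqrt n from below, so
  maximising vectors satisfy the assumptions of \<open>top_vector_localized\<close>. For the last
  claim, i < m leaves at least p / 4 degrees of freedom, and deviations of at most sqrt p / 8 cannot
  spoil an entry of order sqrt p.\<close>

lemma good_bidiag_edge:
  assumes good: "good_bidiag n p l \<tau> a b"
  shows "sqrt p \<le> opn n n (bidiag a b)" "opn n n (bidiag a b) \<le> 4 * sqrt p"
    and "\<exists>u v. unit_vector n u \<and> unit_vector n v \<and> bidiag_form n a b u v = opn n n (bidiag a b) \<and>
      1 / 2 \<le> (\<Sum>i | i < n \<and> i < m. u i * v i)"
    and "\<And>i. i < m \<Longrightarrow> sqrt p / 4 \<le> a i"
proof -
  from good have ab: "\<And>i. 0 \<le> a i" "\<And>i. 0 \<le> b i" by (auto simp: good_bidiag_def)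
  obtain u v where u: "unit_vector n u" and v: "unit_vector n v" and uv: "bidiag_form n a b u v = opn n n (bidiag a b)"
    using opn_bidiag_attained[of n a b] ab n1 by blast
  obtain w where w: "unit_vector n w" and "sqrt p + sqrt n - (4 * real l / sqrt n + 8 * \<tau>\<^sup>2 / sqrt n + 2 * \<tau> / real l + 24 * \<tau> / real l + 3 * sqrt n / (real l)\<^sup>2) \<le> bidiag_form n a b w w"
    using bidiag_form_lower[OF good, of l] np l4 by auto
  then have low: "sqrt p + sqrt n - R \<le> opn n n (bidiag a b)"
    using R_lower bidiag_form_le_opn[OF n1 w w, of a b] by linarith
  have R: "16 * R \<le> sqrt p" using R_small sqrt_np by linarith
  have R0: "R \<le> sqrt n" using R_small sqrt_np by linarith
  show "sqrt p \<le> opn n n (bidiag a b)" using low R0 by linarith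
  have "1 / 2 \<le> (\<Sum>i | i < n \<and> i < m. u i * v i)"
    by (rule top_vector_localized[OF good n1 np(1) _ m(1) u v low[folded uv] R_upper R R_small(2)]) (use l4 in simp)
  then show "\<exists>u v. unit_vector n u \<and> unit_vector n v \<and> bidiag_form n a b u v = opn n n (bidiag a b) \<and>
      1 / 2 \<le> (\<Sum>i | i < n \<and> i < m. u i * v i)"
    using u v uv by blast
  have P1: "(\<Sum>i<n. u i * v i) \<le> 1"
    using unit_vector_overlap(1)[of n u v] unit_vectorD[OF u] unit_vectorD[OF v] gap_nonneg(1)[of n u v] by simp
  have M: "0 \<le> (\<Sum>i<n. real i * (u i * v i)) / (2 * sqrt p)"
    using unit_vectorD[OF u] unit_vectorD[OF v] by (intro divide_nonneg_nonneg sum_nonneg) auto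
  have "sqrt p / 2 * (\<Sum>i<n. u i * v i) \<le> sqrt p / 2 * 1"
    using P1 by (intro mult_left_mono) auto
  moreover have "bidiag_form n a b u v \<le> sqrt p / 2 * (\<Sum>i<n. u i * v i) + sqrt p / 2 + sqrt n
     - (\<Sum>i<n. real i * (u i * v i)) / (2 * sqrt p) + (2 * \<tau> / real l + 128 * \<tau>\<^sup>2 / sqrt n)"
    by (rule bidiag_form_upper[OF good n1 np(1) _ u v]) (use l4 in simp)
  ultimately show "opn n n (bidiag a b) \<le> 4 * sqrt p"
    using uv M R_upper R0 sqrt_np by linarith
  show "sqrt p / 4 \<le> a i" if i: "i < m" for i
  proof -
    let ?d = "real p - real i" and ?\<xi> = "linearized_dev (real p - real i) (a i)"
    have w1: "windows_bounded l n \<tau> (\<lambda>i. linearized_dev (real p - real i) (a i))"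
      using good by (simp add: good_bidiag_def)
    have xi: "\<bar>?\<xi>\<bar> \<le> \<tau>" using windows_boundedD(2)[OF w1, of i] i m l4 by auto
    have \<tau>0: "0 \<le> \<tau>" using windows_boundedD(3)[OF w1] .
    have d: "real p / 4 \<le> ?d" "0 < ?d" using i m np by auto
    have "sqrt (real p / 4) \<le> sqrt ?d" using d(1) by (rule real_sqrt_le_mono)
    then have sd: "sqrt p / 2 \<le> sqrt ?d" by (simp add: real_sqrt_divide)
    have t: "8 * \<tau> \<le> sqrt p" using \<tau>_small sqrt_np by linarith
    have "2 * ?\<xi>\<^sup>2 / sqrt ?d \<le> 2 * \<tau>\<^sup>2 / (sqrt p / 2)"
      using xi sd sqrt_np by (intro frac_le) (auto simp: abs_le_square_iff[symmetric])
    also have "\<dots> = 4 * \<tau> * \<tau> / sqrt p" by (simp add: power2_eq_square)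
    also have "\<dots> \<le> 4 * \<tau> * (sqrt p / 8) / sqrt p"
      using t \<tau>0 by (intro divide_right_mono mult_left_mono) auto
    also have "\<dots> = \<tau> / 2" using sqrt_np by simp
    finally show ?thesis
      using linearized_dev_bounds(2)[OF ab(1) d(2), of i] xi sd t by linarith
  qed
qed

lemma prob_bad_windows:
  "bad_windows n p l \<tau> \<in> sets (std_gauss (grid n p))"
  "measure (std_gauss (grid n p)) (bad_windows n p l \<tau>) \<le> 1 / 8"
  using bad_windows_bound[OF n1 np(1) l4, of \<tau>] bad_small by auto

text \<open>Exactly the raw entries that enter the first \<open>m\<close> row norms. Scaling them
  multiplies these norms and leaves all other row norms and all column norms unchanged.\<close>

definition top_block :: "(nat \<times> nat) set" where
  "top_block = {(i, j). i < m \<and> i \<le> j \<and> j < p}"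

lemma top_block: "top_block \<subseteq> grid n p" "real (card top_block) \<le> real m * real p"
proof -
  show "top_block \<subseteq> grid n p" using m by (auto simp: top_block_def)
  have "card top_block \<le> card ({..<m} \<times> {..<p})" by (intro card_mono) (auto simp: top_block_def)
  then show "real (card top_block) \<le> real m * real p"
    by (simp add: of_nat_mult[symmetric] del: of_nat_mult)
qed

lemma norms_scale_on:
  assumes "0 \<le> \<kappa>"
  shows "row_norm p (scale_on top_block \<kappa> z) i = (if i < m then \<kappa> * row_norm p z i else row_norm p z i)"
    and "col_norm n (scale_on top_block \<kappa> z) j = col_norm n z j"
proof -
  show "row_norm p (scale_on top_block \<kappa> z) i = (if i < m then \<kappa> * row_norm p z i else row_norm p z i)"
  proof -
    have "(\<Sum>j\<in>{i..<p}. (scale_on top_block \<kappa> z (i, j))\<^sup>2) = (\<Sum>j\<in>{i..<p}. (if i < m then \<kappa>\<^sup>2 else 1) * (z (i, j))\<^sup>2)"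
      by (intro sum.cong) (auto simp: scale_on_def top_block_def power_mult_distrib)
    then show ?thesis
      unfolding row_norm_def using assms by (simp add: sum_distrib_left[symmetric] real_sqrt_mult)
  qed
  show "col_norm n (scale_on top_block \<kappa> z) j = col_norm n z j"
    unfolding col_norm_def by (intro arg_cong[of _ _ sqrt] sum.cong) (auto simp: scale_on_def top_block_def)
qed

text \<open>Chosen so that the number of scaled entries times its square is at most 1/64, the budget
  of \<open>scale_on_close\<close>.\<close>

definition scale_par :: real where
  "scale_par = 1 / (8 * sqrt (real m * real p))"

lemma scale_par: "0 < scale_par" "scale_par \<le> 1 / 8" "real (card top_block) * scale_par\<^sup>2 \<le> 1 / 64"
proof -
  have mp: "1 \<le> real m * real p"
    using m np mult_mono[of 1 "real m" 1 "real p"] by simp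
  then have "1 \<le> sqrt (real m * real p)" by simp
  then show "0 < scale_par" "scale_par \<le> 1 / 8"
    by (auto simp: scale_par_def field_simps)
  have "real (card top_block) * scale_par\<^sup>2 \<le> real m * real p * scale_par\<^sup>2"
    using top_block(2) by (intro mult_right_mono) auto
  also have "\<dots> = 1 / 64" using m(1) n1 np(1) by (simp add: scale_par_def power_divide power_mult_distrib)
  finally show "real (card top_block) * scale_par\<^sup>2 \<le> 1 / 64" .
qed

text \<open>The maximising vectors of the unscaled matrix serve as test vectors for the scaled one.
  With s = \<open>scale_par\<close>, diagonal entries of size at least sqrt p / 4 grow by a relative
  amount s / 2 on a region carrying overlap 1/2, so the norm gains s sqrt p / 16. As the norm is at
  least sqrt p, its square gains s p / 8, hence at least s / 8 after division by n.\<close>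

lemma scaling_shift:
  assumes z: "z \<in> space (std_gauss (grid n p))" "z \<notin> bad_windows n p l \<tau>"
  shows "bidiag_eig n p z + scale_par / 8 \<le> bidiag_eig n p (scale_on top_block (1 / sqrt (1 - scale_par)) z)"
proof -
  define \<kappa> where "\<kappa> = 1 / sqrt (1 - scale_par)"
  let ?a = "row_norm p z" and ?b = "col_norm n z"
  let ?a' = "row_norm p (scale_on top_block \<kappa> z)"
  have "sqrt (1 - scale_par) \<le> 1 - scale_par / 2"
    by (rule real_le_lsqrt) (use scale_par in \<open>auto simp: power2_eq_square algebra_simps\<close>)
  then have "1 + scale_par / 2 \<le> 1 / (1 - scale_par / 2)" "1 / (1 - scale_par / 2) \<le> \<kappa>"
    using scale_par unfolding \<kappa>_def
    by (auto simp: field_simps intro!: divide_left_mono mult_pos_pos)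
  then have \<kappa>: "1 + scale_par / 2 \<le> \<kappa>" by linarith
  then have \<kappa>0: "0 \<le> \<kappa>" using scale_par by linarith
  note norms = norms_scale_on[OF \<kappa>0]
  have good: "good_bidiag n p l \<tau> ?a ?b" by (rule good_bidiagI[OF n1 np(1) z])
  note edge = good_bidiag_edge[OF good]
  let ?s = "opn n n (bidiag ?a ?b)" and ?s' = "opn n n (bidiag ?a' ?b)"
  from edge(3) obtain u v where u: "unit_vector n u" and v: "unit_vector n v"
    and uv: "bidiag_form n ?a ?b u v = ?s" and loc: "1 / 2 \<le> (\<Sum>i | i < n \<and> i < m. u i * v i)" by blast
  have w: "0 \<le> u i * v i" for i using unit_vectorD[OF u] unit_vectorD[OF v] by simp
  have "(\<Sum>i<n. ?a i * (u i * v i)) + (\<Sum>i | i < n \<and> i < m. (\<kappa> - 1) * ?a i * (u i * v i)) = (\<Sum>i<n. ?a' i * (u i * v i))"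
  proof -
    have "(\<Sum>i | i < n \<and> i < m. (\<kappa> - 1) * ?a i * (u i * v i)) = (\<Sum>i<n. if i < m then (\<kappa> - 1) * ?a i * (u i * v i) else 0)"
      by (intro sum.mono_neutral_cong_left) auto
    then have "(\<Sum>i<n. ?a i * (u i * v i)) + (\<Sum>i | i < n \<and> i < m. (\<kappa> - 1) * ?a i * (u i * v i)) =
      (\<Sum>i<n. ?a i * (u i * v i) + (if i < m then (\<kappa> - 1) * ?a i * (u i * v i) else 0))"
      by (simp only: sum.distrib)
    also have "\<dots> = (\<Sum>i<n. ?a' i * (u i * v i))"
      by (intro sum.cong refl) (simp add: norms(1) left_diff_distrib)
    finally show ?thesis .
  qed
  then have "bidiag_form n ?a' ?b u v = ?s + (\<Sum>i | i < n \<and> i < m. (\<kappa> - 1) * ?a i * (u i * v i))"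
    unfolding uv[symmetric] bidiag_form_def by simp
  moreover have "(\<Sum>i | i < n \<and> i < m. scale_par / 2 * (sqrt p / 4) * (u i * v i)) \<le> (\<Sum>i | i < n \<and> i < m. (\<kappa> - 1) * ?a i * (u i * v i))"
    using \<kappa> edge(4) scale_par by (intro sum_mono mult_right_mono w mult_mono) auto
  moreover have "scale_par / 2 * (sqrt p / 4) * (1 / 2) \<le> (\<Sum>i | i < n \<and> i < m. scale_par / 2 * (sqrt p / 4) * (u i * v i))"
    unfolding sum_distrib_left[symmetric] using loc scale_par by (intro mult_left_mono) auto
  ultimately have shift: "?s + scale_par * sqrt p / 16 \<le> ?s'"
    using bidiag_form_le_opn[OF n1 u v, of ?a' ?b] by simp
  have s0: "0 \<le> ?s" using edge(1) sqrt_np by linarith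
  have "?s\<^sup>2 + scale_par * real n / 8 \<le> ?s\<^sup>2 + scale_par * real p / 8"
    using np scale_par by (simp add: mult_left_mono)
  also have "scale_par * real p / 8 = 2 * sqrt p * (scale_par * sqrt p / 16)" by simp
  also have "?s\<^sup>2 + 2 * sqrt p * (scale_par * sqrt p / 16) \<le> ?s\<^sup>2 + 2 * ?s * (scale_par * sqrt p / 16) + (scale_par * sqrt p / 16)\<^sup>2"
  proof -
    have "2 * sqrt p * (scale_par * sqrt p / 16) \<le> 2 * ?s * (scale_par * sqrt p / 16)"
      using edge(1) scale_par by (intro mult_right_mono) auto
    then show ?thesis using zero_le_power2[of "scale_par * sqrt p / 16"] by linarith
  qed
  also have "\<dots> = (?s + scale_par * sqrt p / 16)\<^sup>2" by (simp only: power2_sum)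
  also have "\<dots> \<le> ?s'\<^sup>2" using shift s0 scale_par by (intro power_mono) auto
  finally have "(?s\<^sup>2 + scale_par * real n / 8) / real n \<le> ?s'\<^sup>2 / real n" by (rule divide_right_mono) simp
  moreover have "col_norm n (scale_on top_block \<kappa> z) = ?b" using norms(2) by (rule ext)
  ultimately show ?thesis
    unfolding bidiag_eig_def \<kappa>_def[symmetric] using n1 by (simp add: add_divide_distrib)
qed

text \<open>If the deviation were smaller than s / 40, with s = \<open>scale_par\<close>, Chebyshev
  at x = s / 20 would leave mass at most 1/4 on either side of \<mu> \<plusminus> x. The event of
  lying below \<mu> + x has probability at least 3/4, and at least 3/4 - 3/16 = 9/16 after scaling.
  But the scaled value exceeds the unscaled one by s / 8, more than 2 x, off the bad windows, so
  that event forces the unscaled value below \<mu> - x or a bad window, which has probability at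
  most 1/4 + 1/8.\<close>

lemma sd_lower_bound: "scale_par / 40 \<le> top_eig_sd n p"
proof (rule ccontr)
  assume "\<not> scale_par / 40 \<le> top_eig_sd n p"
  then have sd: "top_eig_sd n p < scale_par / 40" by simp
  let ?G = "std_gauss (grid n p)" and ?T = "scale_on top_block (1 / sqrt (1 - scale_par))"
  interpret prob_space ?G by (rule prob_space_std_gauss)
  define \<mu> where "\<mu> = top_eig_mean n p"
  define x where "x = scale_par / 20"
  have x: "0 < x" using scale_par by (simp add: x_def)
  have p1: "p \<ge> 1" using n1 np by simp
  have sd0: "0 \<le> top_eig_sd n p" by (simp add: top_eig_sd_def)
  have "top_eig_sd n p / x \<le> 1 / 2" using sd x by (simp add: x_def field_simps)
  then have "(top_eig_sd n p / x)\<^sup>2 \<le> (1 / 2)\<^sup>2" using sd0 x by (intro power_mono) auto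
  then have "(top_eig_sd n p)\<^sup>2 / x\<^sup>2 \<le> 1 / 4" by (simp add: power_divide)
  then have cheb: "prob {z \<in> space ?G. x \<le> \<bar>top_eig n p z - \<mu>\<bar>} \<le> 1 / 4"
    unfolding \<mu>_def by (rule order_trans[OF top_eig_chebyshev[OF n1 p1 x]])
  have tm[measurable]: "top_eig n p \<in> borel_measurable ?G" "bidiag_eig n p \<in> borel_measurable ?G"
    using borel_measurable_top_eig[OF n1 p1] borel_measurable_bidiag_eig[OF n1 np(1)] by auto
  have up: "prob {z \<in> space ?G. bidiag_eig n p z \<in> {\<mu> + x..}} \<le> 1 / 4"
    unfolding bidiag_eig_law[OF n1 np(1) borel_closed[OF closed_atLeast]]
    by (rule order_trans[OF finite_measure_mono cheb]) auto
  have lo: "prob {z \<in> space ?G. bidiag_eig n p z \<in> {..\<mu> - x}} \<le> 1 / 4"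
    unfolding bidiag_eig_law[OF n1 np(1) borel_closed[OF closed_atMost]]
    by (rule order_trans[OF finite_measure_mono cheb]) auto
  define A where "A = {z \<in> space ?G. bidiag_eig n p z < \<mu> + x}"
  have A: "A \<in> sets ?G" unfolding A_def by measurable
  have "A = space ?G - {z \<in> space ?G. bidiag_eig n p z \<in> {\<mu> + x..}}" by (auto simp: A_def)
  moreover have "{z \<in> space ?G. bidiag_eig n p z \<in> {\<mu> + x..}} \<in> sets ?G" by measurable
  ultimately have "3 / 4 \<le> prob A" using up prob_compl by simp
  also have "\<dots> \<le> prob (?T -` A \<inter> space ?G) + 3 / 16"
    by (rule scale_on_close[OF _ top_block(1) _ _ scale_par(3) A]) (use scale_par in auto)
  also have "prob (?T -` A \<inter> space ?G) \<le> prob ({z \<in> space ?G. bidiag_eig n p z \<in> {..\<mu> - x}} \<union> bad_windows n p l \<tau>)"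
  proof (rule finite_measure_mono)
    show "{z \<in> space ?G. bidiag_eig n p z \<in> {..\<mu> - x}} \<union> bad_windows n p l \<tau> \<in> sets ?G"
      using prob_bad_windows(1) by measurable
    show "?T -` A \<inter> space ?G \<subseteq> {z \<in> space ?G. bidiag_eig n p z \<in> {..\<mu> - x}} \<union> bad_windows n p l \<tau>"
    proof
      fix z assume z: "z \<in> ?T -` A \<inter> space ?G"
      show "z \<in> {z \<in> space ?G. bidiag_eig n p z \<in> {..\<mu> - x}} \<union> bad_windows n p l \<tau>"
      proof (cases "z \<in> bad_windows n p l \<tau>")
        case False
        have "bidiag_eig n p z + scale_par / 8 \<le> bidiag_eig n p (?T z)"
          by (rule scaling_shift[OF _ False]) (use z in simp)
        moreover have "bidiag_eig n p (?T z) < \<mu> + x" using z by (simp add: A_def)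
        ultimately have "bidiag_eig n p z \<le> \<mu> - x" using scale_par by (simp add: x_def)
        then show ?thesis using z by simp
      qed simp
    qed
  qed
  also have "\<dots> \<le> prob {z \<in> space ?G. bidiag_eig n p z \<in> {..\<mu> - x}} + prob (bad_windows n p l \<tau>)"
    by (rule measure_Un_le) (use prob_bad_windows(1) in measurable)
  finally show False using lo prob_bad_windows(2) by simp
qed

text \<open>Replaces a tail estimate for the expectation. Off the bad windows the eigenvalue is at
  most (4 sqrt p)^2 / n, so a mean larger by more than two deviations would make a Chebyshev event
  of probability at most 1/4 contain the complement of an event of probability at most 1/8.\<close>

lemma mean_upper_bound: "top_eig_mean n p \<le> 16 * real p / real n + 2 * top_eig_sd n p"
proof (rule ccontr)
  assume "\<not> ?thesis"
  then have c: "16 * real p / real n + 2 * top_eig_sd n p < top_eig_mean n p" by simp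
  let ?G = "std_gauss (grid n p)"
  interpret prob_space ?G by (rule prob_space_std_gauss)
  define \<mu> where "\<mu> = top_eig_mean n p"
  have p1: "p \<ge> 1" using n1 np by simp
  have x: "0 < 2 * top_eig_sd n p" using sd_lower_bound scale_par by linarith
  have cheb: "prob {z \<in> space ?G. 2 * top_eig_sd n p \<le> \<bar>top_eig n p z - \<mu>\<bar>} \<le> 1 / 4"
    using top_eig_chebyshev[OF n1 p1 x] x by (simp add: \<mu>_def power_mult_distrib)
  have tm[measurable]: "top_eig n p \<in> borel_measurable ?G" "bidiag_eig n p \<in> borel_measurable ?G"
    using borel_measurable_top_eig[OF n1 p1] borel_measurable_bidiag_eig[OF n1 np(1)] by auto
  have lo: "prob {z \<in> space ?G. bidiag_eig n p z \<in> {..\<mu> - 2 * top_eig_sd n p}} \<le> 1 / 4"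
    unfolding bidiag_eig_law[OF n1 np(1) borel_closed[OF closed_atMost]]
    by (rule order_trans[OF finite_measure_mono cheb]) auto
  have "space ?G \<subseteq> {z \<in> space ?G. bidiag_eig n p z \<in> {..\<mu> - 2 * top_eig_sd n p}} \<union> bad_windows n p l \<tau>"
  proof
    fix z assume z: "z \<in> space ?G"
    show "z \<in> {z \<in> space ?G. bidiag_eig n p z \<in> {..\<mu> - 2 * top_eig_sd n p}} \<union> bad_windows n p l \<tau>"
    proof (cases "z \<in> bad_windows n p l \<tau>")
      case False
      have "opn n n (bidiag (row_norm p z) (col_norm n z)) \<le> 4 * sqrt p"
        "0 \<le> opn n n (bidiag (row_norm p z) (col_norm n z))"
        using good_bidiag_edge(1,2)[OF good_bidiagI[OF n1 np(1) z False]] sqrt_np by linarith+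
      then have "(opn n n (bidiag (row_norm p z) (col_norm n z)))\<^sup>2 \<le> (4 * sqrt p)\<^sup>2" by (intro power_mono)
      then have "bidiag_eig n p z \<le> 16 * real p / real n"
        unfolding bidiag_eig_def by (simp add: power_mult_distrib divide_right_mono)
      then show ?thesis using c z by (simp add: \<mu>_def)
    qed simp
  qed
  then have "1 \<le> prob ({z \<in> space ?G. bidiag_eig n p z \<in> {..\<mu> - 2 * top_eig_sd n p}} \<union> bad_windows n p l \<tau>)"
    using prob_bad_windows(1) prob_space finite_measure_mono[of "space ?G" "{z \<in> space ?G. bidiag_eig n p z \<in> {..\<mu> - 2 * top_eig_sd n p}} \<union> bad_windows n p l \<tau>"]
    by simp
  also have "\<dots> \<le> prob {z \<in> space ?G. bidiag_eig n p z \<in> {..\<mu> - 2 * top_eig_sd n p}} + prob (bad_windows n p l \<tau>)"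
    by (rule measure_Un_le) (use prob_bad_windows(1) in measurable)
  finally show False using lo prob_bad_windows(2) by simp
qed

end

section \<open>The laws of the data\<close>

text \<open>Identifies the outcome of Gauss-Jordan elimination by uniqueness of inverses, so that
  the Gaussian density can be handled with an explicitly guessed inverse.\<close>

lemma the_mat_inverse:
  fixes A B :: "real mat"
  assumes A: "A \<in> carrier_mat n n" and B: "B \<in> carrier_mat n n" and AB: "A * B = 1\<^sub>m n" "B * A = 1\<^sub>m n"
  shows "the (mat_inverse A) = B"
proof -
  have "A \<in> Units (ring_mat TYPE(real) n ())"
    using A B AB by (auto simp: Units_def ring_mat_def)
  then obtain C where C: "mat_inverse A = Some C"
    using mat_inverse(1)[OF A, of "()"] by (cases "mat_inverse A") auto
  then have "C * A = 1\<^sub>m n" "C \<in> carrier_mat n n" using mat_inverse(2)[OF A] by auto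
  then have "C = B" using assoc_mult_mat[of C n n A n B n] A B AB by simp
  then show ?thesis using C by simp
qed

lemma gaussian_density:
  assumes S: "S \<in> carrier_mat p p" and P: "P \<in> carrier_mat p p" and inv: "S * P = 1\<^sub>m p" "P * S = 1\<^sub>m p"
  shows "gaussian p S = density (lborel_fun {..<p})
    (\<lambda>x. ennreal (exp (- (\<Sum>j<p. x j * (\<Sum>k<p. P $$ (j, k) * x k)) / 2) / sqrt ((2 * pi) ^ p * Determinant.det S)))"
proof -
  have "scalar_prod (Matrix.vec p x) (P *\<^sub>v Matrix.vec p x) = (\<Sum>j<p. x j * (\<Sum>k<p. P $$ (j, k) * x k))" for x
    using P by (simp add: scalar_prod_def atLeast0LessThan row_def)
  then show ?thesis
    unfolding gaussian_def the_mat_inverse[OF S P inv] by simp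
qed

lemma gaussian_identity: "gaussian p (1\<^sub>m p) = std_gauss {..<p}"
proof -
  have "(\<Sum>j<p. x j * (\<Sum>k<p. 1\<^sub>m p $$ (j, k) * x k)) = (\<Sum>j<p. (x j)\<^sup>2)" for x :: "nat \<Rightarrow> real"
  proof (intro sum.cong refl)
    fix j assume j: "j \<in> {..<p}"
    have "(\<Sum>k<p. 1\<^sub>m p $$ (j, k) * x k) = (\<Sum>k<p. if k = j then x k else 0)"
      using j by (intro sum.cong) auto
    then show "x j * (\<Sum>k<p. 1\<^sub>m p $$ (j, k) * x k) = (x j)\<^sup>2" using j by (simp add: power2_eq_square)
  qed
  then have "gaussian p (1\<^sub>m p) = density (lborel_fun {..<p}) (\<lambda>x. ennreal (exp (- (\<Sum>j<p. (x j)\<^sup>2) / 2) / sqrt ((2 * pi) ^ p)))"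
    using gaussian_density[of "1\<^sub>m p" p "1\<^sub>m p"] by simp
  also have "(\<lambda>x. ennreal (exp (- (\<Sum>j<p. (x j)\<^sup>2) / 2) / sqrt ((2 * pi) ^ p))) =
    (\<lambda>x. ennreal ((1 / sqrt (2 * pi)) ^ card {..<p} * exp (- (\<Sum>j<p. (x j)\<^sup>2) / 2)))"
    by (simp only: real_sqrt_power power_divide power_one card_lessThan) simp
  finally show ?thesis by (simp only: std_gauss_density[OF finite_lessThan])
qed

lemma indep_std_gauss_coordinates:
  assumes "I \<noteq> {}"
  shows "prob_space.indep_vars (std_gauss I) (\<lambda>_. std_normal_distribution) (\<lambda>x z. z x) I"
proof -
  interpret prob_space "std_gauss I" by (rule prob_space_std_gauss)
  have rv: "random_variable std_normal_distribution (\<lambda>z. z x)" if "x \<in> I" for x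
    using that unfolding std_gauss_def by (rule measurable_component_singleton)
  have "distr (std_gauss I) (PiM I (\<lambda>_. std_normal_distribution)) (\<lambda>z. \<lambda>x\<in>I. z x) = distr (std_gauss I) (std_gauss I) (\<lambda>z. z)"
    unfolding std_gauss_def
    by (intro distr_cong refl) (auto simp: space_PiM PiE_def extensional_restrict)
  also have "\<dots> = PiM I (\<lambda>_. std_normal_distribution)" by (simp add: distr_id std_gauss_def)
  also have "\<dots> = PiM I (\<lambda>x. distr (std_gauss I) std_normal_distribution (\<lambda>z. z x))"
  proof (intro PiM_cong refl)
    fix x assume "x \<in> I"
    then show "std_normal_distribution = distr (std_gauss I) std_normal_distribution (\<lambda>z. z x)"
      unfolding std_gauss_def by (rule distr_PiM_component[OF prob_space_std_normal, symmetric])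
  qed
  finally show ?thesis using indep_vars_iff_distr_eq_PiM'[OF assms rv] by simp
qed

definition rows_of :: "nat \<Rightarrow> nat \<Rightarrow> (nat \<times> nat \<Rightarrow> real) \<Rightarrow> nat \<Rightarrow> nat \<Rightarrow> real" where
  "rows_of n p z = (\<lambda>i\<in>{..<n}. \<lambda>j\<in>{..<p}. z (i, j))"

text \<open>Passes from data sets, which are products of products, to one product over pairs:
  disjoint groups of independent coordinates are independent, and each row is a reindexed standard
  Gaussian vector.\<close>

lemma law_H0_rows:
  assumes "n \<ge> 1" "p \<ge> 1"
  shows "rows_of n p \<in> measurable (std_gauss (grid n p)) (law_H0 n p)"
    "law_H0 n p = distr (std_gauss (grid n p)) (law_H0 n p) (rows_of n p)"
proof -
  let ?G = "std_gauss (grid n p)" and ?N = std_normal_distribution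
  interpret prob_space ?G by (rule prob_space_std_gauss)
  define X where "X i z = (\<lambda>j\<in>{..<p}. z (i, j))" for i :: nat and z :: "nat \<times> nat \<Rightarrow> real"
  have ne: "grid n p \<noteq> {}" using assms by (auto simp: lessThan_empty_iff)
  have law: "law_H0 n p = PiM {..<n} (\<lambda>_. std_gauss {..<p})" by (simp add: law_H0_def gaussian_identity)
  have iv: "indep_vars (\<lambda>i. PiM ({i} \<times> {..<p}) (\<lambda>_. ?N)) (\<lambda>i z. restrict z ({i} \<times> {..<p})) {..<n}"
    using indep_vars_restrict[OF indep_std_gauss_coordinates[OF ne], of "{..<n}" "\<lambda>i. {i} \<times> {..<p}"]
    by (auto simp: disjoint_family_on_def)
  have "indep_vars (\<lambda>i. std_gauss {..<p}) (\<lambda>i. X i \<circ> (\<lambda>z. restrict z ({i} \<times> {..<p}))) {..<n}"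
  proof (rule indep_vars_compose[OF iv])
    fix i assume "i \<in> {..<n}"
    show "X i \<in> measurable (PiM ({i} \<times> {..<p}) (\<lambda>_. ?N)) (std_gauss {..<p})"
      unfolding X_def std_gauss_def by (intro measurable_restrict measurable_component_singleton) auto
  qed
  moreover have "X i \<circ> (\<lambda>z. restrict z ({i} \<times> {..<p})) = X i" for i
    by (auto simp: X_def fun_eq_iff)
  ultimately have iX: "indep_vars (\<lambda>i. std_gauss {..<p}) X {..<n}" by simp
  have rv: "random_variable (std_gauss {..<p}) (X i)" if "i \<in> {..<n}" for i
    using iX that by (auto simp: indep_vars_def)
  have dX: "distr ?G (std_gauss {..<p}) (X i) = std_gauss {..<p}" if "i \<in> {..<n}" for i
    unfolding std_gauss_def X_def
    using distr_PiM_reindex[of "grid n p" "\<lambda>_. ?N" "Pair i" "{..<p}"] that prob_space_std_normal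
    by (auto simp: inj_on_def)
  have R: "rows_of n p = (\<lambda>z. \<lambda>i\<in>{..<n}. X i z)" by (simp add: rows_of_def X_def fun_eq_iff)
  show "rows_of n p \<in> measurable ?G (law_H0 n p)"
    unfolding R law by (intro measurable_restrict rv)
  have "{..<n} \<noteq> {}" using assms by (auto simp: lessThan_empty_iff)
  then have "distr ?G (PiM {..<n} (\<lambda>_. std_gauss {..<p})) (\<lambda>z. \<lambda>i\<in>{..<n}. X i z) = PiM {..<n} (\<lambda>i. distr ?G (std_gauss {..<p}) (X i))"
    using indep_vars_iff_distr_eq_PiM'[where I = "{..<n}" and M' = "\<lambda>_. std_gauss {..<p}" and X = X] rv iX by blast
  also have "\<dots> = PiM {..<n} (\<lambda>_. std_gauss {..<p})" using dX by (intro PiM_cong) auto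
  finally show "law_H0 n p = distr ?G (law_H0 n p) (rows_of n p)" unfolding R law by simp
qed

lemma lambda1_rows_of: "n \<ge> 1 \<Longrightarrow> p \<ge> 1 \<Longrightarrow> lambda1 n p (rows_of n p z) = top_eig n p z"
  unfolding top_eig_def lambda1_eq_opn
  by (intro arg_cong[of _ _ "\<lambda>x. x\<^sup>2 / real n"] opn_cong) (simp add: rows_of_def)

lemma borel_measurable_lambda1:
  assumes "n \<ge> 1" "p \<ge> 1"
  shows "lambda1 n p \<in> borel_measurable (law_H0 n p)"
proof -
  have "(\<lambda>X. X i j) \<in> borel_measurable (law_H0 n p)" if "i < n" "j < p" for i j
  proof -
    have "(\<lambda>X. X i) \<in> measurable (law_H0 n p) (std_gauss {..<p})"
      unfolding law_H0_def gaussian_identity using that by (intro measurable_component_singleton) auto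
    from measurable_compose[OF this borel_measurable_coordinate[of j "{..<p}"]] show ?thesis using that by simp
  qed
  then have "(\<lambda>X. (opn n p X)\<^sup>2 / real n) \<in> borel_measurable (law_H0 n p)"
    by (intro borel_measurable_divide borel_measurable_power borel_measurable_const borel_measurable_opn assms)
  then show ?thesis using lambda1_eq_opn[OF assms] by (simp cong: measurable_cong)
qed

lemma E0_lambda1:
  assumes "n \<ge> 1" "p \<ge> 1"
  shows "E0 n p (lambda1 n p) = top_eig_mean n p" "SD0 n p (lambda1 n p) = top_eig_sd n p"
proof -
  note m = borel_measurable_lambda1[OF assms]
  note rows = law_H0_rows[OF assms]
  have E: "(\<integral>X. f (lambda1 n p X) \<partial>law_H0 n p) = (\<integral>z. f (top_eig n p z) \<partial>std_gauss (grid n p))"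
    if "f \<in> borel_measurable borel" for f :: "real \<Rightarrow> real"
  proof -
    have "(\<integral>X. f (lambda1 n p X) \<partial>law_H0 n p) = (\<integral>X. f (lambda1 n p X) \<partial>distr (std_gauss (grid n p)) (law_H0 n p) (rows_of n p))"
      using rows(2) by simp
    also have "\<dots> = (\<integral>z. f (lambda1 n p (rows_of n p z)) \<partial>std_gauss (grid n p))"
      by (rule integral_distr[OF rows(1) measurable_compose[OF m that]])
    finally show ?thesis by (simp only: lambda1_rows_of[OF assms])
  qed
  show mean: "E0 n p (lambda1 n p) = top_eig_mean n p"
    unfolding E0_def top_eig_mean_def using E[of "\<lambda>x. x"] by simp
  show "SD0 n p (lambda1 n p) = top_eig_sd n p"
    unfolding SD0_def mean top_eig_sd_def unfolding E0_def using E[of "\<lambda>x. (x - top_eig_mean n p)\<^sup>2"] by simp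
qed

lemma measure_law_H0:
  assumes "n \<ge> 1" "p \<ge> 1" "A \<in> sets borel"
  shows "measure (law_H0 n p) {X \<in> space (law_H0 n p). lambda1 n p X \<in> A} =
    measure (std_gauss (grid n p)) {z \<in> space (std_gauss (grid n p)). top_eig n p z \<in> A}"
proof -
  note rows = law_H0_rows[OF assms(1,2)]
  have S: "{X \<in> space (law_H0 n p). lambda1 n p X \<in> A} \<in> sets (law_H0 n p)"
    using measurable_sets[OF borel_measurable_lambda1[OF assms(1,2)] assms(3)] by (simp add: vimage_def Int_def conj_commute)
  have "measure (law_H0 n p) {X \<in> space (law_H0 n p). lambda1 n p X \<in> A} =
    measure (distr (std_gauss (grid n p)) (law_H0 n p) (rows_of n p)) {X \<in> space (law_H0 n p). lambda1 n p X \<in> A}"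
    using rows(2) by simp
  also have "\<dots> = measure (std_gauss (grid n p)) (rows_of n p -` {X \<in> space (law_H0 n p). lambda1 n p X \<in> A} \<inter> space (std_gauss (grid n p)))"
    by (rule measure_distr[OF rows(1) S])
  also have "rows_of n p -` {X \<in> space (law_H0 n p). lambda1 n p X \<in> A} \<inter> space (std_gauss (grid n p)) =
    {z \<in> space (std_gauss (grid n p)). top_eig n p z \<in> A}"
    using measurable_space[OF rows(1)] by (auto simp: lambda1_rows_of[OF assms(1,2)])
  finally show ?thesis .
qed

lemma lambda1_deviation:
  assumes np: "n \<ge> 1" "p \<ge> 1" and t: "0 < t" and sd: "0 < top_eig_sd n p"
  shows "measure (law_H0 n p) {X \<in> space (law_H0 n p). top_eig_mean n p + t * top_eig_sd n p \<le> lambda1 n p X} \<le> 1 / t\<^sup>2"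
proof -
  let ?G = "std_gauss (grid n p)"
  interpret prob_space ?G by (rule prob_space_std_gauss)
  have a: "0 < t * top_eig_sd n p" using t sd by simp
  have [measurable]: "top_eig n p \<in> borel_measurable ?G" by (rule borel_measurable_top_eig[OF np])
  have "measure (law_H0 n p) {X \<in> space (law_H0 n p). top_eig_mean n p + t * top_eig_sd n p \<le> lambda1 n p X} =
    prob {z \<in> space ?G. top_eig n p z \<in> {top_eig_mean n p + t * top_eig_sd n p..}}"
    using measure_law_H0[OF np borel_closed[OF closed_atLeast], of "top_eig_mean n p + t * top_eig_sd n p"] by simp
  also have "\<dots> \<le> prob {z \<in> space ?G. t * top_eig_sd n p \<le> \<bar>top_eig n p z - top_eig_mean n p\<bar>}"
    by (intro finite_measure_mono) auto
  also have "\<dots> \<le> (top_eig_sd n p)\<^sup>2 / (t * top_eig_sd n p)\<^sup>2" by (rule top_eig_chebyshev[OF np a])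
  also have "\<dots> = 1 / t\<^sup>2" using sd by (simp add: power_mult_distrib)
  finally show ?thesis .
qed

lemma TW_level_bound:
  assumes np: "n \<ge> 1" "p \<ge> 1" and t: "0 < (3 * ln (real n)) powr (2/3)"
  shows "TW_level n p \<le> 1 / ((3 * ln (real n)) powr (2/3))\<^sup>2"
\<comment> \<open>If the standard deviation is zero, division by zero makes the statistic 0, and the
  positive threshold is never reached.\<close>
proof (cases "top_eig_sd n p = 0")
  case True
  then show ?thesis
    using t by (simp add: TW_level_def TW_rejection_prob_def TW_def E0_lambda1[OF np])
next
  case False
  then have sd: "0 < top_eig_sd n p" by (simp add: top_eig_sd_def less_le)
  have "{X \<in> space (law_H0 n p). (3 * ln (real n)) powr (2/3) \<le> TW n p X} =
    {X \<in> space (law_H0 n p). top_eig_mean n p + (3 * ln (real n)) powr (2/3) * top_eig_sd n p \<le> lambda1 n p X}"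
    using sd by (auto simp: TW_def E0_lambda1[OF np] pos_le_divide_eq)
  then show ?thesis
    using lambda1_deviation[OF np t sd] by (simp add: TW_level_def TW_rejection_prob_def)
qed

text \<open>Along a non-measurable map the distribution is a null measure unless the usual formula happens to
  define a measure.\<close>

lemma emeasure_distr_le:
  "emeasure (distr M N f) A \<le> emeasure M (f -` A \<inter> space M)"
proof (cases "A \<in> sets (distr M N f)")
  case True
  then show ?thesis unfolding distr_def by (subst emeasure_measure_of_conv) auto
next
  case False
  then show ?thesis by (simp add: emeasure_notin_sets)
qed

text \<open>The mixture averages over the image of \<open>U\<close> in the space of measures. By
  \<open>emeasure_distr_le\<close> this image has mass at most one and gives no mass to measures
  that violate the bound. The argument thus needs only pointwise bounds on \<open>K\<close>.\<close>

lemma emeasure_bind_le: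
  assumes U: "prob_space U" and N: "\<And>x. x \<in> space U \<Longrightarrow> sets (K x) = sets N" and B: "B \<in> sets N"
    and c: "\<And>x. x \<in> space U \<Longrightarrow> emeasure (K x) B \<le> c"
  shows "emeasure (U \<bind> K) B \<le> c"
proof -
  interpret prob_space U by fact
  \<comment> \<open>\<open>bind\<close> takes its target space from the kernel at an arbitrarily
    chosen point.\<close>
  define K0 where "K0 = K (SOME x. x \<in> space U)"
  have "(SOME x. x \<in> space U) \<in> space U" using not_empty by (simp add: some_in_eq)
  then have K0: "sets K0 = sets N" unfolding K0_def by (rule N)
  define D where "D = distr U (subprob_algebra K0) K"
  have D: "sets D = sets (subprob_algebra K0)" by (simp add: D_def)
  have m[measurable]: "(\<lambda>M'. emeasure M' B) \<in> borel_measurable D"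
    using measurable_emeasure_subprob_algebra[of B K0] B K0 by (simp cong: measurable_cong_sets add: D)
  let ?S = "{M' \<in> space D. \<not> emeasure M' B \<le> c}"
  have "emeasure D ?S \<le> emeasure U (K -` ?S \<inter> space U)" unfolding D_def by (rule emeasure_distr_le)
  also have "K -` ?S \<inter> space U = {}" using c by auto
  finally have "emeasure D ?S = 0" by simp
  moreover have "?S \<in> sets D" by measurable
  ultimately have ae: "AE M' in D. emeasure M' B \<le> c" by (subst AE_iff_null) (auto simp: null_sets_def)
  have "emeasure (U \<bind> K) B = (\<integral>\<^sup>+M'. emeasure M' B \<partial>D)"
    unfolding bind_nonempty[OF not_empty] D_def K0_def[symmetric] by (rule emeasure_join[of D K0 B, unfolded D_def]) (use B K0 in auto)
  also have "\<dots> \<le> (\<integral>\<^sup>+M'. c \<partial>D)" by (rule nn_integral_mono_AE[OF ae])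
  also have "\<dots> = c * emeasure D (space D)" by simp
  also have "\<dots> \<le> c * 1"
  proof (rule mult_left_mono)
    show "emeasure D (space D) \<le> 1"
      unfolding D_def by (rule order_trans[OF emeasure_distr_le]) (rule emeasure_le_1)
  qed simp
  finally show ?thesis by simp
qed


section \<open>Spiked Gaussian laws as rotated and scaled standard laws\<close>

lemma det_one_plus_gram:
  fixes Q :: "real mat"
  assumes Q: "Q \<in> carrier_mat p r" and QQ: "transpose_mat Q * Q = 1\<^sub>m r"
  shows "Determinant.det (1\<^sub>m p + c \<cdot>\<^sub>m (Q * transpose_mat Q)) = (1 + c) ^ r"
proof -
  let ?T = "transpose_mat Q"
  have T: "?T \<in> carrier_mat r p" using Q by simp
  have cT: "(- c) \<cdot>\<^sub>m ?T \<in> carrier_mat r p" using T by simp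
  define M where "M = four_block_mat (1\<^sub>m r) ((- c) \<cdot>\<^sub>m ?T) Q (1\<^sub>m p)"
  define L where "L = four_block_mat (1\<^sub>m r) (0\<^sub>m r p) (- Q) (1\<^sub>m p)"
  have M: "M \<in> carrier_mat (r + p) (r + p)" and L: "L \<in> carrier_mat (r + p) (r + p)"
    using Q T unfolding M_def L_def by auto
  have dL: "Determinant.det L = 1"
    unfolding L_def using Q by (subst det_four_block_mat_upper_right_zero[where n = r and m = p]) auto
  have e1: "Q * ((- c) \<cdot>\<^sub>m ?T) = (- c) \<cdot>\<^sub>m (Q * ?T)" by (rule mult_smult_distrib[OF Q T])
  have e2: "(- c) \<cdot>\<^sub>m ?T * Q = (- c) \<cdot>\<^sub>m 1\<^sub>m r" unfolding QQ[symmetric] by (rule mult_smult_assoc_mat[OF T Q])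
  have "L * M = four_block_mat (1\<^sub>m r * 1\<^sub>m r + 0\<^sub>m r p * Q) (1\<^sub>m r * ((- c) \<cdot>\<^sub>m ?T) + 0\<^sub>m r p * 1\<^sub>m p)
      (- Q * 1\<^sub>m r + 1\<^sub>m p * Q) (- Q * ((- c) \<cdot>\<^sub>m ?T) + 1\<^sub>m p * 1\<^sub>m p)"
    unfolding L_def M_def by (rule mult_four_block_mat) (use Q T in auto)
  also have "\<dots> = four_block_mat (1\<^sub>m r) ((- c) \<cdot>\<^sub>m ?T) (0\<^sub>m p r) (1\<^sub>m p + c \<cdot>\<^sub>m (Q * ?T))"
  proof (intro cong_four_block_mat)
    show "- Q * 1\<^sub>m r + 1\<^sub>m p * Q = 0\<^sub>m p r" using Q by (intro eq_matI) auto
    have "- Q * ((- c) \<cdot>\<^sub>m ?T) = c \<cdot>\<^sub>m (Q * ?T)"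
      using Q T e1 by (intro eq_matI) (auto simp: uminus_mult_left_mat[OF _] )
    then show "- Q * ((- c) \<cdot>\<^sub>m ?T) + 1\<^sub>m p * 1\<^sub>m p = 1\<^sub>m p + c \<cdot>\<^sub>m (Q * ?T)"
      using Q T by (intro eq_matI) auto
  qed (use Q T in \<open>auto intro!: eq_matI\<close>)
  finally have "Determinant.det (L * M) = Determinant.det (1\<^sub>m p + c \<cdot>\<^sub>m (Q * ?T))"
    using Q T cT by (simp add: det_four_block_mat_lower_left_zero[where n = r and m = p])
  then have 1: "Determinant.det M = Determinant.det (1\<^sub>m p + c \<cdot>\<^sub>m (Q * ?T))"
    using det_mult[OF L M] dL by simp
  have "M * L = four_block_mat (1\<^sub>m r * 1\<^sub>m r + ((- c) \<cdot>\<^sub>m ?T) * (- Q)) (1\<^sub>m r * 0\<^sub>m r p + ((- c) \<cdot>\<^sub>m ?T) * 1\<^sub>m p)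
      (Q * 1\<^sub>m r + 1\<^sub>m p * (- Q)) (Q * 0\<^sub>m r p + 1\<^sub>m p * 1\<^sub>m p)"
    unfolding L_def M_def by (rule mult_four_block_mat) (use Q T in auto)
  also have "\<dots> = four_block_mat ((1 + c) \<cdot>\<^sub>m 1\<^sub>m r) ((- c) \<cdot>\<^sub>m ?T) (0\<^sub>m p r) (1\<^sub>m p)"
  proof (intro cong_four_block_mat)
    have "((- c) \<cdot>\<^sub>m ?T) * (- Q) = - (((- c) \<cdot>\<^sub>m ?T) * Q)" using Q T by (intro uminus_mult_right_mat) auto
    then show "1\<^sub>m r * 1\<^sub>m r + ((- c) \<cdot>\<^sub>m ?T) * (- Q) = (1 + c) \<cdot>\<^sub>m 1\<^sub>m r"
      unfolding e2 by (intro eq_matI) (auto simp: algebra_simps)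
    show "Q * 1\<^sub>m r + 1\<^sub>m p * (- Q) = 0\<^sub>m p r" using Q by (intro eq_matI) auto
  qed (use Q T in \<open>auto intro!: eq_matI\<close>)
  finally have "Determinant.det (M * L) = Determinant.det ((1 + c) \<cdot>\<^sub>m 1\<^sub>m r)"
    using Q T cT by (simp add: det_four_block_mat_lower_left_zero[where n = r and m = p])
  then have "Determinant.det M = (1 + c) ^ r"
    using det_mult[OF M L] dL by (simp add: det_smult)
  with 1 show ?thesis by simp
qed

text \<open>\<open>W\<close> is an orthogonal projection, so (1 + a W)(1 + b W) = 1 + (a + b + a b)
  W. The coefficient vanishes for a = d / (1 - d) and b = -d, which is why the spike is parametrised
  in this way.\<close>

lemma inverse_one_plus_gram:
  fixes Q :: "real mat"
  assumes Q: "Q \<in> carrier_mat p r" and QQ: "transpose_mat Q * Q = 1\<^sub>m r" and d: "d < 1"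
  defines "W \<equiv> Q * transpose_mat Q"
  shows "(1\<^sub>m p + (d / (1 - d)) \<cdot>\<^sub>m W) * (1\<^sub>m p + (- d) \<cdot>\<^sub>m W) = 1\<^sub>m p"
    "(1\<^sub>m p + (- d) \<cdot>\<^sub>m W) * (1\<^sub>m p + (d / (1 - d)) \<cdot>\<^sub>m W) = 1\<^sub>m p"
proof -
  let ?T = "transpose_mat Q"
  have T: "?T \<in> carrier_mat r p" using Q by simp
  have W: "W \<in> carrier_mat p p" using Q by (simp add: W_def)
  have "W * W = Q * (?T * (Q * ?T))" unfolding W_def using Q T by (intro assoc_mult_mat) auto
  also have "?T * (Q * ?T) = ?T * Q * ?T" using Q T by (intro assoc_mult_mat[symmetric]) auto
  also have "\<dots> = ?T" unfolding QQ using T by simp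
  finally have WW: "W * W = W" by (simp add: W_def)
  have prod: "(1\<^sub>m p + a \<cdot>\<^sub>m W) * (1\<^sub>m p + b \<cdot>\<^sub>m W) = 1\<^sub>m p + (a + b + a * b) \<cdot>\<^sub>m W" for a b :: real
  proof -
    have aW: "a \<cdot>\<^sub>m W \<in> carrier_mat p p" "b \<cdot>\<^sub>m W \<in> carrier_mat p p" using W by auto
    have "(1\<^sub>m p + a \<cdot>\<^sub>m W) * (1\<^sub>m p + b \<cdot>\<^sub>m W) = (1\<^sub>m p + b \<cdot>\<^sub>m W) + a \<cdot>\<^sub>m W * (1\<^sub>m p + b \<cdot>\<^sub>m W)"
      using aW by (subst add_mult_distrib_mat[of _ p p _ _ p]) auto
    also have "a \<cdot>\<^sub>m W * (1\<^sub>m p + b \<cdot>\<^sub>m W) = a \<cdot>\<^sub>m W + a \<cdot>\<^sub>m W * (b \<cdot>\<^sub>m W)"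
      using aW by (subst mult_add_distrib_mat[of _ p p _ p]) auto
    also have "a \<cdot>\<^sub>m W * (b \<cdot>\<^sub>m W) = (a * b) \<cdot>\<^sub>m W"
    proof -
      have "a \<cdot>\<^sub>m W * (b \<cdot>\<^sub>m W) = b \<cdot>\<^sub>m (a \<cdot>\<^sub>m W * W)" by (rule mult_smult_distrib[OF aW(1) W])
      also have "a \<cdot>\<^sub>m W * W = a \<cdot>\<^sub>m (W * W)" by (rule mult_smult_assoc_mat[OF W W])
      finally show ?thesis unfolding WW using W by (auto intro!: eq_matI)
    qed
    also have "(1\<^sub>m p + b \<cdot>\<^sub>m W) + (a \<cdot>\<^sub>m W + (a * b) \<cdot>\<^sub>m W) = 1\<^sub>m p + (a + b + a * b) \<cdot>\<^sub>m W"
      using W by (intro eq_matI) (auto simp: algebra_simps)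
    finally show ?thesis .
  qed
  have z: "1\<^sub>m p + 0 \<cdot>\<^sub>m W = 1\<^sub>m p" using W by (intro eq_matI) auto
  have "d / (1 - d) + - d + d / (1 - d) * - d = 0" "- d + d / (1 - d) + - d * (d / (1 - d)) = 0"
    using d by (simp_all add: field_simps)
  then show "(1\<^sub>m p + (d / (1 - d)) \<cdot>\<^sub>m W) * (1\<^sub>m p + (- d) \<cdot>\<^sub>m W) = 1\<^sub>m p"
    "(1\<^sub>m p + (- d) \<cdot>\<^sub>m W) * (1\<^sub>m p + (d / (1 - d)) \<cdot>\<^sub>m W) = 1\<^sub>m p"
    unfolding prod using z by simp_all
qed


text \<open>Once the earlier vectors are axes, orthogonality makes the next vector vanish in their
  coordinates. It is then turned onto its own axis by rotations of the coordinates from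
  \<open>r\<close> on, which fix the earlier axes.\<close>

lemma rotate_frame_to_axes:
  fixes q :: "nat \<Rightarrow> nat \<Rightarrow> real"
  assumes orth: "\<And>k l. k < r \<Longrightarrow> l < r \<Longrightarrow> (\<Sum>j<p. q k j * q l j) = (if k = l then 1 else 0)" and r: "r \<le> p"
  shows "\<exists>gs. valid_list {..<p} gs \<and> (\<forall>k<r. \<forall>j<p. act (\<lambda>j. j) gs (q k) j = (if j = k then 1 else 0))"
  using assms
proof (induction r)
  case 0
  show ?case by (intro exI[of _ "[]"]) simp
next
  case (Suc r)
  then obtain gs where gs: "valid_list {..<p} gs"
    and axes: "\<And>k j. k < r \<Longrightarrow> j < p \<Longrightarrow> act (\<lambda>j. j) gs (q k) j = (if j = k then 1 else 0)"
    by (metis less_SucI Suc_leD)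
  have dot: "(\<Sum>j<p. act (\<lambda>j. j) gs x j * act (\<lambda>j. j) gs y j) = (\<Sum>j<p. x j * y j)" for x y
    by (rule act_dot[OF finite_lessThan gs]) auto
  let ?y = "act (\<lambda>j. j) gs (q r)"
  have y0: "?y k = 0" if k: "k < r" for k
  proof -
    have "(\<Sum>j<p. act (\<lambda>j. j) gs (q k) j * ?y j) = (\<Sum>j<p. if j = k then ?y j else 0)"
      using axes[OF k] by (intro sum.cong) auto
    also have "\<dots> = ?y k" using k Suc.prems(2) by simp
    finally show ?thesis using dot[of "q k" "q r"] Suc.prems(1)[of k r] k by simp
  qed
  have "(\<Sum>j\<in>{r..<p}. (?y j)\<^sup>2) = (\<Sum>j<p. ?y j * ?y j)"
    using y0 by (intro sum.mono_neutral_cong_left) (auto simp: power2_eq_square)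
  also have "\<dots> = 1" using dot[of "q r" "q r"] Suc.prems(1)[of r r] by simp
  finally have norm: "(\<Sum>j\<in>{r..<p}. (?y j)\<^sup>2) = 1" .
  have "r \<in> {r..<p}" using Suc.prems(2) by simp
  then obtain hs where hs: "valid_list {r..<p} hs"
    and ax: "\<forall>j\<in>{r..<p}. act (\<lambda>j. j) hs ?y j = (if j = r then sqrt (\<Sum>j\<in>{r..<p}. (?y j)\<^sup>2) else 0)"
    using rotate_to_axis[of "{r..<p}" r ?y] by blast
  have "act (\<lambda>j. j) (gs @ hs) (q k) j = (if j = k then 1 else 0)" if kj: "k < Suc r" "j < p" for k j
  proof (cases "k = r")
    case True
    show ?thesis
    proof (cases "j < r")
      case True
      then have "act (\<lambda>j. j) hs ?y j = ?y j" by (intro act_outside[OF hs]) auto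
      then show ?thesis using True \<open>k = r\<close> y0 by (simp add: act_append)
    next
      case False
      then show ?thesis using bspec[OF ax, of j] kj norm \<open>k = r\<close> by (simp add: act_append)
    qed
  next
    case False
    then have k: "k < r" using kj by simp
    have "act (\<lambda>j. j) hs (act (\<lambda>j. j) gs (q k)) = act (\<lambda>j. j) gs (q k)"
      by (rule act_zero[OF hs]) (use axes[OF k] k in auto)
    then show ?thesis using axes[OF k kj(2)] by (simp add: act_append)
  qed
  moreover have "valid_list {..<p} hs" by (rule valid_list_mono[OF hs]) auto
  then have "valid_list {..<p} (gs @ hs)" using gs by simp
  ultimately show ?case by blast
qed

text \<open>In coordinates where the columns of \<open>Q\<close> are the first \<open>r\<close> axes
  the covariance is diagonal, with variance 1 / (1 - d) on these axes and 1 elsewhere. The spiked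
  law is therefore a rotation of a scaled standard law; the two are matched through their
  densities.\<close>

lemma spiked_gaussian_law:
  fixes Q :: "real mat"
  assumes Q: "Q \<in> stiefel p r" and r: "r \<le> p" and d: "0 \<le> d" "d < 1"
  defines "S \<equiv> 1\<^sub>m p + (d / (1 - d)) \<cdot>\<^sub>m (Q * transpose_mat Q)"
  shows "\<exists>gs. valid_list {..<p} gs \<and>
    (\<lambda>z. act (\<lambda>j. j) gs (scale_on {..<r} (1 / sqrt (1 - d)) z)) \<in> measurable (std_gauss {..<p}) (std_gauss {..<p}) \<and>
    gaussian p S = distr (std_gauss {..<p}) (std_gauss {..<p}) (\<lambda>z. act (\<lambda>j. j) gs (scale_on {..<r} (1 / sqrt (1 - d)) z))"
proof -
  let ?L = "lborel_fun {..<p}" and ?G = "std_gauss {..<p}" and ?D = "scale_on {..<r} (1 / sqrt (1 - d))"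
  from Q have Qc: "Q \<in> carrier_mat p r" and QQ: "transpose_mat Q * Q = 1\<^sub>m r" by (auto simp: stiefel_def)
  define q where "q k j = (if j < p then Q $$ (j, k) else 0)" for k j
  have "(\<Sum>j<p. q k j * q l j) = (if k = l then 1 else 0)" if "k < r" "l < r" for k l
  proof -
    have "(transpose_mat Q * Q) $$ (k, l) = (\<Sum>j<p. Q $$ (j, k) * Q $$ (j, l))"
      using Qc that by (simp add: scalar_prod_def atLeast0LessThan)
    then show ?thesis unfolding QQ using that by (simp add: q_def)
  qed
  from rotate_frame_to_axes[OF this r] obtain hs where hs: "valid_list {..<p} hs"
    and axes: "\<And>k j. k < r \<Longrightarrow> j < p \<Longrightarrow> act (\<lambda>j. j) hs (q k) j = (if j = k then 1 else 0)" by blast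
  \<comment> \<open>\<open>hs\<close> takes the columns of \<open>Q\<close> to the axes, so its
    inverse carries the diagonal law to the spiked one.\<close>
  define gs where "gs = rev (map inverse_givens hs)"
  have gs: "valid_list {..<p} gs" unfolding gs_def by (rule act_inverse(3)[OF hs])
  let ?T = "act (\<lambda>j. j) hs" and ?T' = "act (\<lambda>j. j) gs"
  have TT: "?T (?T' y) = y" for y unfolding gs_def by (rule act_inverse(2)[OF hs])
  have dot: "(\<Sum>j<p. ?T x j * ?T y j) = (\<Sum>j<p. x j * y j)" for x y
    by (rule act_dot[OF finite_lessThan hs]) auto
  have T': "?T' \<in> measurable ?L ?L" "distr ?L ?L ?T' = ?L"
    using act_lborel_fun[OF finite_lessThan gs, of "\<lambda>j. j"] by auto
  let ?W = "Q * transpose_mat Q"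
  let ?P = "1\<^sub>m p + (- d) \<cdot>\<^sub>m ?W"
  have S: "S \<in> carrier_mat p p" and P: "?P \<in> carrier_mat p p" using Qc by (auto simp: S_def)
  define K where "K = sqrt ((1 - d) ^ r) / sqrt ((2 * pi) ^ p)"
  define F where "F x = ennreal (K * exp (- ((\<Sum>j<p. (x j)\<^sup>2) - d * (\<Sum>k<r. (\<Sum>j<p. q k j * x j)\<^sup>2)) / 2))" for x :: "nat \<Rightarrow> real"
  define H where "H y = ennreal (K * exp (- ((\<Sum>j<p. (y j)\<^sup>2) - d * (\<Sum>k<r. (y k)\<^sup>2)) / 2))" for y :: "nat \<Rightarrow> real"
  have detS: "Determinant.det S = 1 / (1 - d) ^ r"
  proof -
    have "1 + d / (1 - d) = 1 / (1 - d)" using d by (simp add: field_simps)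
    then show ?thesis unfolding S_def det_one_plus_gram[OF Qc QQ] by (simp add: power_divide)
  qed
  have quad: "(\<Sum>j<p. x j * (\<Sum>k<p. ?P $$ (j, k) * x k)) = (\<Sum>j<p. (x j)\<^sup>2) - d * (\<Sum>k<r. (\<Sum>j<p. q k j * x j)\<^sup>2)" for x
  proof -
    have W: "?W $$ (j, k) = (\<Sum>i<r. q i j * q i k)" if "j < p" "k < p" for j k
      using that Qc by (simp add: scalar_prod_def atLeast0LessThan q_def)
    have "(\<Sum>k<p. ?P $$ (j, k) * x k) = x j - d * (\<Sum>i<r. q i j * (\<Sum>k<p. q i k * x k))" if j: "j < p" for j
    proof -
      have "(\<Sum>k<p. ?P $$ (j, k) * x k) = (\<Sum>k<p. (if k = j then x k else 0) - d * ((\<Sum>i<r. q i j * q i k) * x k))"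
        using j Qc by (intro sum.cong refl) (simp add: W[symmetric] left_diff_distrib)
      also have "\<dots> = x j - d * (\<Sum>k<p. (\<Sum>i<r. q i j * q i k) * x k)"
        using j by (simp add: sum_subtractf sum_distrib_left)
      also have "(\<Sum>k<p. (\<Sum>i<r. q i j * q i k) * x k) = (\<Sum>i<r. q i j * (\<Sum>k<p. q i k * x k))"
        unfolding sum_distrib_right sum_distrib_left by (subst sum.swap) (simp add: mult.assoc)
      finally show ?thesis .
    qed
    then have "(\<Sum>j<p. x j * (\<Sum>k<p. ?P $$ (j, k) * x k)) = (\<Sum>j<p. (x j)\<^sup>2 - d * (\<Sum>i<r. (q i j * x j) * (\<Sum>k<p. q i k * x k)))"
      by (intro sum.cong refl) (simp add: right_diff_distrib power2_eq_square sum_distrib_left ac_simps)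
    also have "\<dots> = (\<Sum>j<p. (x j)\<^sup>2) - d * (\<Sum>i<r. \<Sum>j<p. (q i j * x j) * (\<Sum>k<p. q i k * x k))"
      by (simp only: sum_subtractf sum_distrib_left[symmetric]) (subst sum.swap, simp)
    also have "(\<Sum>i<r. \<Sum>j<p. (q i j * x j) * (\<Sum>k<p. q i k * x k)) = (\<Sum>i<r. (\<Sum>j<p. q i j * x j)\<^sup>2)"
      by (simp only: sum_distrib_right[symmetric] power2_eq_square)
    finally show ?thesis .
  qed
  have gS: "gaussian p S = density ?L F"
  proof -
    have "exp t / sqrt ((2 * pi) ^ p * Determinant.det S) = K * exp t" for t
      unfolding detS K_def by (simp add: real_sqrt_mult real_sqrt_divide)
    then show ?thesis
      unfolding gaussian_density[OF S P inverse_one_plus_gram[OF Qc QQ d(2), folded S_def]] quad F_def by simp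
  qed
  \<comment> \<open>Pulled back along the rotation, projections on the columns of \<open>Q\<close>
    become the first \<open>r\<close> coordinates.\<close>
  have FH: "F (?T' y) = H y" for y
  proof -
    have "(\<Sum>j<p. q k j * ?T' y j) = y k" if k: "k < r" for k
    proof -
      have "(\<Sum>j<p. q k j * ?T' y j) = (\<Sum>j<p. ?T (q k) j * y j)" using dot[of "q k" "?T' y"] by (simp add: TT)
      also have "\<dots> = (\<Sum>j<p. if j = k then y j else 0)" using axes[OF k] by (intro sum.cong) auto
      also have "\<dots> = y k" using k r by simp
      finally show ?thesis .
    qed
    moreover have "(\<Sum>j<p. (?T' y j)\<^sup>2) = (\<Sum>j<p. (y j)\<^sup>2)"
      using dot[of "?T' y" "?T' y"] by (simp add: TT power2_eq_square)
    ultimately show ?thesis by (simp add: F_def H_def)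
  qed
  have c[measurable]: "(\<lambda>x. x j) \<in> borel_measurable ?L" if "j < p" for j
    using that measurable_component_singleton[of j "{..<p}" "\<lambda>_. lborel :: real measure"] by (simp add: measurable_lborel1)
  have Fm: "F \<in> borel_measurable ?L"
    unfolding F_def
    by (intro measurable_compose[OF _ measurable_ennreal] borel_measurable_times borel_measurable_const
        measurable_compose[OF _ borel_measurable_exp] borel_measurable_divide borel_measurable_uminus borel_measurable_diff
        borel_measurable_sum borel_measurable_power c) auto
  note D = distr_std_gauss_scale[OF finite_lessThan, of "{..<r}" p d]
  have Dm: "?D \<in> measurable ?G ?G" using D(1) r d by auto
  have T'm: "?T' \<in> measurable ?G ?G" using T'(1) by (simp cong: measurable_cong_sets add: sets_std_gauss)
  have Hm: "H \<in> borel_measurable ?L"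
    unfolding FH[symmetric] by (rule measurable_compose[OF T'(1) Fm])
  have GH: "density ?L H = distr ?G ?G ?D"
  proof -
    define \<phi> where "\<phi> y = ennreal ((1 / sqrt (2 * pi)) ^ card {..<p} * exp (- (\<Sum>i<p. (y i)\<^sup>2) / 2))" for y :: "nat \<Rightarrow> real"
    define \<rho> where "\<rho> y = (\<Prod>x\<in>{..<r}. ennreal (scale_density d (y x)))" for y :: "nat \<Rightarrow> real"
    have "H y = \<phi> y * \<rho> y" for y
    proof -
      have 1: "\<rho> y = ennreal (sqrt (1 - d) ^ r * exp (d * (\<Sum>k<r. (y k)\<^sup>2) / 2))"
        using d by (simp add: \<rho>_def prod_ennreal scale_density_def prod.distrib exp_sum[symmetric] sum_distrib_left sum_divide_distrib)
      have 2: "K = (1 / sqrt (2 * pi)) ^ card {..<p} * sqrt (1 - d) ^ r"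
        by (simp only: K_def real_sqrt_power power_divide power_one card_lessThan) simp
      have 3: "exp (- ((\<Sum>j<p. (y j)\<^sup>2) - d * (\<Sum>k<r. (y k)\<^sup>2)) / 2) =
        exp (- (\<Sum>i<p. (y i)\<^sup>2) / 2) * exp (d * (\<Sum>k<r. (y k)\<^sup>2) / 2)"
        by (simp add: exp_add[symmetric] diff_divide_distrib)
      show ?thesis
        unfolding H_def 1 2 3 \<phi>_def using d by (subst ennreal_mult'[symmetric]) (auto simp: ac_simps)
    qed
    then have "H = (\<lambda>y. \<phi> y * \<rho> y)" by (rule ext)
    moreover have "?G = density ?L \<phi>" unfolding \<phi>_def by (rule std_gauss_density) simp
    moreover have "\<phi> \<in> borel_measurable ?L" unfolding \<phi>_def
      by (intro measurable_compose[OF _ measurable_ennreal] borel_measurable_times borel_measurable_const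
        measurable_compose[OF _ borel_measurable_exp] borel_measurable_divide borel_measurable_uminus
        borel_measurable_sum borel_measurable_power c) auto
    moreover have "\<rho> \<in> borel_measurable ?L"
      unfolding \<rho>_def using r
      by (intro borel_measurable_prod_ennreal measurable_compose[OF _ measurable_ennreal]
          measurable_compose[OF c borel_measurable_scale_density]) auto
    ultimately have "density ?L H = density ?G \<rho>" by (simp add: density_density_eq)
    also have "\<dots> = distr ?G ?G ?D" using D(2) r d by (simp add: \<rho>_def[abs_def])
    finally show ?thesis .
  qed
  have "gaussian p S = density (distr ?L ?L ?T') F" unfolding gS T'(2) ..
  also have "\<dots> = distr (density ?L (\<lambda>y. F (?T' y))) ?L ?T'" by (rule density_distr[OF Fm T'(1)])
  also have "\<dots> = distr (distr ?G ?G ?D) ?L ?T'" unfolding FH using GH by simp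
  also have "\<dots> = distr (distr ?G ?G ?D) ?G ?T'" by (intro distr_cong) (simp_all add: sets_std_gauss)
  also have "\<dots> = distr ?G ?G (?T' \<circ> ?D)" by (rule distr_distr[OF T'm Dm])
  finally have "gaussian p S = distr ?G ?G (\<lambda>z. ?T' (?D z))" by (simp add: comp_def)
  moreover have "(\<lambda>z. ?T' (?D z)) \<in> measurable ?G ?G" by (rule measurable_compose[OF Dm T'm])
  ultimately show ?thesis using gs by blast
qed

lemma opn_scale_columns:
  assumes np: "n \<ge> 1" "p \<ge> 1" and \<kappa>: "1 \<le> \<kappa>"
  shows "opn n p (\<lambda>i. scale_on S \<kappa> (M i)) \<le> \<kappa> * opn n p M"
proof (rule opn_le[OF np])
  fix u v assume u: "u \<in> sphere_vec n" and v: "v \<in> sphere_vec p"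
  have "bil n p (\<lambda>i. scale_on S \<kappa> (M i)) u v = bil n p M u (scale_on S \<kappa> v)"
    unfolding bil_def by (intro sum.cong) (auto simp: scale_on_def)
  also have "\<dots> \<le> opn n p M * (sqrt (\<Sum>i<n. (u i)\<^sup>2) * sqrt (\<Sum>j<p. (scale_on S \<kappa> v j)\<^sup>2))" by (rule bil_le[OF np])
  also have "\<dots> \<le> opn n p M * (1 * \<kappa>)"
  proof (intro mult_left_mono mult_mono opn_nonneg np)
    have "(scale_on S \<kappa> v j)\<^sup>2 \<le> \<kappa>\<^sup>2 * (v j)\<^sup>2" for j
      using \<kappa> mult_right_mono[of 1 "\<kappa>\<^sup>2" "(v j)\<^sup>2"] by (auto simp: scale_on_def power_mult_distrib)
    then have "(\<Sum>j<p. (scale_on S \<kappa> v j)\<^sup>2) \<le> \<kappa>\<^sup>2 * (\<Sum>j<p. (v j)\<^sup>2)"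
      unfolding sum_distrib_left by (rule sum_mono)
    then show "sqrt (\<Sum>j<p. (scale_on S \<kappa> v j)\<^sup>2) \<le> \<kappa>"
      using sphere_vecD(2)[OF v] \<kappa> by (intro real_le_lsqrt) auto
  qed (use sphere_vecD(2)[OF u] \<kappa> in \<open>auto simp: sum_nonneg\<close>)
  finally show "bil n p (\<lambda>i. scale_on S \<kappa> (M i)) u v \<le> \<kappa> * opn n p M" by (simp add: mult.commute)
qed

text \<open>Each observation is a common rotation of a scaled standard vector. The rotation leaves
  the operator norm unchanged, and scaling multiplies it by at most 1 / sqrt (1 - d), so reaching
  \<open>T\<close> under the spike requires a null eigenvalue of at least (1 - d) T. The bound does
  not depend on \<open>Q\<close>.\<close>

lemma spiked_rejection_le:
  assumes np: "n \<ge> 1" "p \<ge> 1" and Q: "Q \<in> stiefel p r" and r: "r \<le> p" and d: "0 \<le> d" "d < 1"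
    and B: "B \<in> sets (law_H0 n p)" and BT: "\<And>X. X \<in> B \<Longrightarrow> T \<le> lambda1 n p X"
  defines "S \<equiv> 1\<^sub>m p + (d / (1 - d)) \<cdot>\<^sub>m (Q * transpose_mat Q)"
  shows "emeasure (PiM {..<n} (\<lambda>_. gaussian p S)) B \<le>
      emeasure (law_H0 n p) {X \<in> space (law_H0 n p). (1 - d) * T \<le> lambda1 n p X}"
    and "sets (PiM {..<n} (\<lambda>_. gaussian p S)) = sets (law_H0 n p)"
proof -
  let ?G = "std_gauss {..<p}" and ?\<kappa> = "1 / sqrt (1 - d)"
  have law: "law_H0 n p = PiM {..<n} (\<lambda>_. ?G)" by (simp add: law_H0_def gaussian_identity)
  obtain gs where gs: "valid_list {..<p} gs"
    and gm: "(\<lambda>z. act (\<lambda>j. j) gs (scale_on {..<r} ?\<kappa> z)) \<in> measurable ?G ?G"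
    and gd: "gaussian p S = distr ?G ?G (\<lambda>z. act (\<lambda>j. j) gs (scale_on {..<r} ?\<kappa> z))"
    using spiked_gaussian_law[OF Q r d] unfolding S_def by blast
  let ?g = "\<lambda>z. act (\<lambda>j. j) gs (scale_on {..<r} ?\<kappa> z)"
  have eq: "PiM {..<n} (\<lambda>_. gaussian p S) = distr (law_H0 n p) (law_H0 n p) (compose {..<n} ?g)"
    unfolding law gd by (rule distr_PiM_finite_prob_space'[symmetric]) (use gm prob_space_std_gauss in auto)
  show "sets (PiM {..<n} (\<lambda>_. gaussian p S)) = sets (law_H0 n p)" unfolding eq by simp
  have cm: "compose {..<n} ?g \<in> measurable (law_H0 n p) (law_H0 n p)"
    unfolding law compose_def
    by (intro measurable_restrict, rule measurable_compose[OF _ gm], rule measurable_component_singleton)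
  have \<kappa>: "1 \<le> ?\<kappa>" "?\<kappa>\<^sup>2 = 1 / (1 - d)" using d by (auto simp: power_divide)
  have le: "lambda1 n p (compose {..<n} ?g X) \<le> lambda1 n p X / (1 - d)" for X
  proof -
    have "opn n p (compose {..<n} ?g X) = opn n p (\<lambda>i. act (\<lambda>j. j) gs (scale_on {..<r} ?\<kappa> (X i)))"
      by (rule opn_cong) (simp add: compose_def)
    also have "\<dots> = opn n p (\<lambda>i. scale_on {..<r} ?\<kappa> (X i))" by (rule opn_act[OF np gs])
    also have "\<dots> \<le> ?\<kappa> * opn n p X" by (rule opn_scale_columns[OF np \<kappa>(1)])
    finally have "(opn n p (compose {..<n} ?g X))\<^sup>2 \<le> (?\<kappa> * opn n p X)\<^sup>2"
      using opn_nonneg[OF np] by (intro power_mono)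
    also have "\<dots> = (opn n p X)\<^sup>2 / (1 - d)" unfolding power_mult_distrib \<kappa>(2) by simp
    finally have "(opn n p (compose {..<n} ?g X))\<^sup>2 / real n \<le> (opn n p X)\<^sup>2 / (1 - d) / real n"
      by (rule divide_right_mono) simp
    then show ?thesis unfolding lambda1_eq_opn[OF np] by (simp add: mult.commute)
  qed
  have "emeasure (PiM {..<n} (\<lambda>_. gaussian p S)) B = emeasure (law_H0 n p) (compose {..<n} ?g -` B \<inter> space (law_H0 n p))"
    unfolding eq by (rule emeasure_distr[OF cm B])
  also have "\<dots> \<le> emeasure (law_H0 n p) {X \<in> space (law_H0 n p). (1 - d) * T \<le> lambda1 n p X}"
  proof (rule emeasure_mono)
    show "{X \<in> space (law_H0 n p). (1 - d) * T \<le> lambda1 n p X} \<in> sets (law_H0 n p)"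
      using borel_measurable_lambda1[OF np] by measurable
    show "compose {..<n} ?g -` B \<inter> space (law_H0 n p) \<subseteq> {X \<in> space (law_H0 n p). (1 - d) * T \<le> lambda1 n p X}"
    proof
      fix X assume X: "X \<in> compose {..<n} ?g -` B \<inter> space (law_H0 n p)"
      then have "T \<le> lambda1 n p X / (1 - d)" using le[of X] BT[of "compose {..<n} ?g X"] by auto
      then have "(1 - d) * T \<le> lambda1 n p X" using d by (simp add: field_simps)
      then show "X \<in> {X \<in> space (law_H0 n p). (1 - d) * T \<le> lambda1 n p X}" using X by simp
    qed
  qed
  finally show "emeasure (PiM {..<n} (\<lambda>_. gaussian p S)) B \<le>
      emeasure (law_H0 n p) {X \<in> space (law_H0 n p). (1 - d) * T \<le> lambda1 n p X}" .
qed

text \<open>With null mean \<mu> and deviation \<sigma>, the assumptions d \<le> 1/2 and d \<mu>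
  \<le> t \<sigma> / 4 keep the reduced threshold (1 - d) (\<mu> + t \<sigma>) at least \<mu> + t
  \<sigma> / 4. Chebyshev then gives 16 / t^2 for every \<open>Q\<close>, hence for the
  mixture.\<close>

lemma TW_power_bound:
  assumes np: "n \<ge> 1" "p \<ge> 1" and U: "uniform_on_stiefel p r U" and r: "r \<le> p" and d: "0 \<le> d" "d \<le> 1 / 2"
    and sd: "0 < top_eig_sd n p" and t: "0 < (3 * ln (real n)) powr (2/3)"
    and small: "d * top_eig_mean n p \<le> (3 * ln (real n)) powr (2/3) * top_eig_sd n p / 4"
  shows "TW_power n p d U \<le> 16 / ((3 * ln (real n)) powr (2/3))\<^sup>2"
proof -
  let ?t = "(3 * ln (real n)) powr (2/3)" and ?H = "law_H0 n p"
  let ?K = "\<lambda>Q. PiM {..<n} (\<lambda>_. gaussian p (1\<^sub>m p + (d / (1 - d)) \<cdot>\<^sub>m (Q * transpose_mat Q)))"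
  from U have ps: "prob_space U" and sU: "sets U = sets (stiefel_borel p r)" by (auto simp: uniform_on_stiefel_def)
  interpret U: prob_space U by fact
  have "space U = stiefel p r" using sets_eq_imp_space_eq[OF sU] by (simp add: stiefel_borel_def)
  then have QU: "Q \<in> stiefel p r" if "Q \<in> space U" for Q using that by simp
  have d1: "d < 1" using d by simp
  define T where "T = top_eig_mean n p + ?t * top_eig_sd n p"
  define B where "B = {X \<in> space ?H. ?t \<le> TW n p X}"
  have B_eq: "B = {X \<in> space ?H. T \<le> lambda1 n p X}"
    unfolding B_def T_def using sd by (auto simp: TW_def E0_lambda1[OF np] pos_le_divide_eq)
  have lm[measurable]: "lambda1 n p \<in> borel_measurable ?H" by (rule borel_measurable_lambda1[OF np])
  have B: "B \<in> sets ?H" unfolding B_eq by measurable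
  have "?t * top_eig_sd n p / 4 \<le> (1 - d) * T - top_eig_mean n p"
  proof -
    have "1 / 2 * (?t * top_eig_sd n p) \<le> (1 - d) * (?t * top_eig_sd n p)"
      using d t sd by (intro mult_right_mono) auto
    moreover have "(1 - d) * T - top_eig_mean n p = (1 - d) * (?t * top_eig_sd n p) - d * top_eig_mean n p"
      by (simp add: T_def algebra_simps)
    ultimately show ?thesis using small by linarith
  qed
  then have sub: "top_eig_mean n p + ?t / 4 * top_eig_sd n p \<le> (1 - d) * T" by simp
  have H0: "prob_space ?H" unfolding law_H0_def gaussian_identity by (intro prob_space_PiM prob_space_std_gauss)
  interpret H: prob_space ?H by fact
  have "emeasure (law_H1 n p d U) B \<le> ennreal (16 / ?t\<^sup>2)"
    unfolding law_H1_def
  proof (rule emeasure_bind_le[OF ps _ B])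
    fix Q assume Q: "Q \<in> space U"
    have BT: "T \<le> lambda1 n p X" if "X \<in> B" for X using that by (simp add: B_eq)
    note sp = spiked_rejection_le[OF np QU[OF Q] r d(1) d1 B BT]
    show "sets (?K Q) = sets ?H" by (rule sp(2))
    have "emeasure (?K Q) B \<le> emeasure ?H {X \<in> space ?H. (1 - d) * T \<le> lambda1 n p X}" by (rule sp(1))
    also have "\<dots> \<le> emeasure ?H {X \<in> space ?H. top_eig_mean n p + ?t / 4 * top_eig_sd n p \<le> lambda1 n p X}"
      using sub by (intro emeasure_mono) auto
    also have "\<dots> \<le> ennreal (1 / (?t / 4)\<^sup>2)"
      unfolding H.emeasure_eq_measure by (intro ennreal_leI lambda1_deviation[OF np _ sd]) (use t in simp)
    also have "1 / (?t / 4)\<^sup>2 = 16 / ?t\<^sup>2" by (simp add: power_divide)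
    finally show "emeasure (?K Q) B \<le> ennreal (16 / ?t\<^sup>2)" .
  qed
  moreover have "space (law_H1 n p d U) = space ?H"
    unfolding law_H1_def
  proof (rule space_bind[OF _ U.not_empty])
    fix Q assume Q: "Q \<in> space U"
    show "sets (?K Q) = sets ?H"
      by (rule spiked_rejection_le(2)[OF np QU[OF Q] r d(1) d1 B, of T]) (simp add: B_eq)
  qed
  ultimately show ?thesis
    unfolding TW_power_def TW_rejection_prob_def B_def[symmetric]
    by (simp add: B_def measure_def enn2real_leI)
qed

section \<open>Asymptotics\<close>

lemma eventually_powr_le:
  fixes a b C :: real
  assumes "a < b"
  shows "\<forall>\<^sub>F n in sequentially. C * real n powr a \<le> real n powr b"
proof -
  have "((\<lambda>n. C * real n powr (a - b)) \<longlongrightarrow> C * 0) sequentially"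
    using assms by (intro tendsto_mult tendsto_const tendsto_neg_powr filterlim_real_sequentially) auto
  then have "\<forall>\<^sub>F n in sequentially. C * real n powr (a - b) < 1"
    by (rule order_tendstoD(2)) simp
  with eventually_gt_at_top[of 0] show ?thesis
  proof eventually_elim
    case (elim n)
    have "C * real n powr a = C * real n powr (a - b) * real n powr b"
      using elim(1) by (simp add: powr_add[symmetric])
    also have "\<dots> \<le> 1 * real n powr b" using elim(2) by (intro mult_right_mono) auto
    finally show ?case by simp
  qed
qed

lemma ceiling_bounds:
  fixes x :: real
  assumes "1 \<le> x"
  shows "x \<le> real (nat \<lceil>x\<rceil>)" "real (nat \<lceil>x\<rceil>) \<le> 2 * x"
  using assms by linarith+

text \<open>All error terms are at most multiples of n^(2 \<epsilon> - 1/6). The factor n^\<epsilon>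
  in the window bound makes tails of order exp (-n^\<epsilon>), which beat the number of windows,
  and the exponent 3 \<epsilon> in \<open>m\<close> leaves a spare n^\<epsilon> over R sqrt p,
  enough to absorb the constants.\<close>

lemma eventually_edge_parameters:
  fixes \<epsilon> \<Gamma> :: real and p :: "nat \<Rightarrow> nat"
  assumes \<epsilon>: "0 < \<epsilon>" "\<epsilon> < 1 / 9" and \<Gamma>: "1 \<le> \<Gamma>"
    and p: "\<forall>n\<ge>1. n \<le> p n" and p\<Gamma>: "\<forall>\<^sub>F n in sequentially. real (p n) \<le> \<Gamma> * real n"
  shows "\<forall>\<^sub>F n in sequentially. edge_parameters n (p n) (nat \<lceil>real n powr (1 / 3)\<rceil>)
    (nat \<lceil>real n powr (1 / 3 + 3 * \<epsilon>)\<rceil>) (real n powr \<epsilon> * sqrt (real (nat \<lceil>real n powr (1 / 3)\<rceil>)))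
    (300 * real n powr (2 * \<epsilon> - 1 / 6))"
proof -
  have bad: "\<forall>\<^sub>F n in sequentially. 4 * (real n + 1) * (2 * real n powr (1 / 3) + 1) * exp (1 - real n powr \<epsilon>) \<le> 1 / 8"
    using \<epsilon>(1) by real_asymp
  note ev = eventually_powr_le
  have "\<forall>\<^sub>F n in sequentially. 16 * real n powr (1 / 3) \<le> real n powr 1" by (rule ev) simp
  moreover have "\<forall>\<^sub>F n in sequentially. 4 * real n powr 0 \<le> real n powr (1 / 3)" by (rule ev) simp
  moreover have "\<forall>\<^sub>F n in sequentially. 4 * real n powr (1 / 3 + 3 * \<epsilon>) \<le> real n powr 1"
    by (rule ev) (use \<epsilon> in simp)
  moreover have "\<forall>\<^sub>F n in sequentially. 16 * 300 * real n powr (2 * \<epsilon> - 1 / 6) \<le> real n powr (1 / 2)"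
    by (rule ev) (use \<epsilon> in simp)
  moreover have "\<forall>\<^sub>F n in sequentially. 16 * 300 * sqrt \<Gamma> * real n powr (2 * \<epsilon> + 1 / 3) \<le> real n powr (1 / 3 + 3 * \<epsilon>)"
    by (rule ev) (use \<epsilon> in simp)
  moreover have "\<forall>\<^sub>F n in sequentially. 16 * real n powr (\<epsilon> + 1 / 6) \<le> real n powr (1 / 2)"
    by (rule ev) (use \<epsilon> in simp)
  moreover note bad p\<Gamma> eventually_ge_at_top[of 16]
  ultimately show ?thesis
  proof eventually_elim
    case (elim n)
    define x where "x = real n powr (1 / 3)"
    define l where "l = nat \<lceil>x\<rceil>"
    define y where "y = real n powr (1 / 3 + 3 * \<epsilon>)"
    define m where "m = nat \<lceil>y\<rceil>"
    define \<tau> where "\<tau> = real n powr \<epsilon> * sqrt (real l)"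
    define w where "w = real n powr (2 * \<epsilon> - 1 / 6)"
    have n: "16 \<le> real n" "0 < real n" "1 \<le> real n" using elim by auto
    have x: "4 \<le> x" "16 * x \<le> real n" using elim n by (auto simp: x_def)
    have y: "1 \<le> y" "4 * y \<le> real n" using elim n \<epsilon> by (auto simp: y_def ge_one_powr_ge_zero)
    have l: "x \<le> real l" "real l \<le> 2 * x" unfolding l_def by (rule ceiling_bounds; use x in simp)+
    have m: "y \<le> real m" "real m \<le> 2 * y" unfolding m_def by (rule ceiling_bounds; use y in simp)+
    have sn: "sqrt (real n) = real n powr (1 / 2)" using n by (simp add: powr_half_sqrt)
    have sx: "sqrt x = real n powr (1 / 6)" using n by (simp add: x_def powr_half_sqrt[symmetric] powr_powr)
    have l0: "0 < real l" "sqrt x \<le> sqrt (real l)" "0 < sqrt x" using l x by auto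
    have mono: "real n powr a \<le> w" if "a \<le> 2 * \<epsilon> - 1 / 6" for a
      unfolding w_def using that n by (intro powr_mono) auto
    have t1: "4 * real l / sqrt n \<le> 8 * w"
    proof -
      have "4 * real l / sqrt n \<le> 8 * x / sqrt n" using l n by (intro divide_right_mono) auto
      also have "\<dots> = 8 * real n powr (1 / 3 - 1 / 2)" unfolding sn x_def powr_diff by simp
      also have "\<dots> \<le> 8 * w" using \<epsilon> by (intro mult_left_mono mono) auto
      finally show ?thesis .
    qed
    have t2: "\<tau>\<^sup>2 / sqrt n \<le> 2 * w"
    proof -
      have "(real n powr \<epsilon>)\<^sup>2 = real n powr (2 * \<epsilon>)"
        by (simp only: power2_eq_square powr_add[symmetric] mult_2)
      then have "\<tau>\<^sup>2 = real n powr (2 * \<epsilon>) * real l"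
        by (simp add: \<tau>_def power_mult_distrib)
      also have "\<dots> \<le> real n powr (2 * \<epsilon>) * (2 * x)" using l by (intro mult_left_mono) auto
      finally have "\<tau>\<^sup>2 / sqrt n \<le> real n powr (2 * \<epsilon>) * (2 * x) / sqrt n" by (rule divide_right_mono) simp
      also have "\<dots> = 2 * real n powr (2 * \<epsilon> + 1 / 3 - 1 / 2)"
        unfolding sn x_def using n by (simp only: powr_diff powr_add) simp
      also have "2 * \<epsilon> + 1 / 3 - 1 / 2 = 2 * \<epsilon> - 1 / 6" by simp
      finally show ?thesis by (simp add: w_def)
    qed
    have t3: "\<tau> / real l \<le> w"
    proof -
      have "\<tau> / real l = real n powr \<epsilon> / sqrt (real l)"
        using l0 by (simp add: \<tau>_def real_div_sqrt field_simps)
      also have "\<dots> \<le> real n powr \<epsilon> / sqrt x" using l0 by (intro divide_left_mono) auto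
      also have "\<dots> = real n powr (\<epsilon> - 1 / 6)" unfolding sx using n by (simp add: powr_diff)
      also have "\<dots> \<le> w" using \<epsilon> by (intro mono) auto
      finally show ?thesis .
    qed
    have t4: "3 * sqrt n / (real l)\<^sup>2 \<le> 3 * w"
    proof -
      have "3 * sqrt n / (real l)\<^sup>2 \<le> 3 * sqrt n / x\<^sup>2" using l x by (intro divide_left_mono power_mono) auto
      also have "x\<^sup>2 = real n powr (2 / 3)" by (simp add: x_def power2_eq_square powr_add[symmetric])
      also have "3 * sqrt n / real n powr (2 / 3) = 3 * real n powr (1 / 2 - 2 / 3)" unfolding sn powr_diff by simp
      also have "\<dots> \<le> 3 * w" using \<epsilon> by (intro mult_left_mono mono) auto
      finally show ?thesis .
    qed
    have \<tau>l: "\<tau> / sqrt (real l) = real n powr \<epsilon>" using l0 by (simp add: \<tau>_def)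
    have np: "n \<le> p n" using p n by simp
    have "edge_parameters n (p n) l m \<tau> (300 * w)"
    proof
      show "n \<le> p n" by fact
      have "4 * real l + 4 \<le> real n" using l x by linarith
      then show "4 * l + 4 \<le> n" by linarith
      have "4 \<le> real l" using l x by linarith
      then show "4 \<le> l" by simp
      have "0 < real m" using m y by linarith
      then show "0 < m" by simp
      have "2 * real m \<le> real n" using m y by linarith
      then show "2 * m \<le> n" by linarith
      have w0: "0 \<le> w" by (simp add: w_def)
      show "4 * real l / sqrt n + 8 * \<tau>\<^sup>2 / sqrt n + 2 * \<tau> / real l + 24 * \<tau> / real l + 3 * sqrt n / (real l)\<^sup>2 \<le> 300 * w"
      proof -
        have "8 * \<tau>\<^sup>2 / sqrt n = 8 * (\<tau>\<^sup>2 / sqrt n)" "2 * \<tau> / real l = 2 * (\<tau> / real l)" "24 * \<tau> / real l = 24 * (\<tau> / real l)" by simp_all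
        then show ?thesis using t1 t2 t3 t4 w0 by linarith
      qed
      \<comment> \<open>The binding case for the constant 300: this sum is at most (2 + 2 * 128) w =
        258 w.\<close>
      show "2 * \<tau> / real l + 128 * \<tau>\<^sup>2 / sqrt n \<le> 300 * w"
      proof -
        have "128 * \<tau>\<^sup>2 / sqrt n = 128 * (\<tau>\<^sup>2 / sqrt n)" "2 * \<tau> / real l = 2 * (\<tau> / real l)" by simp_all
        then show ?thesis using t2 t3 w0 by linarith
      qed
      show "16 * (300 * w) \<le> sqrt n" using elim(4) by (simp add: w_def sn)
      show "16 * (300 * w) * sqrt (p n) \<le> real m"
      proof -
        have "sqrt (p n) \<le> sqrt (\<Gamma> * real n)" using elim(8) by (rule real_sqrt_le_mono)
        then have "16 * (300 * w) * sqrt (p n) \<le> 16 * (300 * w) * (sqrt \<Gamma> * sqrt n)"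
          using w0 by (intro mult_left_mono) (auto simp: real_sqrt_mult)
        also have "\<dots> = 16 * 300 * sqrt \<Gamma> * (w * sqrt n)" by simp
        also have "w * sqrt n = real n powr (2 * \<epsilon> + 1 / 3)" unfolding w_def sn powr_add[symmetric] by (simp add: add.commute)
        also have "16 * 300 * sqrt \<Gamma> * real n powr (2 * \<epsilon> + 1 / 3) \<le> y" using elim(5) by (simp add: y_def)
        finally show ?thesis using m by linarith
      qed
      show "8 * \<tau> \<le> sqrt n"
      proof -
        have "sqrt (real l) \<le> sqrt (4 * x)" using l x by (intro real_sqrt_le_mono) linarith
        then have "sqrt (real l) \<le> 2 * sqrt x" by (simp add: real_sqrt_mult)
        then have "8 * \<tau> \<le> 8 * (real n powr \<epsilon> * (2 * sqrt x))"
          unfolding \<tau>_def by (intro mult_left_mono) auto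
        also have "\<dots> = 16 * real n powr (\<epsilon> + 1 / 6)" unfolding sx powr_add by simp
        finally show ?thesis using elim(6) sn by simp
      qed
      have "4 * (real n + 1) * (real l + 1) * exp (1 - \<tau> / sqrt l) \<le> 4 * (real n + 1) * (2 * x + 1) * exp (1 - real n powr \<epsilon>)"
        unfolding \<tau>l using l by (intro mult_right_mono mult_left_mono) auto
      also have "\<dots> \<le> 1 / 8" using elim(7) by (simp add: x_def)
      finally show "4 * (real n + 1) * (real l + 1) * exp (1 - \<tau> / sqrt l) \<le> 1 / 8" .
    qed
    then show ?case by (simp add: \<tau>_def l_def m_def w_def x_def y_def)
  qed
qed

text \<open>The choice \<epsilon> = (\<eta> - 2/3) / 3 makes sqrt (m p) of order n^(2/3 + 3
  \<epsilon> / 2), an exponent halfway between 2/3 and \<eta>. The remaining gap swallows every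
  constant, including \<open>C\<close>.\<close>

lemma eventually_sd_lower:
  fixes \<eta> :: real and p :: "nat \<Rightarrow> nat"
  assumes \<eta>: "2 / 3 < \<eta>" "\<eta> < 1" and p: "\<forall>n\<ge>1. n \<le> p n"
    and lim: "(\<lambda>n. real (p n) / real n) \<longlonglongrightarrow> \<gamma>" and \<gamma>: "1 \<le> \<gamma>"
  shows "\<forall>\<^sub>F n in sequentially. C * real n powr (- \<eta>) \<le> top_eig_sd n (p n) \<and>
    top_eig_mean n (p n) \<le> 16 * (\<gamma> + 1) + 2 * top_eig_sd n (p n)"
proof -
  define \<Gamma> where "\<Gamma> = \<gamma> + 1"
  define \<epsilon> where "\<epsilon> = (\<eta> - 2 / 3) / 3"
  have \<epsilon>: "0 < \<epsilon>" "\<epsilon> < 1 / 9" using \<eta> by (auto simp: \<epsilon>_def)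
  have \<Gamma>: "1 \<le> \<Gamma>" using \<gamma> by (simp add: \<Gamma>_def)
  have "\<forall>\<^sub>F n in sequentially. real (p n) / real n < \<Gamma>"
    by (rule order_tendstoD(2)[OF lim]) (simp add: \<Gamma>_def)
  with eventually_gt_at_top[of 0] have p\<Gamma>: "\<forall>\<^sub>F n in sequentially. real (p n) \<le> \<Gamma> * real n"
    by eventually_elim (simp add: field_simps)
  \<comment> \<open>320 = 8 * 40, from \<open>scale_par\<close> and from
    \<open>sd_lower_bound\<close>.\<close>
  have "\<forall>\<^sub>F n in sequentially. C * (320 * (2 * \<Gamma>)) * real n powr (2 / 3 + 3 / 2 * \<epsilon>) \<le> real n powr \<eta>"
  proof (rule eventually_powr_le)
    have "9 * \<epsilon> + 2 = 3 * \<eta>" by (simp add: \<epsilon>_def field_simps)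
    then show "2 / 3 + 3 / 2 * \<epsilon> < \<eta>" using \<eta>(1) by (simp add: field_simps)
  qed
  with eventually_edge_parameters[OF \<epsilon> \<Gamma> p p\<Gamma>] p\<Gamma> eventually_ge_at_top[of 1]
  show ?thesis
  proof eventually_elim
    case (elim n)
    define y where "y = real n powr (1 / 3 + 3 * \<epsilon>)"
    define m where "m = nat \<lceil>y\<rceil>"
    interpret edge_parameters n "p n" "nat \<lceil>real n powr (1 / 3)\<rceil>" m
      "real n powr \<epsilon> * sqrt (real (nat \<lceil>real n powr (1 / 3)\<rceil>))" "300 * real n powr (2 * \<epsilon> - 1 / 6)"
      unfolding m_def y_def by (rule elim(1))
    have n: "1 \<le> real n" using elim by simp
    have y: "1 \<le> y" using n \<epsilon> by (auto simp: y_def ge_one_powr_ge_zero)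
    have m2: "real m \<le> 2 * y" unfolding m_def by (rule ceiling_bounds(2)[OF y])
    have "real m * real (p n) \<le> 2 * y * (\<Gamma> * real n)" using m2 elim(2) y by (intro mult_mono) auto
    \<comment> \<open>The constant is enlarged to a square, so that the root below is
      explicit.\<close>
    also have "\<dots> \<le> (2 * \<Gamma>)\<^sup>2 * (y * real n)"
      using \<Gamma> y n mult_right_mono[of "2 * \<Gamma>" "(2 * \<Gamma>)\<^sup>2" "y * real n"] by (simp add: power2_eq_square algebra_simps)
    also have "\<dots> = (2 * \<Gamma> * real n powr (2 / 3 + 3 / 2 * \<epsilon>))\<^sup>2"
    proof -
      have "y * real n = real n powr (1 / 3 + 3 * \<epsilon> + 1)" using n unfolding y_def powr_add by simp
      also have "1 / 3 + 3 * \<epsilon> + 1 = (2 / 3 + 3 / 2 * \<epsilon>) + (2 / 3 + 3 / 2 * \<epsilon>)" by simp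
      also have "real n powr \<dots> = (real n powr (2 / 3 + 3 / 2 * \<epsilon>))\<^sup>2" by (simp only: powr_add power2_eq_square)
      finally show ?thesis by (simp add: power_mult_distrib)
    qed
    finally have "sqrt (real m * real (p n)) \<le> 2 * \<Gamma> * real n powr (2 / 3 + 3 / 2 * \<epsilon>)"
      using \<Gamma> by (intro real_le_lsqrt) auto
    moreover have pos: "0 < sqrt (real m * real (p n))" using m np n by simp
    ultimately have sc: "1 / (320 * (2 * \<Gamma> * real n powr (2 / 3 + 3 / 2 * \<epsilon>))) \<le> scale_par / 40"
      unfolding scale_par_def using \<Gamma> n by (simp add: field_simps)
    have "C * real n powr (- \<eta>) * (320 * (2 * \<Gamma> * real n powr (2 / 3 + 3 / 2 * \<epsilon>))) \<le> real n powr \<eta> * real n powr (- \<eta>)"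
      using mult_right_mono[OF elim(4), of "real n powr (- \<eta>)"] by (simp add: algebra_simps)
    also have "\<dots> = 1" using n by (simp add: powr_add[symmetric])
    finally have "C * real n powr (- \<eta>) \<le> 1 / (320 * (2 * \<Gamma> * real n powr (2 / 3 + 3 / 2 * \<epsilon>)))"
      using \<Gamma> n by (simp add: pos_le_divide_eq)
    then have "C * real n powr (- \<eta>) \<le> top_eig_sd n (p n)" using sc sd_lower_bound by linarith
    moreover have "16 * real (p n) / real n \<le> 16 * \<Gamma>" using elim(2) n by (simp add: field_simps)
    ultimately show ?case using mean_upper_bound by (auto simp: \<Gamma>_def)
  qed
qed

theorem corollary1p1:
  fixes \<alpha> \<beta> \<gamma> :: real and p r :: "nat \<Rightarrow> nat" and \<delta> :: "nat \<Rightarrow> real"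
    and U :: "nat \<Rightarrow> real mat measure"
  assumes "0 < \<alpha>" "\<alpha> < 1" "0 < \<beta>" "\<beta> < 1" "1 \<le> \<gamma>"
    and "\<And>n. n \<ge> 1 \<Longrightarrow> p n \<ge> n"
    and "(\<lambda>n. real (p n) / real n) \<longlonglongrightarrow> \<gamma>"
    and "\<And>n. n \<ge> 1 \<Longrightarrow>
           r n \<in> {nat \<lfloor>real n powr (1 - \<beta>)\<rfloor>, nat \<lceil>real n powr (1 - \<beta>)\<rceil>}"
    and "\<And>n. n \<ge> 1 \<Longrightarrow> \<delta> n = real n powr (- \<alpha>)"
    and "\<And>n. n \<ge> 1 \<Longrightarrow> uniform_on_stiefel (p n) (r n) (U n)"
    and "\<alpha> + \<beta> < 1"
  shows "(\<lambda>n. TW_level n (p n)) \<longlonglongrightarrow> 0 \<and>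
         (\<alpha> > 2/3 \<longrightarrow> (\<lambda>n. TW_power n (p n) (\<delta> n) (U n)) \<longlonglongrightarrow> 0)"
proof (intro conjI impI)
  let ?t = "\<lambda>n. (3 * ln (real n)) powr (2/3)"
  have t0: "(\<lambda>n. c / (?t n)\<^sup>2) \<longlonglongrightarrow> 0" for c :: real by real_asymp
  \<comment> \<open>16 is what the final comparison needs: 4 \<sigma> \<le> t \<sigma> / 4, where
    \<sigma> is the null standard deviation.\<close>
  have t1: "\<forall>\<^sub>F n in sequentially. 16 \<le> ?t n" by real_asymp
  show "(\<lambda>n. TW_level n (p n)) \<longlonglongrightarrow> 0"
  proof (rule tendsto_sandwich[OF _ _ tendsto_const t0[of 1]])
    show "\<forall>\<^sub>F n in sequentially. 0 \<le> TW_level n (p n)"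
      by (simp add: TW_level_def TW_rejection_prob_def)
    show "\<forall>\<^sub>F n in sequentially. TW_level n (p n) \<le> 1 / (?t n)\<^sup>2"
      using t1 eventually_ge_at_top[of 1]
    proof eventually_elim
      case (elim n)
      have "0 < ?t n" using elim(1) by linarith
      moreover have "p n \<ge> 1" using assms(6)[of n] elim(2) by simp
      ultimately show ?case using elim(2) by (intro TW_level_bound)
    qed
  qed
  assume \<alpha>: "\<alpha> > 2 / 3"
  show "(\<lambda>n. TW_power n (p n) (\<delta> n) (U n)) \<longlonglongrightarrow> 0"
  proof (rule tendsto_sandwich[OF _ _ tendsto_const t0[of 16]])
    show "\<forall>\<^sub>F n in sequentially. 0 \<le> TW_power n (p n) (\<delta> n) (U n)"
      by (simp add: TW_power_def TW_rejection_prob_def)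
    have "\<forall>\<^sub>F n in sequentially. 2 * real n powr (- \<alpha>) \<le> real n powr 0"
      using assms(1) by (intro eventually_powr_le) simp
    moreover have "\<forall>n\<ge>1. n \<le> p n" using assms(6) by blast
    \<comment> \<open>Used with \<eta> = \<alpha>. The factor 8 (\<gamma> + 1) is half the constant
      in the bound for the mean, so that \<delta> times the mean is at most three standard
      deviations.\<close>
    from eventually_sd_lower[OF \<alpha> assms(2) this assms(7) assms(5), of "8 * (\<gamma> + 1)"]
    have "\<forall>\<^sub>F n in sequentially. 8 * (\<gamma> + 1) * real n powr (- \<alpha>) \<le> top_eig_sd n (p n) \<and>
      top_eig_mean n (p n) \<le> 16 * (\<gamma> + 1) + 2 * top_eig_sd n (p n)" .
    moreover note t1 eventually_ge_at_top[of 1]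
    ultimately
    show "\<forall>\<^sub>F n in sequentially. TW_power n (p n) (\<delta> n) (U n) \<le> 16 / (?t n)\<^sup>2"
    proof eventually_elim
      case (elim n)
      note elim = elim(3,4,2,1)
      let ?\<sigma> = "top_eig_sd n (p n)"
      have \<delta>: "\<delta> n = real n powr (- \<alpha>)" using assms(9)[of n] elim(2) by simp
      have \<delta>0: "0 < \<delta> n" "\<delta> n \<le> 1 / 2" using elim(2,4) by (auto simp: \<delta>)
      have t: "0 < ?t n" using elim(1) by linarith
      have sd: "8 * (\<gamma> + 1) * \<delta> n \<le> ?\<sigma>" using elim(3) by (simp add: \<delta>)
      have "0 < 8 * (\<gamma> + 1) * \<delta> n" using assms(5) \<delta>0 by simp
      then have sd0: "0 < ?\<sigma>" using sd by linarith
      have rp: "r n \<le> p n"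
      proof -
        have "real n powr (1 - \<beta>) \<le> real n powr 1" using elim(2) assms(3) by (intro powr_mono) auto
        then have "real n powr (1 - \<beta>) \<le> real n" using elim(2) by simp
        then have "nat \<lceil>real n powr (1 - \<beta>)\<rceil> \<le> n" "nat \<lfloor>real n powr (1 - \<beta>)\<rfloor> \<le> n" by linarith+
        then have "r n \<le> n" using assms(8)[of n] elim(2) by auto
        then show ?thesis using assms(6)[of n] elim(2) by simp
      qed
      have "\<delta> n * top_eig_mean n (p n) \<le> \<delta> n * (16 * (\<gamma> + 1) + 2 * ?\<sigma>)"
        using elim(3) \<delta>0 by (intro mult_left_mono) auto
      also have "\<dots> = 2 * (8 * (\<gamma> + 1) * \<delta> n) + 2 * \<delta> n * ?\<sigma>" by (simp add: algebra_simps)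
      also have "\<dots> \<le> 2 * ?\<sigma> + 1 * ?\<sigma>"
        using sd \<delta>0 sd0 by (intro add_mono mult_left_mono mult_right_mono) auto
      also have "\<dots> \<le> 4 * ?\<sigma>" using sd0 by simp
      also have "\<dots> \<le> ?t n / 4 * ?\<sigma>" using elim(1) sd0 by (intro mult_right_mono) auto
      finally have small: "\<delta> n * top_eig_mean n (p n) \<le> ?t n * ?\<sigma> / 4" by simp
      have "p n \<ge> 1" using assms(6)[of n] elim(2) by simp
      then show ?case
        using elim(2) \<delta>0 rp sd0 t small assms(10)[of n]
        by (intro TW_power_bound[where r = "r n"]) auto
    qed
  qed
qed

end
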